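(* Let $\mathcal{C}>0$, let $\beta\in(0,1]$, and let $d\ge 2$ be an integer such that either $d=2$ or $d\ge h(\beta):=\max\{9,\lfloor 2+4/\beta\rfloor+1\}$. Let $X$ be a $p_n$-ERW in direction $\ell\in\mathbb{S}^{d-1}$ on $\mathbb{Z}^d$ with $p_n=\mathcal{C}n^{-\beta}\wedge 1$, and let $\mathcal{R}_n^X$ be its range. Then $$\lim_{n\to\infty}\frac{|\mathcal{R}_n^X|}{n}=\pi_d \quad\text{almost surely.}$$
   Context: Definition of the $p_n$-ERW in direction $\ell$ on $\mathbb{Z}^d$. Let $d\ge 2$, let $\ell\in\mathbb{S}^{d-1}$ (the unit sphere of $\mathbb{R}^d$), let $\|\cdot\|$ be the Euclidean norm, and let $\{p_n\}_{n\ge1}\subset(0,1]$. Let $\{\xi_i\}_{i\ge1}$ and $\{\gamma_i\}_{i\ge1}$ be sequences of $\mathbb{Z}^d$-valued random vectors on a probability space $(\Omega,\mathcal{F},\mathbb{P})$, adapted to a filtration $\{\mathcal{F}_n\}_{n\ge0}$ (with $\mathcal{F}_0$ containing all null sets), such that: (i) there is a constant $K>0$ with $\sup_{n}\|\xi_n\|\le K$ and $\sup_n\|\gamma_n\|\le K$ on every realization; (ii) there is a constant $\lambda>0$ such that for all $n\ge1$, $\mathbb{E}[\xi_n\mid\mathcal{F}_{n-1}]=0$ and $\mathbb{E}[\gamma_n\cdot\ell\mid\mathcal{F}_{n-1}]\ge\lambda$; (iii) $\{\xi_i\}$ is i.i.d. with zero mean vector and finite covariance matrix, and $\mathbb{P}[\xi_i\cdot\ell'=0]<1$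 for all $\ell'\in\mathbb{S}^{d-1}$; (iv) $\{\gamma_i\}$ is i.i.d., and the sequences $\{\xi_i\}$ and $\{\gamma_i\}$ are independent of each other. Let $\{U_i\}_{i\ge1}$ be i.i.d. uniform on $[0,1]$, independent of $(\{\xi_i\},\{\gamma_i\})$. Set $X_0=0$, $E_0=\emptyset$, and for $n\ge1$ let $E_n=\{\exists k<n:\ X_k=X_n\}$. The process $X=\{X_n\}_{n\ge0}$ is defined by $$X_n=\sum_{i=1}^n\Big(\mathbf{1}_{E_{i-1}}\xi_i+\mathbf{1}_{E_{i-1}^c\cap\{U_i>p_i\}}\xi_i+\mathbf{1}_{E_{i-1}^c\cap\{U_i\le p_i\}}\gamma_i\Big),\quad n\ge1.$$ The range is $\mathcal{R}_n^X=\{X_0,X_1,\dots,X_n\}\subset\mathbb{Z}^d$. The constant $\pi_d$ is the probability that the random walk $Y_n=\sum_{i=1}^n\xi_i$, $Y_0=0$, never returns to the origin. $a\wedge b=\min(a,b)$. *)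

theory Defs
  imports "HOL-Probability.Probability"
begin

definition real_vec :: "int ^ 'd \<Rightarrow> real ^ 'd" where
  "real_vec v = (\<chi> i. real_of_int (v $ i))"

text \<open>
  A random sequence indexed by \<open>n \<ge> 1\<close> is a function on all of \<^typ>\<open>nat\<close> whose value at \<open>0\<close>
  is never used. Lattice-valued random vectors carry the discrete \<open>\<sigma>\<close>-algebra, and a whole
  sequence is regarded as one random element of the product space over \<open>{1..}\<close>.
\<close>

abbreviation seq_space :: "'b measure \<Rightarrow> (nat \<Rightarrow> 'b) measure" where
  "seq_space S \<equiv> PiM {1..} (\<lambda>_. S)"

definition seq_of :: "(nat \<Rightarrow> 'a \<Rightarrow> 'b) \<Rightarrow> 'a \<Rightarrow> (nat \<Rightarrow> 'b)" where
  "seq_of Z \<omega> = (\<lambda>i\<in>{1..}. Z i \<omega>)"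

definition (in prob_space) iid_seq :: "'b measure \<Rightarrow> (nat \<Rightarrow> 'a \<Rightarrow> 'b) \<Rightarrow> bool" where
  "iid_seq S Z \<longleftrightarrow>
     indep_vars (\<lambda>_. S) Z {1..} \<and> (\<forall>i\<ge>1. distr M S (Z i) = distr M S (Z 1))"

text \<open>
  The library's \<^const>\<open>prob_space.indep_var\<close> needs both variables to have values in the same type.
\<close>

definition (in prob_space) indep_pair ::
  "'b measure \<Rightarrow> ('a \<Rightarrow> 'b) \<Rightarrow> 'c measure \<Rightarrow> ('a \<Rightarrow> 'c) \<Rightarrow> bool" where
  "indep_pair S A T B \<longleftrightarrow>
     random_variable S A \<and> random_variable T B \<and>
     indep_set (sets (vimage_algebra (space M) A S)) (sets (vimage_algebra (space M) B T))"

text \<open>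
  The conditional mean of the vector \<open>\<xi> n\<close> is taken coordinatewise because
  \<^const>\<open>real_cond_exp\<close> is real-valued.
\<close>

locale pn_ERW = prob_space M + filtration "space M" F
  for M :: "'a measure" and F :: "nat \<Rightarrow> 'a measure" +
  fixes l :: "real ^ 'd"
    and p :: "nat \<Rightarrow> real"
    and \<xi> \<gamma> :: "nat \<Rightarrow> 'a \<Rightarrow> int ^ 'd"
    and U :: "nat \<Rightarrow> 'a \<Rightarrow> real"
  assumes dim: "CARD('d) \<ge> 2"
    and direction: "norm l = 1"
    and p_range: "\<And>n. n \<ge> 1 \<Longrightarrow> 0 < p n \<and> p n \<le> 1"
    and F_subalgebra: "\<And>n. subalgebra M (F n)"
    and F_null: "null_sets M \<subseteq> sets (F 0)"
    and adapted_\<xi>: "\<And>n. n \<ge> 1 \<Longrightarrow> \<xi> n \<in> measurable (F n) (count_space UNIV)"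
    and adapted_\<gamma>: "\<And>n. n \<ge> 1 \<Longrightarrow> \<gamma> n \<in> measurable (F n) (count_space UNIV)"
    and bounded_steps:
      "\<exists>K>0. \<forall>n\<ge>1. \<forall>\<omega>\<in>space M. norm (real_vec (\<xi> n \<omega>)) \<le> K \<and> norm (real_vec (\<gamma> n \<omega>)) \<le> K"
    and \<xi>_cond_mean:
      "\<And>n i. n \<ge> 1 \<Longrightarrow>
         AE \<omega> in M. real_cond_exp M (F (n - 1)) (\<lambda>\<omega>. real_vec (\<xi> n \<omega>) $ i) \<omega> = 0"
    and \<gamma>_drift:
      "\<exists>c>0. \<forall>n\<ge>1. AE \<omega> in M. real_cond_exp M (F (n - 1)) (\<lambda>\<omega>. real_vec (\<gamma> n \<omega>) \<bullet> l) \<omega> \<ge> c"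
    and \<xi>_iid: "iid_seq (count_space UNIV) \<xi>"
    and \<xi>_integrable: "\<And>n. n \<ge> 1 \<Longrightarrow> integrable M (\<lambda>\<omega>. real_vec (\<xi> n \<omega>))"
    and \<xi>_mean: "\<And>n. n \<ge> 1 \<Longrightarrow> expectation (\<lambda>\<omega>. real_vec (\<xi> n \<omega>)) = 0"
    and \<xi>_finite_covariance:
      "\<And>n i j. n \<ge> 1 \<Longrightarrow> integrable M (\<lambda>\<omega>. real_vec (\<xi> n \<omega>) $ i * real_vec (\<xi> n \<omega>) $ j)"
    and \<xi>_nondegenerate:
      "\<And>n l'. n \<ge> 1 \<Longrightarrow> norm l' = 1 \<Longrightarrow> prob {\<omega> \<in> space M. real_vec (\<xi> n \<omega>) \<bullet> l' = 0} < 1"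
    and \<gamma>_iid: "iid_seq (count_space UNIV) \<gamma>"
    and \<xi>_\<gamma>_indep:
      "indep_var (seq_space (count_space UNIV)) (seq_of \<xi>) (seq_space (count_space UNIV)) (seq_of \<gamma>)"
    and U_iid: "iid_seq borel U"
    and U_uniform: "\<And>n. n \<ge> 1 \<Longrightarrow> distr M borel (U n) = uniform_measure lborel {0..1}"
    and U_indep:
      "indep_pair
         (seq_space (count_space UNIV) \<Otimes>\<^sub>M seq_space (count_space UNIV))
         (\<lambda>\<omega>. (seq_of \<xi> \<omega>, seq_of \<gamma> \<omega>))
         (seq_space borel) (seq_of U)"

text \<open>
  The walk itself. The condition \<open>\<exists>k\<in>{..<i - 1}. X\<^sub>k = X\<^bsub>i - 1\<^esub>\<close> is the event \<open>E\<^bsub>i - 1\<^esub>\<close> that the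
  current site was visited before; for \<open>i = 1\<close> it is false, so \<open>E\<^sub>0\<close> is empty.
\<close>

context
  notes sum.cong [fundef_cong] conj_cong [fundef_cong]
begin

function erw ::
  "(nat \<Rightarrow> real) \<Rightarrow> (nat \<Rightarrow> 'a \<Rightarrow> int ^ 'd) \<Rightarrow> (nat \<Rightarrow> 'a \<Rightarrow> int ^ 'd) \<Rightarrow> (nat \<Rightarrow> 'a \<Rightarrow> real)
     \<Rightarrow> nat \<Rightarrow> 'a \<Rightarrow> int ^ 'd" where
  "erw p \<xi> \<gamma> U n \<omega> =
     (\<Sum>i\<in>{1..n}.
        let E = (\<exists>k\<in>{..<i - 1}. erw p \<xi> \<gamma> U k \<omega> = erw p \<xi> \<gamma> U (i - 1) \<omega>)
        in of_bool E *s \<xi> i \<omega>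
           + of_bool (\<not> E \<and> U i \<omega> > p i) *s \<xi> i \<omega>
           + of_bool (\<not> E \<and> U i \<omega> \<le> p i) *s \<gamma> i \<omega>)"
  by pat_completeness auto
termination
  by (relation "Wellfounded.measure (\<lambda>(p, \<xi>, \<gamma>, U, n, \<omega>). n)") auto

end

declare erw.simps [simp del]

definition walk_range :: "(nat \<Rightarrow> 'a \<Rightarrow> 'b) \<Rightarrow> nat \<Rightarrow> 'a \<Rightarrow> 'b set" where
  "walk_range X n \<omega> = (\<lambda>k. X k \<omega>) ` {0..n}"

text \<open>The probability that the random walk with steps \<open>\<xi>\<^sub>1, \<xi>\<^sub>2, \<dots>\<close> never returns to the origin.\<close>

definition escape_prob :: "'a measure \<Rightarrow> (nat \<Rightarrow> 'a \<Rightarrow> int ^ 'd) \<Rightarrow> real" where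
  "escape_prob M \<xi> = measure M {\<omega> \<in> space M. \<forall>n\<ge>1. (\<Sum>i=1..n. \<xi> i \<omega>) \<noteq> 0}"

definition h :: "real \<Rightarrow> int" where
  "h \<beta> = max 9 (\<lfloor>2 + 4 / \<beta>\<rfloor> + 1)"

end

theory Submission
  imports Defs "HOL-Library.Poly_Mapping" "HOL-Real_Asymp.Real_Asymp"
begin

text \<open>
Call a time \<open>i\<close> a clock time if \<open>U\<^sub>i \<le> p\<^sub>i\<close>. Between clock times the walk makes the steps of the plain
  random walk, whatever it has visited, and the expected number of clock times up to \<open>n\<close> is only of
  order \<open>n\<^bsup>1 - 3\<beta>/4\<^esup>\<close> at most. So the drifted steps enter only through their small number and through
  the fact that the clock is independent of the steps.

  The size of the range up to \<open>n\<close> is the number of times \<open>k \<le> n\<close> at which a site is visited for the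
  last time. Fix a window length \<open>m\<close> of order \<open>n\<^bsup>\<beta>/4\<^esup>\<close> and count the \<open>k < n\<close> for which the sums
  \<open>\<xi>\<^bsub>k+1\<^esub> + \<dots> + \<xi>\<^bsub>k+t\<^esub>\<close> with \<open>t \<le> m\<close> avoid \<open>0\<close>. This count has mean \<open>n\<close> times a probability tending to
  the escape probability, and variance at most \<open>n (2m + 1)\<close>, because windows more than \<open>m\<close> apart are
  independent. It differs from the size of the range for two reasons only. At most \<open>m\<close> windows meet a
  given clock time. And a walker that has not returned within \<open>m\<close> steps may return later; sending \<open>k\<close>
  to the next visit of its site is injective, so such \<open>k\<close> are at most as many as the times \<open>j \<le> n\<close> whose
  site was already visited before \<open>j - m\<close> (lemmas \<open>range_upper\<close> and \<open>range_lower\<close>).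

  The first effect bounds the range from above in every dimension, which suffices for \<open>d = 2\<close>: there
  the escape probability is \<open>0\<close>, since the Green function of a centred planar walk diverges. This is
  proved with Fourier inversion on the torus, where \<open>1 - r \<phi>\<close> is of order \<open>(1 - r) + |\<theta>|\<^sup>2\<close>
  near the origin (lemmas \<open>planar_walk_recurrent\<close> and \<open>escape_prob_planar\<close>).

  In high dimension late revisits are controlled by the local bound \<open>P(S\<^sub>t = y) \<le> C t\<^bsup>-d/2\<^esup>\<close>
  (\<open>local_bound\<close>). Let \<open>j\<close> be a late revisit of the site visited at \<open>i\<close>. If no clock time lies between
  them, a block of more than \<open>m\<close> plain steps sums to \<open>0\<close>. Otherwise let \<open>s\<close> be the last clock time
  before \<open>j\<close>: the block of plain steps from \<open>s\<close> to \<open>j\<close>, which is independent of everything up to \<open>s\<close>,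
  hits one of the at most \<open>n\<close> sites visited before \<open>s\<close>. That has probability at most
  \<open>p\<^sub>s min(1, n C t\<^bsup>-d/2\<^esup>)\<close> with \<open>t = j - s\<close>, and \<open>min(1, x) \<le> x\<^bsup>\<beta>/2\<^esup>\<close> makes the sum over \<open>t\<close> converge as soon
  as \<open>d \<beta> > 4\<close>. Summed over the clock times, the expected number of late revisits is
  of order \<open>n\<^bsup>1 - 3\<beta>/4\<^esup> n\<^bsup>\<beta>/2\<^esup> = n\<^bsup>1 - \<beta>/4\<^esup>\<close>, hence negligible.

  The two counts of exceptions, divided by \<open>n\<close>, and the squared deviation of the window count from its
  mean, divided by \<open>n\<^sup>2\<close>, have expectations of order at most \<open>n\<^bsup>-\<beta>/4\<^esup>\<close>. This is summable along the sequence
  \<open>n = k\<^sup>r\<close> for large \<open>r\<close>, so the limit holds almost surely along it, and monotonicity of the range fills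
  the gaps because \<open>(k + 1)\<^sup>r / k\<^sup>r\<close> tends to \<open>1\<close>.
\<close>

section \<open>Pointwise bounds for convolution powers\<close>

abbreviation lookup where "lookup \<equiv> Poly_Mapping.lookup"
abbreviation keys where "keys \<equiv> Poly_Mapping.keys"
abbreviation single where "single \<equiv> Poly_Mapping.single"

lemma lookup_mult_group:
  fixes f g :: "'g::ab_group_add \<Rightarrow>\<^sub>0 real"
  shows "lookup (f * g) y = (\<Sum>x\<in>keys f. lookup f x * lookup g (y - x))"
proof -
  have inner: "Sum_any (\<lambda>q. lookup g q when y = l + q) = lookup g (y - l)" for l
  proof -
    have "(\<lambda>q. lookup g q when y = l + q) = (\<lambda>q. lookup g q when q = y - l)"
      by (auto simp: fun_eq_iff when_def algebra_simps)
    then show ?thesis by (simp only: Sum_any_when_equal)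
  qed
  have "lookup (f * g) y = Sum_any (\<lambda>l. lookup f l * lookup g (y - l))"
    by (simp add: lookup_mult inner)
  also have "\<dots> = (\<Sum>x\<in>keys f. lookup f x * lookup g (y - x))"
    by (rule Sum_any.expand_superset) (auto simp: in_keys_iff)
  finally show ?thesis .
qed

lemma lookup_single_mult:
  fixes g :: "'g::ab_group_add \<Rightarrow>\<^sub>0 real"
  shows "lookup (single 0 c * g) y = c * lookup g y"
  by (cases "c = 0") (auto simp: lookup_mult_group)

text \<open>
  Functions of finite support on the group are multiplied by convolution, so powers of a step law are
  the laws of its random walk. Convolving with a nonnegative function of mass \<open>s\<close> replaces a pointwise
  bound \<open>c\<close> by \<open>s c\<close>: every value is a weighted sum of values of the other factor.
\<close>

lemma lookup_power_mult_le:
  fixes r g :: "'g::ab_group_add \<Rightarrow>\<^sub>0 real"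
  assumes r: "\<And>y. 0 \<le> lookup r y" and g: "\<And>y. lookup g y \<le> c"
  shows "lookup (r ^ n * g) y \<le> (\<Sum>x\<in>keys r. lookup r x) ^ n * c"
proof (induction n arbitrary: y)
  case 0
  then show ?case using g by simp
next
  case (Suc n)
  have "lookup (r ^ Suc n * g) y = lookup (r * (r ^ n * g)) y"
    by (simp add: mult.assoc)
  also have "\<dots> \<le> (\<Sum>x\<in>keys r. lookup r x * ((\<Sum>x\<in>keys r. lookup r x) ^ n * c))"
    unfolding lookup_mult_group[of r] by (intro sum_mono mult_left_mono Suc r)
  finally show ?case by (simp add: sum_distrib_right mult.assoc)
qed

text \<open>
  Passing from \<open>n\<close> to \<open>n + 1\<close> multiplies the left side by \<open>4 (2n + 1) (2n + 3) / (n + 1)\<^sup>2\<close>, which is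
  less than \<open>16\<close>.
\<close>

lemma central_binomial_sq_le: "(real (2 * n choose n))\<^sup>2 * (2 * real n + 1) \<le> 16 ^ n"
proof (induction n)
  case 0
  then show ?case by simp
next
  case (Suc n)
  have "Suc n * (Suc (2 * n) choose Suc n) = Suc (2 * n) * (2 * n choose n)"
    by (rule Suc_times_binomial)
  moreover have "(2 * Suc n choose Suc n) = 2 * (Suc (2 * n) choose Suc n)"
    using binomial_symmetric[of n "Suc (2*n)"] by simp
  ultimately have "Suc n * (2 * Suc n choose Suc n) = 2 * (Suc (2 * n) * (2 * n choose n))"
    by (metis mult.left_commute)
  then have e: "real (Suc n) * real (2 * Suc n choose Suc n) = 2 * (2 * real n + 1) * real (2 * n choose n)"
    by (metis (no_types, opaque_lifting) ab_semigroup_mult_class.mult_ac(1) of_nat_1 of_nat_Suc of_nat_mult of_nat_numeral add.commute)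
  have "(real (Suc n))\<^sup>2 * ((real (2 * Suc n choose Suc n))\<^sup>2 * (2 * real (Suc n) + 1))
        = (real (Suc n) * real (2 * Suc n choose Suc n))\<^sup>2 * (2 * real n + 3)"
    by (simp add: power_mult_distrib)
  also have "\<dots> = ((real (2 * n choose n))\<^sup>2 * (2 * real n + 1)) * (4 * ((2 * real n + 1) * (2 * real n + 3)))"
    unfolding e by (simp add: power2_eq_square algebra_simps)
  also have "\<dots> \<le> 16 ^ n * (16 * (real (Suc n))\<^sup>2)"
  proof (rule mult_mono[OF Suc])
    show "4 * ((2 * real n + 1) * (2 * real n + 3)) \<le> 16 * (real (Suc n))\<^sup>2"
      by (simp add: power2_eq_square algebra_simps)
  qed auto
  finally have "(real (Suc n))\<^sup>2 * ((real (2 * Suc n choose Suc n))\<^sup>2 * (2 * real (Suc n) + 1)) \<le> (real (Suc n))\<^sup>2 * 16 ^ Suc n"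
    by (simp add: mult_ac)
  then show ?case by (subst (asm) mult_le_cancel_left_pos) auto
qed

lemma binomial_le_sqrt: "real (n choose k) \<le> 2 ^ n / sqrt (real n + 1)"
proof -
  have even_case: "real (2 * m choose m) * sqrt (2 * real m + 1) \<le> 2 ^ (2 * m)" for m
  proof (rule power2_le_imp_le)
    show "(real (2 * m choose m) * sqrt (2 * real m + 1))\<^sup>2 \<le> (2 ^ (2 * m))\<^sup>2"
      using central_binomial_sq_le[of m]
      using power_mult[of "2::real" 4 m]
      by (simp add: power_mult_distrib mult.commute flip: power_mult)
  qed simp
  have "real (n choose k) \<le> real (n choose (n div 2))"
    using binomial_maximum[of n k] by simp
  also have "\<dots> \<le> 2 ^ n / sqrt (real n + 1)"
  proof (cases "even n")
    case True
    then obtain m where "n = 2 * m" by blast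
    then show ?thesis using even_case[of m] by (simp add: pos_le_divide_eq)
  next
    \<comment> \<open>An odd row has its maximum at half of the central coefficient of the next row.\<close>
    case False
    then obtain m where m: "n = 2 * m + 1" by (elim oddE)
    have "(2 * Suc m choose Suc m) = 2 * (Suc (2 * m) choose Suc m)"
      using binomial_symmetric[of m "Suc (2*m)"] by simp
    moreover have "(Suc (2 * m) choose Suc m) = (Suc (2 * m) choose m)"
      using binomial_symmetric[of m "Suc (2*m)"] by simp
    ultimately have "real (2 * Suc m choose Suc m) = 2 * real (n choose (n div 2))"
      using m by simp
    then have "2 * (real (n choose (n div 2)) * sqrt (2 * real m + 3)) \<le> 2 * 2 ^ n"
      using even_case[of "Suc m"] m by (simp add: add.commute mult.assoc)
    then have "real (n choose (n div 2)) * sqrt (2 * real m + 3) \<le> 2 ^ n" by simp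
    moreover have "real (n choose (n div 2)) * sqrt (real n + 1) \<le> real (n choose (n div 2)) * sqrt (2 * real m + 3)"
      using m by (intro mult_left_mono) auto
    ultimately have "real (n choose (n div 2)) * sqrt (real n + 1) \<le> 2 ^ n" by linarith
    then show ?thesis by (simp add: pos_le_divide_eq)
  qed
  finally show ?thesis .
qed

text \<open>
  The left side is the mean of \<open>1 / sqrt (n + 1)\<close> for a binomially distributed number \<open>n\<close>. The mean of
  \<open>1 / (n + 1)\<close> can be computed, because \<open>(k choose n) / (n + 1) = (k + 1 choose n + 1) / (k + 1)\<close> turns
  it into an almost complete binomial sum.
\<close>

lemma binomial_mean_inverse_sqrt:
  fixes x :: real
  assumes x: "0 < x" "x \<le> 1"
  shows "(\<Sum>n\<le>k. real (k choose n) * x ^ n * (1 - x) ^ (k - n) / sqrt (real n + 1)) \<le> 1 / sqrt (x * (real k + 1))"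
proof -
  define s where "s = x * (real k + 1)"
  define w where "w n = real (k choose n) * x ^ n * (1 - x) ^ (k - n)" for n
  have s: "s > 0" using x by (simp add: s_def)
  have w0: "w n \<ge> 0" for n using x by (simp add: w_def)
  have w1: "(\<Sum>n\<le>k. w n) = 1"
    using binomial_ring[of x "1 - x" k] by (simp add: w_def)
  have "s * (\<Sum>n\<le>k. w n / (real n + 1)) = (\<Sum>n\<le>k. real (Suc k choose Suc n) * x ^ Suc n * (1 - x) ^ (Suc k - Suc n))"
    unfolding sum_distrib_left
  proof (rule sum.cong[OF refl])
    fix n assume "n \<in> {..k}"
    have "real (Suc n) * real (Suc k choose Suc n) = real (Suc k) * real (k choose n)"
      by (metis Suc_times_binomial of_nat_mult)
    then have "real (Suc k choose Suc n) = (real k + 1) * real (k choose n) / (real n + 1)"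
      by (simp add: field_simps)
    then show "s * (w n / (real n + 1)) = real (Suc k choose Suc n) * x ^ Suc n * (1 - x) ^ (Suc k - Suc n)"
      by (simp add: s_def w_def)
  qed
  also have "\<dots> = (\<Sum>n\<le>Suc k. real (Suc k choose n) * x ^ n * (1 - x) ^ (Suc k - n)) - (1 - x) ^ Suc k"
    by (subst sum.atMost_Suc_shift) simp
  also have "\<dots> = 1 - (1 - x) ^ Suc k"
    using binomial_ring[of x "1 - x" "Suc k"] by simp
  also have "\<dots> \<le> 1" using x by simp
  finally have inv: "(\<Sum>n\<le>k. w n / (real n + 1)) \<le> 1 / s"
    using s by (simp add: field_simps)
  \<comment> \<open>The arithmetic-geometric mean inequality, weighted so that it is sharp at \<open>n + 1 = s\<close>.\<close>
  have am: "1 / sqrt (real n + 1) \<le> (sqrt s / (real n + 1) + 1 / sqrt s) / 2" for n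
  proof -
    let ?a = "1 / sqrt (real n + 1)"
    have "0 \<le> (?a * sqrt s - 1)\<^sup>2" by simp
    also have "\<dots> = ?a\<^sup>2 * s - 2 * ?a * sqrt s + 1"
      using s by (simp add: power2_diff power_mult_distrib power_divide)
    also have "?a\<^sup>2 = 1 / (real n + 1)" by (simp add: power_divide)
    finally have "2 * ?a * sqrt s \<le> s / (real n + 1) + 1" by simp
    then have "2 * ?a \<le> (s / (real n + 1) + 1) / sqrt s" using s by (simp add: pos_le_divide_eq)
    also have "\<dots> = sqrt s / (real n + 1) + 1 / sqrt s"
      using s by (simp add: add_divide_distrib) (metis real_div_sqrt divide_divide_eq_left mult.commute less_imp_le)
    finally show ?thesis by simp
  qed
  have "(\<Sum>n\<le>k. w n / sqrt (real n + 1)) \<le> (\<Sum>n\<le>k. w n * ((sqrt s / (real n + 1) + 1 / sqrt s) / 2))"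
    using mult_left_mono[OF am w0] by (intro sum_mono) simp
  also have "\<dots> = (sqrt s * (\<Sum>n\<le>k. w n / (real n + 1)) + (\<Sum>n\<le>k. w n) / sqrt s) / 2"
    by (simp add: sum_distrib_left sum_divide_distrib flip: sum.distrib) (intro sum.cong refl, simp add: field_simps)
  also have "\<dots> \<le> (sqrt s * (1 / s) + 1 / sqrt s) / 2"
    using inv s w1 by (intro divide_right_mono add_mono mult_left_mono) auto
  also have "sqrt s * (1 / s) = 1 / sqrt s" using s by (simp add: field_simps)
  finally show ?thesis by (simp add: w_def s_def)
qed

text \<open>
  The injectivity hypothesis says that \<open>y\<close> determines how many of the \<open>N i\<close> choices between \<open>u i\<close> and
  \<open>u0\<close> fell on \<open>u i\<close>, for all \<open>i\<close> at once. Hence at most one term of the expanded product contributes to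
  the coefficient at \<open>y\<close>, and it is a product of binomial coefficients. Multiples of a group element are
  written as iterated additions, which make sense in any abelian group.
\<close>

lemma lookup_binomial_product_le:
  fixes u :: "'i \<Rightarrow> 'g::ab_group_add" and u0 :: 'g
  assumes fin: "finite I"
    and inj: "inj_on (\<lambda>j. \<Sum>i\<in>I. ((+) (u i - u0) ^^ j i) 0) (PiE I (\<lambda>_. UNIV))"
  shows "lookup (\<Prod>i\<in>I. (single (u i) 1 + single u0 (1::real)) ^ N i) y
          \<le> (\<Prod>i\<in>I. 2 ^ N i / sqrt (real (N i) + 1))"
proof -
  have sp: "single v (1::real) ^ n = single (((+) v ^^ n) 0) 1" for v :: 'g and n
    by (induction n) (auto simp: mult_single simp flip: single_one)
  have ex: "((+) v ^^ j) 0 + ((+) w ^^ (n - j)) 0 = ((+) w ^^ n) 0 + ((+) (v - w) ^^ j) 0" if "j \<le> n" for v w :: 'g and n j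
    using that
  proof (induction j)
    case (Suc j)
    then obtain e where e: "n = Suc (j + e)" by (metis less_eqE add_Suc)
    have n1: "n - j = Suc e" "n - Suc j = e" using e by auto
    show ?case using Suc n1 by (simp add: algebra_simps)
  qed simp
  have bi: "(single (u i) 1 + single u0 (1::real)) ^ n
        = (\<Sum>j\<le>n. single (((+) u0 ^^ n) 0 + ((+) (u i - u0) ^^ j) 0) (real (n choose j)))" for i n
    unfolding binomial_ring
  proof (rule sum.cong[OF refl])
    fix j assume "j \<in> {..n}"
    then have "of_nat (n choose j) * single (u i) (1::real) ^ j * single u0 1 ^ (n - j)
       = single 0 (real (n choose j)) * (single (((+) u0 ^^ n) 0 + ((+) (u i - u0) ^^ j) 0) 1)"
      using ex[of j n "u i" u0] unfolding single_of_nat[symmetric] sp mult.assoc mult_single by simp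
    then show "of_nat (n choose j) * single (u i) (1::real) ^ j * single u0 1 ^ (n - j)
       = single (((+) u0 ^^ n) 0 + ((+) (u i - u0) ^^ j) 0) (real (n choose j))"
      by (simp only: mult_single add_0 mult_1_right)
  qed
  have ps: "(\<Prod>i\<in>J. single (a i) (c i)) = single (\<Sum>i\<in>J. a i) (\<Prod>i\<in>J. c i)"
    if "finite J" for J :: "'i set" and a :: "'i \<Rightarrow> 'g" and c :: "'i \<Rightarrow> real"
    using that by induction (auto simp: mult_single)
  have "(\<Prod>i\<in>I. (single (u i) 1 + single u0 (1::real)) ^ N i)
     = (\<Sum>j\<in>PiE I (\<lambda>i. {..N i}). single ((\<Sum>i\<in>I. ((+) u0 ^^ N i) 0) + (\<Sum>i\<in>I. ((+) (u i - u0) ^^ j i) 0)) (\<Prod>i\<in>I. real (N i choose j i)))"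
    using fin by (simp add: bi prod_sum_PiE ps sum.distrib)
  then have "lookup (\<Prod>i\<in>I. (single (u i) 1 + single u0 (1::real)) ^ N i) y
     = (\<Sum>j\<in>PiE I (\<lambda>i. {..N i}). (\<Prod>i\<in>I. real (N i choose j i)) when (\<Sum>i\<in>I. ((+) u0 ^^ N i) 0) + (\<Sum>i\<in>I. ((+) (u i - u0) ^^ j i) 0) = y)"
    by (simp add: lookup_sum lookup_single)
  also have "\<dots> \<le> (\<Prod>i\<in>I. 2 ^ N i / sqrt (real (N i) + 1))"
  proof (cases "\<exists>j0\<in>PiE I (\<lambda>i. {..N i}). (\<Sum>i\<in>I. ((+) u0 ^^ N i) 0) + (\<Sum>i\<in>I. ((+) (u i - u0) ^^ j0 i) 0) = y")
    case True
    then obtain j0 where j0: "j0 \<in> PiE I (\<lambda>i. {..N i})" "(\<Sum>i\<in>I. ((+) u0 ^^ N i) 0) + (\<Sum>i\<in>I. ((+) (u i - u0) ^^ j0 i) 0) = y" by blast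
    have un: "j = j0" if "j \<in> PiE I (\<lambda>i. {..N i})" "(\<Sum>i\<in>I. ((+) u0 ^^ N i) 0) + (\<Sum>i\<in>I. ((+) (u i - u0) ^^ j i) 0) = y" for j
    proof (rule inj_onD[OF inj])
      show "(\<Sum>i\<in>I. ((+) (u i - u0) ^^ j i) 0) = (\<Sum>i\<in>I. ((+) (u i - u0) ^^ j0 i) 0)"
        by (rule add_left_imp_eq[OF trans[OF that(2) j0(2)[symmetric]]])
    qed (use that(1) j0(1) in \<open>auto simp: PiE_iff\<close>)
    have "(\<Sum>j\<in>PiE I (\<lambda>i. {..N i}). (\<Prod>i\<in>I. real (N i choose j i)) when (\<Sum>i\<in>I. ((+) u0 ^^ N i) 0) + (\<Sum>i\<in>I. ((+) (u i - u0) ^^ j i) 0) = y)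
       = (\<Sum>j\<in>PiE I (\<lambda>i. {..N i}). if j = j0 then (\<Prod>i\<in>I. real (N i choose j0 i)) else 0)"
    proof (rule sum.cong[OF refl])
      fix j assume j: "j \<in> PiE I (\<lambda>i. {..N i})"
      show "((\<Prod>i\<in>I. real (N i choose j i)) when (\<Sum>i\<in>I. ((+) u0 ^^ N i) 0) + (\<Sum>i\<in>I. ((+) (u i - u0) ^^ j i) 0) = y)
        = (if j = j0 then (\<Prod>i\<in>I. real (N i choose j0 i)) else 0)"
      proof (cases "j = j0")
        case True
        then show ?thesis using j0(2) by (simp only: when_def simp_thms if_True)
      next
        case False
        then have "\<not> (\<Sum>i\<in>I. ((+) u0 ^^ N i) 0) + (\<Sum>i\<in>I. ((+) (u i - u0) ^^ j i) 0) = y"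
          using un[OF j] by metis
        then show ?thesis using False by (simp only: when_def if_False)
      qed
    qed
    also have "\<dots> = (\<Prod>i\<in>I. real (N i choose j0 i))"
      using j0(1) fin by (subst sum.delta) (auto intro!: finite_PiE)
    also have "\<dots> \<le> (\<Prod>i\<in>I. 2 ^ N i / sqrt (real (N i) + 1))"
      by (intro prod_mono conjI binomial_le_sqrt) auto
    finally show ?thesis .
  next
    case False
    then show ?thesis by (subst sum.neutral) (auto simp: when_def intro!: prod_nonneg)
  qed
  finally show ?thesis .
qed

text \<open>
  When \<open>b i\<close> is the sum of two atoms, a step of law \<open>q\<close> is, with probability \<open>2 \<kappa>\<close>, a fair choice between
  them, and for different \<open>i\<close> the pairs of atoms may differ. Of the \<open>k * card A\<close> steps, \<open>k\<close> are reserved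
  for each \<open>i\<close>, and the number \<open>n\<close> of fair choices among them is binomially distributed. Given these numbers, \<open>base\<close> bounds
  the coefficients by a product of factors \<open>1 / sqrt (n + 1)\<close>, whose means were bounded above. The
  induction expands the factor \<open>q ^ k\<close> of one index after the other; the powers of \<open>r\<close> left over do not
  increase the maximum beyond their mass.
\<close>

lemma lookup_power_le_mixture:
  fixes b r :: "'i \<Rightarrow> 'g::ab_group_add \<Rightarrow>\<^sub>0 real" and q :: "'g \<Rightarrow>\<^sub>0 real"
  assumes fin: "finite A" and \<kappa>: "0 < \<kappa>" "2 * \<kappa> \<le> 1"
    and q: "\<And>i. i \<in> A \<Longrightarrow> q = single 0 \<kappa> * b i + r i"
    and r: "\<And>i y. i \<in> A \<Longrightarrow> 0 \<le> lookup (r i) y"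
    and tot: "\<And>i. i \<in> A \<Longrightarrow> (\<Sum>x\<in>keys (r i). lookup (r i) x) = 1 - 2 * \<kappa>"
    and base: "\<And>N y. lookup (\<Prod>i\<in>A. b i ^ N i) y \<le> (\<Prod>i\<in>A. 2 ^ N i / sqrt (real (N i) + 1))"
  shows "lookup (q ^ (k * card A)) y \<le> (1 / sqrt (2 * \<kappa> * (real k + 1))) ^ card A"
proof -
  define s where "s = 1 / sqrt (2 * \<kappa> * (real k + 1))"
  define D where "D N J = (\<Prod>i\<in>J. 2 ^ N i / sqrt (real (N i) + 1))" for N :: "'i \<Rightarrow> nat" and J
  have s0: "s \<ge> 0" using \<kappa> by (simp add: s_def)
  have D0: "D N J \<ge> 0" for N J by (auto simp: D_def intro!: prod_nonneg)
  have "finite I \<Longrightarrow> I \<subseteq> A \<Longrightarrow> lookup (q ^ (k * card I) * (\<Prod>i\<in>A - I. b i ^ N i)) y \<le> s ^ card I * D N (A - I)" for I N y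
  proof (induction I arbitrary: N y rule: finite_induct)
    case empty
    then show ?case using base by (simp add: D_def)
  next
    case (insert j I)
    then have j: "j \<in> A" "j \<in> A - I" and AI: "A - I = insert j (A - insert j I)" by auto
    define P where "P n = q ^ (k * card I) * (\<Prod>i\<in>A - I. b i ^ (N(j := n)) i)" for n
    have P: "P n = q ^ (k * card I) * (b j ^ n * (\<Prod>i\<in>A - insert j I. b i ^ N i))" for n
    proof -
      have "(\<Prod>i\<in>A - I. b i ^ (N(j := n)) i) = b j ^ n * (\<Prod>i\<in>A - insert j I. b i ^ (N(j := n)) i)"
        unfolding AI using fin by (subst prod.insert) auto
      also have "(\<Prod>i\<in>A - insert j I. b i ^ (N(j := n)) i) = (\<Prod>i\<in>A - insert j I. b i ^ N i)"
        by (rule prod.cong) auto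
      finally show ?thesis by (simp add: P_def)
    qed
    have DP: "D (N(j := n)) (A - I) = 2 ^ n / sqrt (real n + 1) * D N (A - insert j I)" for n
    proof -
      have "D (N(j := n)) (A - I) = 2 ^ n / sqrt (real n + 1) * D (N(j := n)) (A - insert j I)"
        unfolding AI D_def using fin by (subst prod.insert) auto
      also have "D (N(j := n)) (A - insert j I) = D N (A - insert j I)"
        unfolding D_def by (rule prod.cong) auto
      finally show ?thesis .
    qed
    have sk: "(single (0::'g) \<kappa>) ^ n = single 0 (\<kappa> ^ n)" for n
      by (induction n) (auto simp: mult_single simp flip: single_one)
    have "q ^ (k * card (insert j I)) * (\<Prod>i\<in>A - insert j I. b i ^ N i)
       = (single 0 \<kappa> * b j + r j) ^ k * (q ^ (k * card I) * (\<Prod>i\<in>A - insert j I. b i ^ N i))"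
      using insert by (simp add: power_add mult.assoc flip: q[OF j(1)])
    also have "\<dots> = (\<Sum>n\<le>k. single 0 (real (k choose n) * \<kappa> ^ n) * (r j ^ (k - n) * P n))"
      unfolding binomial_ring sum_distrib_right P
    proof (rule sum.cong[OF refl])
      fix n
      have "of_nat (k choose n) * (single (0::'g) \<kappa>) ^ n = single 0 (real (k choose n) * \<kappa> ^ n)"
        unfolding single_of_nat[symmetric] sk mult_single by simp
      then show "of_nat (k choose n) * (single 0 \<kappa> * b j) ^ n * r j ^ (k - n) * (q ^ (k * card I) * (\<Prod>i\<in>A - insert j I. b i ^ N i))
        = single 0 (real (k choose n) * \<kappa> ^ n) * (r j ^ (k - n) * (q ^ (k * card I) * (b j ^ n * (\<Prod>i\<in>A - insert j I. b i ^ N i))))"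
        unfolding power_mult_distrib by (simp only: mult.assoc[symmetric]) (simp only: ac_simps)
    qed
    finally have "lookup (q ^ (k * card (insert j I)) * (\<Prod>i\<in>A - insert j I. b i ^ N i)) y
       = (\<Sum>n\<le>k. real (k choose n) * \<kappa> ^ n * lookup (r j ^ (k - n) * P n) y)"
      by (simp add: lookup_sum lookup_single_mult)
    also have "\<dots> \<le> (\<Sum>n\<le>k. real (k choose n) * \<kappa> ^ n * ((1 - 2 * \<kappa>) ^ (k - n) * (s ^ card I * D (N(j := n)) (A - I))))"
    proof (intro sum_mono mult_left_mono)
      fix n
      show "lookup (r j ^ (k - n) * P n) y \<le> (1 - 2 * \<kappa>) ^ (k - n) * (s ^ card I * D (N(j := n)) (A - I))"
        unfolding tot[OF j(1), symmetric]
        unfolding P_def by (intro lookup_power_mult_le r j insert.IH) (use insert.prems in auto)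
    qed (use \<kappa> in auto)
    also have "\<dots> = s ^ card I * D N (A - insert j I) * (\<Sum>n\<le>k. real (k choose n) * (2 * \<kappa>) ^ n * (1 - 2 * \<kappa>) ^ (k - n) / sqrt (real n + 1))"
      unfolding sum_distrib_left DP by (intro sum.cong refl) (simp add: power_mult_distrib)
    also have "\<dots> \<le> s ^ card I * D N (A - insert j I) * s"
      using binomial_mean_inverse_sqrt[of "2 * \<kappa>" k] \<kappa> s0 D0 by (intro mult_left_mono) (auto simp: s_def)
    finally show ?case using insert.hyps by (simp only: card_insert_disjoint power_Suc mult_ac simp_thms)
  qed
  from this[OF fin order_refl, of "\<lambda>_. 0" y] show ?thesis by (simp add: s_def D_def)
qed

section \<open>Centred step laws and their local bound\<close>

lemma real_vec_zero [simp]: "real_vec 0 = 0"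
  and real_vec_add: "real_vec (v + w) = real_vec v + real_vec w"
  and real_vec_diff: "real_vec (v - w) = real_vec v - real_vec w"
  by (simp_all add: real_vec_def vec_eq_iff)

lemma real_vec_sum: "real_vec (sum f A) = (\<Sum>i\<in>A. real_vec (f i))"
  by (induction A rule: infinite_finite_induct) (simp_all add: real_vec_add)

text \<open>
  The law of a single step: finite support, mean zero, and not carried by a hyperplane through the
  origin.
\<close>

locale centred_step_law =
  fixes q :: "(int ^ 'd) \<Rightarrow>\<^sub>0 real"
  assumes nonneg: "0 \<le> lookup q v"
    and total: "(\<Sum>v\<in>keys q. lookup q v) = 1"
    and mean: "(\<Sum>v\<in>keys q. lookup q v *\<^sub>R real_vec v) = 0"
    and nondegenerate: "norm l = 1 \<Longrightarrow> \<exists>v\<in>keys q. real_vec v \<bullet> l \<noteq> 0"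
begin

lemma lookup_power_mult_le': "(\<And>y. lookup g y \<le> c) \<Longrightarrow> lookup (q ^ n * g) y \<le> c"
  using lookup_power_mult_le[of q g c n y] nonneg total by simp

lemma lookup_power_nonneg: "0 \<le> lookup (q ^ n) y"
proof (induction n arbitrary: y)
  case 0
  then show ?case by (simp add: lookup_one when_def)
next
  case (Suc n)
  then show ?case unfolding power_Suc lookup_mult_group by (intro sum_nonneg mult_nonneg_nonneg nonneg)
qed

text \<open>
  If all atoms had the same inner product with some vector \<open>a\<close>, this common value would be the inner
  product of \<open>a\<close> with the mean, hence \<open>0\<close>, against nondegeneracy.
\<close>

lemma span_differences:
  assumes u0: "u0 \<in> keys q"
  shows "span ((\<lambda>v. real_vec v - real_vec u0) ` keys q) = UNIV"
proof (rule ccontr)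
  assume "\<not> ?thesis"
  then obtain a where a: "a \<noteq> 0" and orth: "\<forall>x\<in>span ((\<lambda>v. real_vec v - real_vec u0) ` keys q). a \<bullet> x = 0"
    using span_not_UNIV_orthogonal by blast
  then have eq: "a \<bullet> real_vec v = a \<bullet> real_vec u0" if "v \<in> keys q" for v
  proof -
    have "real_vec v - real_vec u0 \<in> span ((\<lambda>v. real_vec v - real_vec u0) ` keys q)"
      using that by (intro span_base imageI)
    then have "a \<bullet> (real_vec v - real_vec u0) = 0" using orth by blast
    then show ?thesis by (simp add: inner_diff_right)
  qed
  have "0 = a \<bullet> (\<Sum>v\<in>keys q. lookup q v *\<^sub>R real_vec v)"
    by (simp add: mean)
  also have "\<dots> = (\<Sum>v\<in>keys q. lookup q v * (a \<bullet> real_vec u0))"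
    by (simp add: inner_sum_right eq)
  also have "\<dots> = a \<bullet> real_vec u0" by (simp add: total flip: sum_distrib_right)
  finally have "a \<bullet> real_vec u0 = 0" by simp
  moreover have "norm (a /\<^sub>R norm a) = 1" using a by simp
  ultimately show False using nondegenerate[of "a /\<^sub>R norm a"] eq by (auto simp: inner_commute)
qed

lemma independent_atoms:
  obtains u0 and u :: "'d \<Rightarrow> int ^ 'd" where
    "u0 \<in> keys q" "\<And>i. u i \<in> keys q" "\<And>i. u i \<noteq> u0"
    "inj_on (\<lambda>j. \<Sum>i\<in>UNIV. ((+) (u i - u0) ^^ j i) 0) (PiE UNIV (\<lambda>_. UNIV))"
proof -
  have "keys q \<noteq> {}" using total by auto
  then obtain u0 where u0: "u0 \<in> keys q" by blast
  let ?V = "(\<lambda>v. real_vec v - real_vec u0) ` keys q"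
  obtain B where B: "B \<subseteq> ?V" "independent B" "?V \<subseteq> span B"
    using maximal_independent_subset by blast
  have "span B = UNIV" using B span_differences[OF u0] by (metis span_eq span_subspace subspace_span span_mono span_span top.extremum_uniqueI)
  then have "card B = CARD('d)"
    using basis_card_eq_dim[of B UNIV] B(2) by simp
  moreover have finB: "finite B" using B(2) by (rule independent_imp_finite)
  ultimately obtain f :: "'d \<Rightarrow> real ^ 'd" where f: "bij_betw f UNIV B"
    using finite_same_card_bij[of "UNIV :: 'd set" B] by auto
  have "\<exists>v\<in>keys q. real_vec v - real_vec u0 = f i" for i
  proof -
    have "f i \<in> ?V" using f B(1) by (auto simp: bij_betw_def)
    then show ?thesis by fastforce
  qed
  then obtain u where u: "\<And>i. u i \<in> keys q" "\<And>i. real_vec (u i) - real_vec u0 = f i"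
    by metis
  have fB: "f i \<in> B" for i using f by (auto simp: bij_betw_def)
  show thesis
  proof
    show "u i \<noteq> u0" for i
      using u(2)[of i] fB[of i] B(2) dependent_zero by fastforce
    show "inj_on (\<lambda>j. \<Sum>i\<in>UNIV. ((+) (u i - u0) ^^ j i) 0) (PiE UNIV (\<lambda>_. UNIV))"
    proof (rule inj_onI)
      fix j j' :: "'d \<Rightarrow> nat"
      assume e: "(\<Sum>i\<in>UNIV. ((+) (u i - u0) ^^ j i) 0) = (\<Sum>i\<in>UNIV. ((+) (u i - u0) ^^ j' i) 0)"
      have m: "real_vec (((+) (u i - u0) ^^ n) 0) = real n *\<^sub>R f i" for i n
        by (induction n) (simp_all add: real_vec_add real_vec_diff u(2) scaleR_left_distrib)
      have "(\<Sum>i\<in>UNIV. real (j i) *\<^sub>R f i) = (\<Sum>i\<in>UNIV. real (j' i) *\<^sub>R f i)"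
        using arg_cong[OF e, of real_vec] by (simp add: real_vec_sum m)
      then have "(\<Sum>i\<in>UNIV. (real (j i) - real (j' i)) *\<^sub>R f i) = 0"
        by (simp add: scaleR_left_diff_distrib sum_subtractf)
      moreover have "inj f" using f by (simp add: bij_betw_def)
      ultimately have zero: "(\<Sum>b\<in>B. (real (j (the_inv f b)) - real (j' (the_inv f b))) *\<^sub>R b) = 0"
        by (subst sum.reindex_bij_betw[OF f, symmetric]) (simp add: the_inv_f_f)
      have "\<forall>b\<in>B. real (j (the_inv f b)) - real (j' (the_inv f b)) = 0"
        using independentD[OF B(2) finB order_refl zero] by fast
      then have "j i = j' i" for i
        using fB[of i] \<open>inj f\<close> by (metis eq_iff_diff_eq_0 of_nat_eq_iff the_inv_f_f)
      then show "j = j'" by auto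
    qed
  qed (use u0 u in auto)
qed

text \<open>
  The atoms \<open>u i\<close> found above differ from \<open>u0\<close> by linearly independent vectors, so the mixture estimate
  applies with one index per coordinate direction and yields one factor \<open>t\<^bsup>-1/2\<^esup>\<close> for each.
\<close>

theorem local_bound:
  obtains C where "C > 0" "\<And>t y. t \<ge> 1 \<Longrightarrow> lookup (q ^ t) y \<le> C * real t powr (- (real CARD('d) / 2))"
proof -
  obtain u0 and u :: "'d \<Rightarrow> int ^ 'd" where u: "u0 \<in> keys q" "\<And>i. u i \<in> keys q" "\<And>i. u i \<noteq> u0"
    and inj: "inj_on (\<lambda>j. \<Sum>i\<in>UNIV. ((+) (u i - u0) ^^ j i) 0) (PiE UNIV (\<lambda>_. UNIV))"
    using independent_atoms by blast
  \<comment> \<open>With the smallest weight of an atom, \<open>q\<close> minus \<open>\<kappa>\<close> at \<open>u i\<close> and at \<open>u0\<close> is still nonnegative.\<close>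
  define \<kappa> where "\<kappa> = Min (lookup q ` keys q)"
  have \<kappa>le: "\<kappa> \<le> lookup q v" if "v \<in> keys q" for v
    using that by (auto simp: \<kappa>_def)
  have "\<kappa> \<in> lookup q ` keys q" unfolding \<kappa>_def using u by (intro Min_in) auto
  then have \<kappa>0: "\<kappa> > 0" using nonneg by (auto simp: in_keys_iff less_le)
  define b where "b i = single (u i) (1::real) + single u0 1" for i
  define r where "r i = q - single 0 \<kappa> * b i" for i
  have lr: "lookup (r i) v = lookup q v - (\<kappa> when u i = v) - (\<kappa> when u0 = v)" for i v
    by (simp add: r_def lookup_minus b_def distrib_left mult_single lookup_add lookup_single)
  have tot: "(\<Sum>x\<in>keys (r i). lookup (r i) x) = 1 - 2 * \<kappa>" for i
  proof -
    have "(\<Sum>x\<in>keys (r i). lookup (r i) x) = (\<Sum>x\<in>keys q. lookup (r i) x)"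
    proof (rule sum.mono_neutral_left)
      show "keys (r i) \<subseteq> keys q"
      proof
        fix x assume x: "x \<in> keys (r i)"
        show "x \<in> keys q"
        proof (rule ccontr)
          assume "x \<notin> keys q"
          moreover from this have "u i \<noteq> x" "u0 \<noteq> x" using u(1) u(2)[of i] by auto
          ultimately show False using x by (simp add: in_keys_iff lr)
        qed
      qed
    qed (auto simp: in_keys_iff)
    also have "\<dots> = 1 - \<kappa> - \<kappa>"
      using u by (simp add: lr sum_subtractf total when_def)
    finally show ?thesis by simp
  qed
  have r: "0 \<le> lookup (r i) y" for i y
    using u(3)[of i] \<kappa>le[OF u(1)] \<kappa>le[OF u(2)[of i]] nonneg[of y] by (auto simp: lr when_def)
  have \<kappa>1: "2 * \<kappa> \<le> 1"
  proof -
    have "0 \<le> (\<Sum>x\<in>keys (r undefined). lookup (r undefined) x)" using r by (intro sum_nonneg) auto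
    then show ?thesis by (simp add: tot)
  qed
  define d where "d = CARD('d)"
  have d: "d > 0" by (simp add: d_def)
  have main: "lookup (q ^ (k * d)) y \<le> (1 / sqrt (2 * \<kappa> * (real k + 1))) ^ d" for k y
    unfolding d_def
  proof (rule lookup_power_le_mixture[where b = b and r = r])
    show "lookup (\<Prod>i\<in>UNIV. b i ^ N i) y \<le> (\<Prod>i\<in>UNIV. 2 ^ N i / sqrt (real (N i) + 1))" for N y
      unfolding b_def by (rule lookup_binomial_product_le[OF _ inj]) simp
  qed (use \<kappa>0 \<kappa>1 r tot in \<open>auto simp: r_def\<close>)
  define C where "C = (2 * \<kappa> / d) powr (- (real d / 2))"
  show thesis
  proof
    show "C > 0" using \<kappa>0 d by (simp add: C_def)
    fix t y assume t: "(t::nat) \<ge> 1"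
    \<comment> \<open>A full number of rounds of \<open>d\<close> steps; the remaining steps do not increase the maximum.\<close>
    define k where "k = t div d"
    have "real t \<le> real d * (real k + 1)"
    proof -
      have "t \<le> d * (k + 1)" using d unfolding k_def by (metis Suc_eq_plus1 dividend_less_times_div less_imp_le mult_Suc_right add.commute)
      then show ?thesis by (metis of_nat_1 of_nat_add of_nat_le_iff of_nat_mult)
    qed
    then have tk: "real t / real d \<le> real k + 1" using d by (simp add: field_simps)
    have "q ^ t = q ^ (t mod d) * q ^ (k * d)" by (simp add: k_def flip: power_add)
    then have "lookup (q ^ t) y \<le> (1 / sqrt (2 * \<kappa> * (real k + 1))) ^ d"
      using lookup_power_mult_le'[OF main] by metis
    also have "1 / sqrt (2 * \<kappa> * (real k + 1)) = (2 * \<kappa> * (real k + 1)) powr (- (1/2))"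
      using \<kappa>0 by (simp add: powr_minus powr_half_sqrt field_simps)
    also have "\<dots> ^ d = (2 * \<kappa> * (real k + 1)) powr (- (real d / 2))"
      using \<kappa>0 by (simp add: powr_powr flip: powr_realpow)
    also have "\<dots> \<le> (2 * \<kappa> * (real t / real d)) powr (- (real d / 2))"
    proof (rule powr_mono2')
      show "2 * \<kappa> * (real t / real d) \<le> 2 * \<kappa> * (real k + 1)"
        using \<kappa>0 tk by (intro mult_left_mono) auto
    qed (use \<kappa>0 t d in auto)
    also have "2 * \<kappa> * (real t / real d) = (2 * \<kappa> / real d) * real t" by simp
    also have "\<dots> powr (- (real d / 2)) = C * real t powr (- (real d / 2))"
      unfolding C_def by (rule powr_mult)
    finally show "lookup (q ^ t) y \<le> C * real t powr (- (real CARD('d) / 2))" by (simp add: d_def)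
  qed
qed

end

section \<open>Recurrence of centred planar walks\<close>

lemma integral_cis:
  "(\<integral>x. cis (real_of_int a * x) \<partial>restrict_space lborel {-pi..pi}) = (if a = 0 then of_real (2 * pi) else 0)"
proof -
  have *: "(\<integral>x. cis (real_of_int a * x) \<partial>restrict_space lborel {-pi..pi}) = (\<integral>x. indicator {-pi..pi} x *\<^sub>R cis (real_of_int a * x) \<partial>lborel)"
    by (subst integral_restrict_space) auto
  show ?thesis
  proof (cases "a = 0")
    case True
    have "(\<integral>x. indicator {-pi..pi} x *\<^sub>R (1::complex) \<partial>lborel) = of_real pi - of_real (- pi)"
      by (rule integral_FTC_atLeastAtMost[where F = "\<lambda>x. of_real x"])
         (auto intro!: derivative_eq_intros)
    then show ?thesis unfolding * using True by simp
  next
    case False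
    define F where "F x = cis (real_of_int a * x) / (\<i> * of_int a)" for x
    have "(\<integral>x. indicator {-pi..pi} x *\<^sub>R cis (real_of_int a * x) \<partial>lborel) = F pi - F (- pi)"
    proof (rule integral_FTC_atLeastAtMost)
      fix x :: real
      have "((\<lambda>z. exp (\<i> * of_int a * z) / (\<i> * of_int a)) has_field_derivative exp (\<i> * of_int a * of_real x)) (at (of_real x))"
        by (auto intro!: derivative_eq_intros simp: False)
      from has_vector_derivative_real_field[OF this, of "{-pi..pi}"]
      show "(F has_vector_derivative cis (real_of_int a * x)) (at x within {-pi..pi})"
        by (simp add: F_def[abs_def] cis_conv_exp mult.assoc)
    qed (auto intro!: continuous_intros)
    also have "\<dots> = 0"
    proof -
      have "sin (real_of_int a * pi) = 0" using sin_zero_iff_int2 by blast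
      then have "cis (real_of_int a * pi) = cis (real_of_int a * - pi)"
        by (simp add: complex_eq_iff)
      then show ?thesis by (simp add: F_def)
    qed
    finally show ?thesis unfolding * using False by simp
  qed
qed

abbreviation torus1 :: "real measure" where "torus1 \<equiv> restrict_space lborel {-pi..pi}"

definition torus :: "(real \<times> real) measure" where "torus = torus1 \<Otimes>\<^sub>M torus1"


lemma finite_measure_torus1: "finite_measure torus1"
  by (rule finite_measureI) (simp add: emeasure_restrict_space)

lemma finite_measure_torus: "finite_measure torus"
  and pair_sigma_finite_torus: "pair_sigma_finite torus1 torus1"
proof -
  interpret T: finite_measure torus1 by (rule finite_measure_torus1)
  show "pair_sigma_finite torus1 torus1" by unfold_locales
  show "finite_measure torus"
    unfolding torus_def
  proof (rule finite_measureI)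
    have "emeasure (torus1 \<Otimes>\<^sub>M torus1) (space (torus1 \<Otimes>\<^sub>M torus1)) = emeasure torus1 (space torus1) * emeasure torus1 (space torus1)"
      by (simp only: space_pair_measure T.emeasure_pair_measure_Times[OF sets.top sets.top])
    then show "emeasure (torus1 \<Otimes>\<^sub>M torus1) (space (torus1 \<Otimes>\<^sub>M torus1)) \<noteq> \<infinity>"
      using T.emeasure_finite[of "space torus1"] by (simp add: ennreal_mult_eq_top_iff del: T.emeasure_finite)
  qed
qed

lemma measurable_torus [measurable]: "fst \<in> borel_measurable torus" "snd \<in> borel_measurable torus"
proof -
  have [measurable]: "(\<lambda>x. x) \<in> borel_measurable torus1" by (rule measurable_restrict_space1) simp
  have "(\<lambda>z. (\<lambda>x. x) (fst z)) \<in> borel_measurable torus" "(\<lambda>z. (\<lambda>x. x) (snd z)) \<in> borel_measurable torus"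
    unfolding torus_def by measurable
  then show "fst \<in> borel_measurable torus" "snd \<in> borel_measurable torus" by simp_all
qed

lemma measurable_cis [measurable]: "cis \<in> borel_measurable borel"
proof -
  have "continuous_on UNIV cis" by (intro continuous_intros)
  then show ?thesis by (rule borel_measurable_continuous_onI)
qed

lemma integrable_torus_cis: "integrable torus (\<lambda>z. cis (real_of_int a * fst z + real_of_int b * snd z))"
proof -
  interpret T: finite_measure torus by (rule finite_measure_torus)
  show ?thesis by (rule T.integrable_const_bound[where B = 1]) simp_all
qed

lemma integral_torus_cis:
  "(\<integral>z. cis (real_of_int a * fst z + real_of_int b * snd z) \<partial>torus) = (if a = 0 \<and> b = 0 then of_real (4 * pi\<^sup>2) else 0)"
proof -
  interpret P: pair_sigma_finite torus1 torus1 by (rule pair_sigma_finite_torus)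
  have "(\<integral>z. cis (real_of_int a * fst z + real_of_int b * snd z) \<partial>torus)
     = (\<integral>x. (\<integral>y. cis (real_of_int a * x) * cis (real_of_int b * y) \<partial>torus1) \<partial>torus1)"
    using integrable_torus_cis[of a b]
    unfolding torus_def by (subst P.integral_fst'[symmetric]) (simp_all add: cis_mult)
  also have "\<dots> = (\<integral>y. cis (real_of_int b * y) \<partial>torus1) * (\<integral>x. cis (real_of_int a * x) \<partial>torus1)"
    by (simp add: mult.commute)
  also have "\<dots> = (if a = 0 \<and> b = 0 then of_real (4 * pi\<^sup>2) else 0)"
    by (simp add: integral_cis power2_eq_square)
  finally show ?thesis .
qed


lemma measure_torus_rectangle:
  assumes "-pi \<le> a" "a \<le> b" "b \<le> pi" "-pi \<le> c" "c \<le> d" "d \<le> pi"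
  shows "{a<..b} \<times> {c..d} \<in> sets torus" "measure torus ({a<..b} \<times> {c..d}) = (b - a) * (d - c)"
proof -
  interpret T: finite_measure torus1 by (rule finite_measure_torus1)
  have sub: "{a<..b} \<subseteq> {-pi..pi}" "{c..d} \<subseteq> {-pi..pi}" using assms by auto
  have s: "{a<..b} \<in> sets torus1" "{c..d} \<in> sets torus1"
    using sub by (simp_all add: sets_restrict_space_iff)
  show "{a<..b} \<times> {c..d} \<in> sets torus" using s unfolding torus_def by (rule pair_measureI)
  have "emeasure torus ({a<..b} \<times> {c..d}) = emeasure torus1 {a<..b} * emeasure torus1 {c..d}"
    unfolding torus_def using s by (rule T.emeasure_pair_measure_Times)
  also have "\<dots> = ennreal ((b - a) * (d - c))"
    using sub assms by (simp add: emeasure_restrict_space ennreal_mult)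
  finally show "measure torus ({a<..b} \<times> {c..d}) = (b - a) * (d - c)"
    using assms by (simp add: measure_def)
qed

text \<open>
  For a character \<open>\<psi>\<close> of the group this is the Fourier transform of \<open>f\<close>, a ring homomorphism
  from convolution to multiplication.
\<close>

definition char_fun :: "('g \<Rightarrow> complex) \<Rightarrow> ('g \<Rightarrow>\<^sub>0 real) \<Rightarrow> complex" where
  "char_fun \<psi> f = (\<Sum>v\<in>keys f. of_real (lookup f v) * \<psi> v)"

lemma char_fun_superset:
  assumes "finite S" "keys f \<subseteq> S"
  shows "char_fun \<psi> f = (\<Sum>v\<in>S. of_real (lookup f v) * \<psi> v)"
  unfolding char_fun_def using assms by (intro sum.mono_neutral_left) (auto simp: in_keys_iff)

lemma char_fun_mult:
  fixes f g :: "'g::ab_group_add \<Rightarrow>\<^sub>0 real"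
  assumes \<psi>: "\<And>v w. \<psi> (v + w) = \<psi> v * \<psi> w"
  shows "char_fun \<psi> (f * g) = char_fun \<psi> f * char_fun \<psi> g"
proof -
  define S where "S = (\<lambda>(x, y). x + y) ` (keys f \<times> keys g)"
  have S: "finite S" by (simp add: S_def)
  have "keys (f * g) \<subseteq> S" using keys_mult[of f g] by (force simp: S_def)
  then have "char_fun \<psi> (f * g) = (\<Sum>w\<in>S. \<Sum>x\<in>keys f. of_real (lookup f x) * of_real (lookup g (w - x)) * \<psi> w)"
    using S by (simp add: char_fun_superset lookup_mult_group sum_distrib_right)
  also have "\<dots> = (\<Sum>x\<in>keys f. of_real (lookup f x) * \<psi> x * (\<Sum>w\<in>S. of_real (lookup g (w - x)) * \<psi> (w - x)))"
  proof (subst sum.swap, intro sum.cong refl)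
    fix x
    have "\<psi> w = \<psi> x * \<psi> (w - x)" for w using \<psi>[of x "w - x"] by simp
    then have "of_real (lookup f x) * of_real (lookup g (w - x)) * \<psi> w = of_real (lookup f x) * \<psi> x * (of_real (lookup g (w - x)) * \<psi> (w - x))" for w
      by (metis (no_types, opaque_lifting) mult.assoc mult.left_commute)
    then show "(\<Sum>w\<in>S. of_real (lookup f x) * of_real (lookup g (w - x)) * \<psi> w)
       = of_real (lookup f x) * \<psi> x * (\<Sum>w\<in>S. of_real (lookup g (w - x)) * \<psi> (w - x))"
      unfolding sum_distrib_left by (intro sum.cong refl)
  qed
  also have "\<dots> = (\<Sum>x\<in>keys f. of_real (lookup f x) * \<psi> x * char_fun \<psi> g)"
  proof (intro sum.cong refl arg_cong2[where f = "(*)"])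
    fix x assume x: "x \<in> keys f"
    have "(\<Sum>w\<in>S. of_real (lookup g (w - x)) * \<psi> (w - x)) = (\<Sum>v\<in>(\<lambda>w. w - x) ` S. of_real (lookup g v) * \<psi> v)"
      by (subst sum.reindex) (auto simp: inj_on_def)
    also have "\<dots> = char_fun \<psi> g"
    proof (rule char_fun_superset[symmetric])
      show "keys g \<subseteq> (\<lambda>w. w - x) ` S"
      proof
        fix y assume "y \<in> keys g"
        then have "x + y \<in> S" using x by (auto simp: S_def)
        then show "y \<in> (\<lambda>w. w - x) ` S" by (rule rev_image_eqI) simp
      qed
    qed (simp add: S)
    finally show "(\<Sum>w\<in>S. of_real (lookup g (w - x)) * \<psi> (w - x)) = char_fun \<psi> g" .
  qed
  finally show ?thesis by (simp add: char_fun_def[of \<psi> f] flip: sum_distrib_right)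
qed

lemma char_fun_power:
  fixes f :: "'g::ab_group_add \<Rightarrow>\<^sub>0 real"
  assumes \<psi>: "\<And>v w. \<psi> (v + w) = \<psi> v * \<psi> w" and "\<psi> 0 = 1"
  shows "char_fun \<psi> (f ^ n) = char_fun \<psi> f ^ n"
proof (induction n)
  case 0
  then show ?case using assms(2) by (simp add: char_fun_def lookup_one)
next
  case (Suc n)
  then show ?case by (simp add: char_fun_mult[OF \<psi>])
qed


text \<open>
  The remainder of the second-order expansion of the exponential is at most \<open>|t|\<^sup>3 / 6 \<le> t\<^sup>2 / 6\<close>.
\<close>

lemma cos_le:
  fixes t :: real
  assumes "\<bar>t\<bar> \<le> 1" shows "t\<^sup>2 / 3 \<le> 1 - cos t"
proof -
  have "Re (iexp t - (\<Sum>k\<le>2. (\<i> * t)^k / fact k)) \<le> \<bar>t\<bar> ^ 3 / fact 3"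
    using order_trans[OF complex_Re_le_cmod iexp_approx1[of t 2]] by (simp add: eval_nat_numeral)
  also have "Re (iexp t - (\<Sum>k\<le>2. (\<i> * t)^k / fact k)) = cos t - 1 + t\<^sup>2 / 2"
    by (simp add: numeral_2_eq_2 flip: cis_conv_exp)
  also have "\<bar>t\<bar> ^ 3 / fact 3 \<le> t\<^sup>2 / 6"
  proof -
    have "\<bar>t\<bar> ^ 3 = t\<^sup>2 * \<bar>t\<bar>" by (simp add: power3_eq_cube power2_eq_square)
    also have "\<dots> \<le> t\<^sup>2 * 1" using assms by (intro mult_left_mono) auto
    finally show ?thesis by (simp add: fact_numeral)
  qed
  finally show ?thesis by simp
qed

context centred_step_law
begin

definition \<phi> :: "real ^ 'd \<Rightarrow> complex" where
  "\<phi> \<theta> = char_fun (\<lambda>v. cis (\<theta> \<bullet> real_vec v)) q"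

lemma cmod_\<phi>: "cmod (\<phi> \<theta>) \<le> 1"
proof -
  have "cmod (\<phi> \<theta>) \<le> (\<Sum>v\<in>keys q. cmod (of_real (lookup q v) * cis (\<theta> \<bullet> real_vec v)))"
    unfolding \<phi>_def char_fun_def by (rule norm_sum)
  also have "\<dots> = 1" using nonneg by (simp add: norm_mult total)
  finally show ?thesis .
qed

text \<open>
  Near the origin both \<open>1 - Re \<phi>\<close> and \<open>1 - \<phi>\<close> are of order \<open>|\<theta>|\<^sup>2\<close>: from above because the mean is zero and
  the linear term of the expansion cancels, from below because the quadratic form of second moments is
  positive on the unit sphere, hence bounded away from \<open>0\<close> there by compactness.
\<close>

lemma \<phi>_quadratic:
  obtains c L where "c > 0" "L \<ge> 1"
    "\<And>\<theta>. norm \<theta> \<le> 1 / L \<Longrightarrow> c * (norm \<theta>)\<^sup>2 \<le> 1 - Re (\<phi> \<theta>)"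
    "\<And>\<theta>. cmod (1 - \<phi> \<theta>) \<le> L\<^sup>2 * (norm \<theta>)\<^sup>2"
proof -
  define S where "S \<theta> = (\<Sum>v\<in>keys q. lookup q v * (\<theta> \<bullet> real_vec v)\<^sup>2)" for \<theta>
  define L where "L = 1 + (\<Sum>v\<in>keys q. norm (real_vec v))"
  have L1: "L \<ge> 1" by (auto simp: L_def intro!: sum_nonneg)
  have Lv: "norm (real_vec v) \<le> L" if "v \<in> keys q" for v
    using member_le_sum[of v "keys q" "\<lambda>v. norm (real_vec v)"] that by (simp add: L_def)
  have tv: "\<bar>\<theta> \<bullet> real_vec v\<bar> \<le> norm \<theta> * L" if "v \<in> keys q" for v \<theta>
    using Cauchy_Schwarz_ineq2[of \<theta> "real_vec v"] mult_left_mono[OF Lv[OF that], of "norm \<theta>"] by simp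
  have Re\<phi>: "1 - Re (\<phi> \<theta>) = (\<Sum>v\<in>keys q. lookup q v * (1 - cos (\<theta> \<bullet> real_vec v)))" for \<theta>
    by (simp add: \<phi>_def char_fun_def right_diff_distrib sum_subtractf total)
  have Spos: "S \<theta> > 0" if "norm \<theta> = 1" for \<theta>
  proof -
    obtain v where v: "v \<in> keys q" "real_vec v \<bullet> \<theta> \<noteq> 0" using nondegenerate[OF \<open>norm \<theta> = 1\<close>] by blast
    then have "lookup q v * (\<theta> \<bullet> real_vec v)\<^sup>2 > 0"
      using nonneg[of v] by (auto simp: in_keys_iff inner_commute less_le)
    then show ?thesis unfolding S_def using v nonneg by (intro sum_pos2[of _ v]) auto
  qed
  have ne: "sphere (0::real^'d) 1 \<noteq> {}" by simp
  have "continuous_on (sphere 0 1) S" unfolding S_def by (intro continuous_intros)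
  then obtain \<theta>0 where "norm \<theta>0 = 1" and min: "\<And>\<theta>. norm \<theta> = 1 \<Longrightarrow> S \<theta>0 \<le> S \<theta>"
    using continuous_attains_inf[OF compact_sphere ne, of S] by (auto simp: dist_norm)
  then have S0: "S \<theta>0 > 0" using Spos by blast
  have Sbd: "S \<theta>0 * (norm \<theta>)\<^sup>2 \<le> S \<theta>" for \<theta>
  proof (cases "\<theta> = 0")
    case False
    have "S \<theta> = (norm \<theta>)\<^sup>2 * S (\<theta> /\<^sub>R norm \<theta>)"
      using False unfolding S_def by (simp add: sum_distrib_left power_mult_distrib field_simps)
    moreover have "S \<theta>0 \<le> S (\<theta> /\<^sub>R norm \<theta>)" using False by (intro min) simp
    ultimately show ?thesis by (metis mult.commute mult_left_mono zero_le_power2)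
  qed (simp add: S_def)
  show thesis
  proof
    show "S \<theta>0 / 3 > 0" using S0 by simp
    show "L \<ge> 1" by (rule L1)
    show "S \<theta>0 / 3 * (norm \<theta>)\<^sup>2 \<le> 1 - Re (\<phi> \<theta>)" if "norm \<theta> \<le> 1 / L" for \<theta>
    proof -
      have nL: "norm \<theta> * L \<le> 1" using that L1 by (simp add: field_simps)
      have "S \<theta>0 / 3 * (norm \<theta>)\<^sup>2 \<le> S \<theta> / 3" using Sbd[of \<theta>] by simp
      also have "\<dots> = (\<Sum>v\<in>keys q. lookup q v * ((\<theta> \<bullet> real_vec v)\<^sup>2 / 3))"
        by (simp add: S_def sum_divide_distrib)
      also have "\<dots> \<le> 1 - Re (\<phi> \<theta>)"
        unfolding Re\<phi> using nonneg tv[of _ \<theta>] nL by (intro sum_mono mult_left_mono cos_le) force+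
      finally show ?thesis .
    qed
    show "cmod (1 - \<phi> \<theta>) \<le> L\<^sup>2 * (norm \<theta>)\<^sup>2" for \<theta>
    proof -
      have "(\<Sum>v\<in>keys q. lookup q v * (\<theta> \<bullet> real_vec v)) = \<theta> \<bullet> (\<Sum>v\<in>keys q. lookup q v *\<^sub>R real_vec v)"
        by (simp add: inner_sum_right)
      then have m: "(\<Sum>v\<in>keys q. of_real (lookup q v) * (\<i> * of_real (\<theta> \<bullet> real_vec v))) = 0"
        using mean by (simp add: mult.left_commute[of _ \<i>] flip: sum_distrib_left of_real_mult of_real_sum)
      have t: "(\<Sum>v\<in>keys q. complex_of_real (lookup q v)) = 1"
        using total by (simp flip: of_real_sum)
      have "\<phi> \<theta> - 1 = (\<Sum>v\<in>keys q. of_real (lookup q v) * (iexp (\<theta> \<bullet> real_vec v) - (\<Sum>k\<le>1. (\<i> * (\<theta> \<bullet> real_vec v))^k / fact k)))"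
        using m t by (simp add: \<phi>_def char_fun_def cis_conv_exp algebra_simps sum.distrib sum_subtractf)
      then have "cmod (1 - \<phi> \<theta>) = cmod \<dots>" by (metis norm_minus_commute)
      also have "\<dots> \<le> (\<Sum>v\<in>keys q. lookup q v * (L\<^sup>2 * (norm \<theta>)\<^sup>2))"
      proof (rule sum_norm_le)
        fix v assume v: "v \<in> keys q"
        have "cmod (iexp (\<theta> \<bullet> real_vec v) - (\<Sum>k\<le>1. (\<i> * (\<theta> \<bullet> real_vec v))^k / fact k)) \<le> \<bar>\<theta> \<bullet> real_vec v\<bar>^(Suc 1) / fact (Suc 1)"
          by (rule iexp_approx1)
        also have "\<dots> \<le> \<bar>\<theta> \<bullet> real_vec v\<bar>\<^sup>2" by (simp add: power2_eq_square)
        also have "\<dots> \<le> (norm \<theta> * L)\<^sup>2" using tv[OF v, of \<theta>] by (intro power_mono) auto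
        finally show "cmod (of_real (lookup q v) * (iexp (\<theta> \<bullet> real_vec v) - (\<Sum>k\<le>1. (\<i> * (\<theta> \<bullet> real_vec v))^k / fact k)))
             \<le> lookup q v * (L\<^sup>2 * (norm \<theta>)\<^sup>2)"
          using nonneg[of v] by (simp add: norm_mult mult_left_mono power_mult_distrib mult.commute)
      qed
      also have "\<dots> = L\<^sup>2 * (norm \<theta>)\<^sup>2" by (simp add: total flip: sum_distrib_right)
      finally show ?thesis .
    qed
  qed
qed


text \<open>
  Suppose the expected numbers of returns to the origin were bounded by \<open>B\<close>. By Fourier inversion the
  integral of \<open>Re (1 / (1 - r \<phi>))\<close> over the torus is \<open>4 \<pi>\<^sup>2\<close> times the \<open>r\<close>-discounted number of returns,
  so it is bounded uniformly in \<open>r < 1\<close>. But the integrand is nonnegative and at least of order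
  \<open>1 / (\<epsilon> + |\<theta>|\<^sup>2)\<close> with \<open>\<epsilon> = 1 - r\<close>. The rectangles \<open>A j\<close> at distance about \<open>\<delta> 2\<^bsup>-j\<^esup>\<close> from the origin, with
  area of order \<open>4\<^bsup>-j\<^esup>\<close>, each contribute a fixed amount as long as \<open>4\<^bsup>-j\<^esup> \<delta>\<^sup>2 \<ge> \<epsilon>\<close>, so their number
  can be made too large.
\<close>

theorem planar_walk_recurrent:
  assumes d2: "CARD('d) = 2"
  shows "\<exists>K. (\<Sum>k<K. lookup (q ^ k) 0) > B"
proof (rule ccontr)
  assume "\<not> ?thesis"
  then have B: "(\<Sum>k<K. lookup (q ^ k) 0) \<le> B" for K by (auto simp: not_less)
  interpret T: finite_measure torus by (rule finite_measure_torus)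
  obtain i1 i2 :: 'd where ii: "UNIV = {i1, i2}" "i1 \<noteq> i2" using d2 by (auto simp: card_2_iff)
  define th where "th z = (\<chi> i. if i = i1 then fst z else (snd z :: real))" for z :: "real \<times> real"
  have th_inner: "th z \<bullet> real_vec v = real_of_int (v $ i1) * fst z + real_of_int (v $ i2) * snd z" for z and v :: "int ^ 'd"
    using ii(2) by (simp add: th_def inner_vec_def ii(1) real_vec_def)
  have th_norm: "(norm (th z))\<^sup>2 = (fst z)\<^sup>2 + (snd z)\<^sup>2" for z
    using ii(2) by (simp add: th_def power2_norm_eq_inner inner_vec_def ii(1)) (simp add: power2_eq_square)
  have [measurable]: "(\<lambda>z. \<phi> (th z)) \<in> borel_measurable torus"
    unfolding \<phi>_def char_fun_def th_inner by measurable
  have Fourier: "(\<integral>z. \<phi> (th z) ^ k \<partial>torus) = of_real (4 * pi\<^sup>2 * lookup (q ^ k) 0)" for k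
  proof -
    have "\<phi> (th z) ^ k = (\<Sum>v\<in>keys (q ^ k). of_real (lookup (q ^ k) v) * cis (real_of_int (v $ i1) * fst z + real_of_int (v $ i2) * snd z))" for z
    proof -
      have "\<phi> (th z) ^ k = char_fun (\<lambda>v. cis (th z \<bullet> real_vec v)) (q ^ k)"
        unfolding \<phi>_def by (rule char_fun_power[symmetric]) (simp_all add: cis_mult real_vec_add inner_add_right)
      then show ?thesis by (simp only: char_fun_def th_inner)
    qed
    then have "(\<integral>z. \<phi> (th z) ^ k \<partial>torus) = (\<Sum>v\<in>keys (q ^ k). \<integral>z. of_real (lookup (q ^ k) v) * cis (real_of_int (v $ i1) * fst z + real_of_int (v $ i2) * snd z) \<partial>torus)"
      by (simp add: integrable_torus_cis)
    also have "\<dots> = (\<Sum>v\<in>keys (q ^ k). if v = 0 then of_real (4 * pi\<^sup>2 * lookup (q ^ k) 0) else 0)"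
    proof (rule sum.cong[OF refl])
      fix v :: "int ^ 'd"
      have "v = 0 \<longleftrightarrow> v $ i1 = 0 \<and> v $ i2 = 0"
      proof -
        have "i = i1 \<or> i = i2" for i using ii(1) by blast
        then have "(\<forall>i. v $ i = 0) \<longleftrightarrow> v $ i1 = 0 \<and> v $ i2 = 0" by metis
        then show ?thesis by (simp add: vec_eq_iff)
      qed
      then show "(\<integral>z. of_real (lookup (q ^ k) v) * cis (real_of_int (v $ i1) * fst z + real_of_int (v $ i2) * snd z) \<partial>torus)
        = (if v = 0 then of_real (4 * pi\<^sup>2 * lookup (q ^ k) 0) else 0)"
        unfolding integral_mult_right_zero integral_torus_cis by (cases "v = 0") auto
    qed
    also have "\<dots> = of_real (4 * pi\<^sup>2 * lookup (q ^ k) 0)"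
      by (simp add: in_keys_iff)
    finally show ?thesis .
  qed
  have intk: "integrable torus (\<lambda>z. \<phi> (th z) ^ k)" for k
    by (rule T.integrable_const_bound[where B = 1]) (auto simp: norm_power cmod_\<phi> power_le_one)
  have upper: "(\<integral>z. Re (1 / (1 - of_real r * \<phi> (th z))) \<partial>torus) \<le> 4 * pi\<^sup>2 * B + 1"
    and int_r: "integrable torus (\<lambda>z. Re (1 / (1 - of_real r * \<phi> (th z))))" if r: "0 < r" "r < 1" for r
  proof -
    define H where "H z = 1 / (1 - of_real r * \<phi> (th z))" for z
    have cm: "cmod (of_real r * \<phi> (th z)) \<le> r" for z
      using r cmod_\<phi>[of "th z"] by (simp add: norm_mult mult_left_le)
    have ge: "1 - r \<le> cmod (1 - of_real r * \<phi> (th z))" for z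
      using norm_triangle_ineq2[of 1 "of_real r * \<phi> (th z)"] cm[of z] by simp
    have cH: "cmod (H z) \<le> 1 / (1 - r)" for z
      using ge[of z] r by (simp add: H_def norm_divide frac_le)
    have [measurable]: "H \<in> borel_measurable torus" unfolding H_def[abs_def] by measurable
    have intH: "integrable torus H"
      by (rule T.integrable_const_bound[where B = "1 / (1 - r)"]) (auto simp: cH)
    then show "integrable torus (\<lambda>z. Re (1 / (1 - of_real r * \<phi> (th z))))"
      unfolding H_def[symmetric] by (rule integrable_Re)
    have "(\<lambda>K. r ^ K / (1 - r) * measure torus (space torus)) \<longlonglongrightarrow> 0 / (1 - r) * measure torus (space torus)"
      using r by (intro tendsto_intros) auto
    then have "\<forall>\<^sub>F K in sequentially. r ^ K / (1 - r) * measure torus (space torus) < 1"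
      by (rule order_tendstoD) simp
    then obtain K where K: "r ^ K / (1 - r) * measure torus (space torus) < 1"
      by (auto simp: eventually_sequentially)
    have intKH: "integrable torus (\<lambda>z. (of_real r * \<phi> (th z)) ^ K * H z)"
    proof (rule T.integrable_const_bound[where B = "r ^ K / (1 - r)"])
      have "cmod ((of_real r * \<phi> (th z)) ^ K * H z) \<le> r ^ K * (1 / (1 - r))" for z
        unfolding norm_mult norm_power using cm[of z] cH[of z] r by (intro mult_mono power_mono) (auto simp: norm_mult)
      then show "AE z in torus. cmod ((of_real r * \<phi> (th z)) ^ K * H z) \<le> r ^ K / (1 - r)" by simp
    qed simp
    have "H z = (\<Sum>k<K. of_real (r ^ k) * \<phi> (th z) ^ k) + (of_real r * \<phi> (th z)) ^ K * H z" for z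
    proof -
      have ne: "of_real r * \<phi> (th z) \<noteq> 1" using cm[of z] r by auto
      have "(\<Sum>k<K. (of_real r * \<phi> (th z)) ^ k) = (1 - (of_real r * \<phi> (th z)) ^ K) * H z"
        unfolding H_def using ne by (subst geometric_sum) (auto simp: field_simps)
      then show ?thesis by (simp add: power_mult_distrib algebra_simps)
    qed
    then have "(\<integral>z. H z \<partial>torus) = (\<integral>z. (\<Sum>k<K. of_real (r ^ k) * \<phi> (th z) ^ k) + (of_real r * \<phi> (th z)) ^ K * H z \<partial>torus)"
      by presburger
    also have "\<dots> = (\<Sum>k<K. of_real (r ^ k) * (\<integral>z. \<phi> (th z) ^ k \<partial>torus)) + (\<integral>z. (of_real r * \<phi> (th z)) ^ K * H z \<partial>torus)"
      using intKH intk by simp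
    finally have "Re (\<integral>z. H z \<partial>torus) = (\<Sum>k<K. r ^ k * (4 * pi\<^sup>2 * lookup (q ^ k) 0)) + Re (\<integral>z. (of_real r * \<phi> (th z)) ^ K * H z \<partial>torus)"
      unfolding Fourier by (simp flip: of_real_mult of_real_power)
    also have "(\<Sum>k<K. r ^ k * (4 * pi\<^sup>2 * lookup (q ^ k) 0)) \<le> (\<Sum>k<K. 4 * pi\<^sup>2 * lookup (q ^ k) 0)"
    proof (rule sum_mono)
      fix k
      show "r ^ k * (4 * pi\<^sup>2 * lookup (q ^ k) 0) \<le> 4 * pi\<^sup>2 * lookup (q ^ k) 0"
        using r lookup_power_nonneg[of k 0] by (intro mult_left_le_one_le) (auto simp: power_le_one)
    qed
    also have "\<dots> \<le> 4 * pi\<^sup>2 * B" using B[of K] by (simp flip: sum_distrib_left)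
    also have "Re (\<integral>z. (of_real r * \<phi> (th z)) ^ K * H z \<partial>torus) \<le> 1"
    proof -
      have "Re (\<integral>z. (of_real r * \<phi> (th z)) ^ K * H z \<partial>torus) \<le> cmod (\<integral>z. (of_real r * \<phi> (th z)) ^ K * H z \<partial>torus)"
        by (rule complex_Re_le_cmod)
      also have "\<dots> \<le> (\<integral>z. cmod ((of_real r * \<phi> (th z)) ^ K * H z) \<partial>torus)" by (rule integral_norm_bound)
      also have "\<dots> \<le> (\<integral>z. r ^ K / (1 - r) \<partial>torus)"
      proof (rule integral_mono)
        fix z
        have "cmod ((of_real r * \<phi> (th z)) ^ K * H z) \<le> r ^ K * (1 / (1 - r))"
          unfolding norm_mult norm_power using cm[of z] cH[of z] r by (intro mult_mono power_mono) (auto simp: norm_mult)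
        then show "cmod ((of_real r * \<phi> (th z)) ^ K * H z) \<le> r ^ K / (1 - r)" by simp
      qed (use intKH in \<open>auto intro: integrable_norm\<close>)
      also have "\<dots> \<le> 1" using K by (simp add: mult.commute)
      finally show ?thesis .
    qed
    finally have "Re (\<integral>z. H z \<partial>torus) \<le> 4 * pi\<^sup>2 * B + 1" by simp
    then show "(\<integral>z. Re (1 / (1 - of_real r * \<phi> (th z))) \<partial>torus) \<le> 4 * pi\<^sup>2 * B + 1"
      using integral_Re[OF intH] by (simp only: H_def[abs_def])
  qed
  obtain c L where cL: "c > 0" "L \<ge> 1"
    and c: "\<And>\<theta>. norm \<theta> \<le> 1 / L \<Longrightarrow> c * (norm \<theta>)\<^sup>2 \<le> 1 - Re (\<phi> \<theta>)"
    and L: "\<And>\<theta>. cmod (1 - \<phi> \<theta>) \<le> L\<^sup>2 * (norm \<theta>)\<^sup>2"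
    using \<phi>_quadratic by blast
  define c1 where "c1 = min 1 (c / 2)"
  define \<delta> where "\<delta> = 1 / (2 * L)"
  have \<delta>: "0 < \<delta>" "\<delta> \<le> 1 / 2" using cL by (auto simp: \<delta>_def field_simps)
  have c1: "c1 > 0" "c1 \<le> 1" "c1 \<le> c / 2" using cL by (auto simp: c1_def)
  define c2 where "c2 = c1 / (L\<^sup>2)\<^sup>2"
  have c2: "c2 > 0" using c1 cL by (simp add: c2_def)
  define A where "A j = {\<delta> / 2 ^ Suc j<..\<delta> / 2 ^ j} \<times> {0..\<delta> / 2 ^ j}" for j :: nat
  have small: "\<delta> / 2 ^ j \<le> \<delta>" for j :: nat
    using \<delta> by (simp add: divide_le_eq mult_le_cancel_left1)
  have A: "A j \<in> sets torus" "measure torus (A j) = \<delta>\<^sup>2 / 4 ^ j / 2" for j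
  proof -
    have p0: "0 < \<delta> / 2 ^ j" "0 < \<delta> / 2 ^ Suc j" using \<delta> by simp_all
    have "\<delta> / 2 ^ j \<le> pi" using small[of j] \<delta> pi_gt3 by linarith
    moreover have "\<delta> / 2 ^ Suc j \<le> \<delta> / 2 ^ j" using \<delta> by (intro divide_left_mono) auto
    moreover have "- pi \<le> \<delta> / 2 ^ Suc j" "-pi \<le> 0" "0 \<le> \<delta> / 2 ^ j" using p0 pi_gt_zero by linarith+
    ultimately have b: "\<delta> / 2 ^ j \<le> pi" "\<delta> / 2 ^ Suc j \<le> \<delta> / 2 ^ j" "- pi \<le> \<delta> / 2 ^ Suc j" "-pi \<le> 0" "0 \<le> \<delta> / 2 ^ j" by simp_all
    note R = measure_torus_rectangle[OF b(3,2,1,4,5,1)]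
    show "A j \<in> sets torus" using R(1) by (simp add: A_def)
    show "measure torus (A j) = \<delta>\<^sup>2 / 4 ^ j / 2"
      using R(2) by (simp add: A_def field_simps power2_eq_square flip: power_mult_distrib)
  qed
  have disj: "\<not> (z \<in> A j \<and> z \<in> A k)" if "j < k" for z j k
  proof -
    have "\<delta> / 2 ^ k \<le> \<delta> / 2 ^ Suc j"
      using that \<delta> by (intro divide_left_mono power_increasing) auto
    then show ?thesis by (auto simp: A_def)
  qed
  obtain J :: nat where J: "real J * (c2 / 6) > 4 * pi\<^sup>2 * B + 1"
    using reals_Archimedean3[of "c2 / 6"] c2 by (metis divide_pos_pos zero_less_numeral)
  define \<epsilon> where "\<epsilon> = \<delta>\<^sup>2 / 4 ^ J"
  have "\<delta>\<^sup>2 \<le> (1 / 2)\<^sup>2" using \<delta> by (intro power_mono) auto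
  moreover have "\<epsilon> \<le> \<delta>\<^sup>2" unfolding \<epsilon>_def by (simp add: divide_le_eq mult_le_cancel_left1)
  ultimately have "\<epsilon> \<le> (1 / 2)\<^sup>2" by simp
  moreover have "\<epsilon> > 0" using \<delta> by (simp add: \<epsilon>_def)
  ultimately have \<epsilon>: "0 < \<epsilon>" "\<epsilon> \<le> 1 / 2" by (simp_all add: power2_eq_square)
  define r where "r = 1 - \<epsilon>"
  have r: "0 < r" "r < 1" "1 / 2 \<le> r" using \<epsilon> by (auto simp: r_def)
  define g where "g z = Re (1 / (1 - of_real r * \<phi> (th z)))" for z
  have gRe: "g z = Re (1 - of_real r * \<phi> (th z)) / (cmod (1 - of_real r * \<phi> (th z)))\<^sup>2" for z
    by (simp add: g_def Re_divide cmod_power2)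
  have g0: "g z \<ge> 0" for z
  proof -
    have "Re (\<phi> (th z)) \<le> 1" using order_trans[OF complex_Re_le_cmod cmod_\<phi>] .
    then have "r * Re (\<phi> (th z)) \<le> r * 1" using r by (intro mult_left_mono) auto
    then have "r * Re (\<phi> (th z)) \<le> 1" using r by linarith
    then show ?thesis by (simp add: gRe)
  qed
  have gA: "c2 / 3 * (4 ^ j / \<delta>\<^sup>2) \<le> g z" if "j < J" "z \<in> A j" for j z
  proof -
    define s where "s = (norm (th z))\<^sup>2"
    have xy: "0 \<le> fst z" "fst z \<le> \<delta> / 2 ^ j" "0 \<le> snd z" "snd z \<le> \<delta> / 2 ^ j"
      using that(2) \<delta> less_imp_le[of "\<delta> / 2 ^ Suc j" "fst z"] order_trans[of 0 "\<delta> / 2 ^ Suc j" "fst z"]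
      by (auto simp: A_def mem_Times_iff)
    have "s \<le> (\<delta> / 2 ^ j)\<^sup>2 + (\<delta> / 2 ^ j)\<^sup>2"
      unfolding s_def th_norm using xy by (intro add_mono power_mono)
    also have "\<dots> = 2 * (\<delta>\<^sup>2 / 4 ^ j)"
    proof -
      have "(2 ^ j)\<^sup>2 = (4::real) ^ j" by (simp add: power2_eq_square flip: power_mult_distrib)
      then show ?thesis by (simp add: power_divide)
    qed
    finally have s: "s \<le> 2 * (\<delta>\<^sup>2 / 4 ^ j)" .
    have "\<delta>\<^sup>2 / 4 ^ j \<le> \<delta>\<^sup>2" by (simp add: divide_le_eq mult_le_cancel_left1)
    then have "s \<le> 4 * \<delta>\<^sup>2" using s zero_le_power2[of \<delta>] by linarith
    also have "\<dots> = (1 / L)\<^sup>2" by (simp add: \<delta>_def power2_eq_square)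
    finally have "(norm (th z))\<^sup>2 \<le> (1 / L)\<^sup>2" by (simp only: s_def)
    then have nL: "norm (th z) \<le> 1 / L"
      by (rule power2_le_imp_le) (use cL in auto)
    have "\<epsilon> \<le> \<delta>\<^sup>2 / 4 ^ j"
    proof -
      have "(4::real) ^ j \<le> 4 ^ J" using that(1) by (intro power_increasing) auto
      then show ?thesis unfolding \<epsilon>_def by (intro divide_left_mono) auto
    qed
    then have es: "\<epsilon> + s \<le> 3 * (\<delta>\<^sup>2 / 4 ^ j)" using s by simp
    have s0: "s \<ge> 0" by (simp add: s_def)
    have espos: "\<epsilon> + s > 0" using \<epsilon> s0 by simp
    define w where "w = 1 - of_real r * \<phi> (th z)"
    have "w = of_real \<epsilon> + of_real r * (1 - \<phi> (th z))" by (simp add: w_def r_def algebra_simps)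
    then have "cmod w \<le> \<epsilon> + r * cmod (1 - \<phi> (th z))"
      using norm_triangle_ineq[of "of_real \<epsilon>" "of_real r * (1 - \<phi> (th z))"] \<epsilon> r by (simp add: norm_mult)
    also have "\<dots> \<le> L\<^sup>2 * \<epsilon> + 1 * (L\<^sup>2 * s)"
      using L[of "th z"] r cL \<epsilon> by (intro add_mono mult_mono) (auto simp: s_def)
    finally have wle: "cmod w \<le> L\<^sup>2 * (\<epsilon> + s)" by (simp add: algebra_simps)
    have "c1 * (\<epsilon> + s) \<le> 1 * \<epsilon> + c / 2 * s"
      unfolding distrib_left using c1 \<epsilon> s0 by (intro add_mono mult_right_mono) auto
    also have "\<dots> \<le> \<epsilon> + r * (1 - Re (\<phi> (th z)))"
    proof -
      have "1 / 2 * (c * s) \<le> r * (1 - Re (\<phi> (th z)))"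
        using c[OF nL] r cL s0 by (intro mult_mono) (auto simp: s_def)
      then show ?thesis by simp
    qed
    also have "\<dots> = Re w" by (simp add: w_def r_def algebra_simps)
    finally have Rew: "c1 * (\<epsilon> + s) \<le> Re w" .
    have w0: "cmod w > 0"
    proof -
      have "0 < c1 * (\<epsilon> + s)" using c1 espos by simp
      then show ?thesis using Rew complex_Re_le_cmod[of w] by linarith
    qed
    have "c2 / 3 * (4 ^ j / \<delta>\<^sup>2) = c2 / (3 * (\<delta>\<^sup>2 / 4 ^ j))" by simp
    also have "\<dots> \<le> c2 / (\<epsilon> + s)" using es espos c2 \<delta> by (intro divide_left_mono mult_pos_pos) auto
    also have "\<dots> = c1 * (\<epsilon> + s) / (L\<^sup>2 * (\<epsilon> + s))\<^sup>2"
      using espos cL by (simp add: c2_def power_mult_distrib power2_eq_square)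
    also have "\<dots> \<le> Re w / (cmod w)\<^sup>2"
    proof (rule frac_le)
      show "0 \<le> Re w" using Rew c1 espos by (meson less_imp_le mult_nonneg_nonneg order_trans)
      show "(cmod w)\<^sup>2 \<le> (L\<^sup>2 * (\<epsilon> + s))\<^sup>2" using wle by (intro power_mono) auto
    qed (use Rew w0 in auto)
    finally show ?thesis by (simp add: gRe w_def)
  qed
  have intA: "integrable torus (\<lambda>z. c2 / 3 * (4 ^ j / \<delta>\<^sup>2) * indicator (A j) z)" for j
    using A(1)[of j] by (intro integrable_mult_right integrable_real_indicator) (auto simp: less_top[symmetric])
  have "real J * (c2 / 6) = (\<Sum>j<J. c2 / 3 * (4 ^ j / \<delta>\<^sup>2) * measure torus (A j))"
    using \<delta> by (simp add: A)
  also have "\<dots> = (\<integral>z. (\<Sum>j<J. c2 / 3 * (4 ^ j / \<delta>\<^sup>2) * indicator (A j) z) \<partial>torus)"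
  proof -
    have "(\<integral>z. c2 / 3 * (4 ^ j / \<delta>\<^sup>2) * indicator (A j) z \<partial>torus) = c2 / 3 * (4 ^ j / \<delta>\<^sup>2) * measure torus (A j)" for j
      using sets.sets_into_space[OF A(1)] by (subst integral_mult_right_zero) (simp add: Int_absorb2)
    then show ?thesis using intA by (subst Bochner_Integration.integral_sum) presburger+
  qed
  also have "\<dots> \<le> (\<integral>z. g z \<partial>torus)"
  proof (rule integral_mono)
    show "integrable torus (\<lambda>z. \<Sum>j<J. c2 / 3 * (4 ^ j / \<delta>\<^sup>2) * indicator (A j) z)"
      by (intro Bochner_Integration.integrable_sum intA)
    show "integrable torus g" unfolding g_def[abs_def] by (rule int_r) (use r in auto)
    show "(\<Sum>j<J. c2 / 3 * (4 ^ j / \<delta>\<^sup>2) * indicator (A j) z) \<le> g z" for z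
    proof (cases "\<exists>j<J. z \<in> A j")
      case True
      then obtain j where j: "j < J" "z \<in> A j" by blast
      have "(\<Sum>i<J. c2 / 3 * (4 ^ i / \<delta>\<^sup>2) * indicator (A i) z) = (\<Sum>i\<in>{j}. c2 / 3 * (4 ^ i / \<delta>\<^sup>2) * indicator (A i) z)"
        using j disj[of _ j z] disj[of j _ z] by (intro sum.mono_neutral_right) (auto simp: indicator_def, metis nat_neq_iff)
      also have "\<dots> \<le> g z" using gA[OF j] j by simp
      finally show ?thesis .
    next
      case False
      then show ?thesis using g0 by (subst sum.neutral) (auto simp: indicator_def)
    qed
  qed
  also have "\<dots> \<le> 4 * pi\<^sup>2 * B + 1" unfolding g_def by (rule upper) (use r in auto)
  finally show False using J by simp
qed

end

section \<open>Ranges of interrupted paths\<close>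

text \<open>
  Every value of the path has exactly one last visit before time \<open>n\<close>.
\<close>

lemma card_image_eq_last_visits:
  fixes x :: "nat \<Rightarrow> 'b"
  shows "card (x ` {0..n}) = card {k\<in>{0..n}. \<forall>j\<in>{k<..n}. x j \<noteq> x k}"
proof -
  let ?L = "{k\<in>{0..n}. \<forall>j\<in>{k<..n}. x j \<noteq> x k}"
  have "x ` ?L = x ` {0..n}"
  proof (intro equalityI subsetI)
    fix y assume "y \<in> x ` {0..n}"
    then have ne: "{k\<in>{0..n}. x k = y} \<noteq> {}" by auto
    define k where "k = Max {k\<in>{0..n}. x k = y}"
    have k: "k \<in> {k\<in>{0..n}. x k = y}" unfolding k_def by (rule Max_in) (use ne in auto)
    have "x j \<noteq> x k" if "j \<in> {k<..n}" for j
    proof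
      assume "x j = x k"
      then have "j \<le> k" using that k unfolding k_def by (intro Max_ge) auto
      then show False using that by simp
    qed
    then show "y \<in> x ` ?L" using k by blast
  qed auto
  moreover have "inj_on x ?L"
  proof (rule inj_onI)
    fix a b assume "a \<in> ?L" "b \<in> ?L" "x a = x b"
    then have "\<not> a < b" "\<not> b < a" by force+
    then show "a = b" by simp
  qed
  ultimately show ?thesis using card_image[of x ?L] by simp
qed

lemma card_windows_meeting_le:
  fixes J :: "nat set"
  shows "card {k. k + m \<le> n \<and> J \<inter> {k<..k + m} \<noteq> {}} \<le> m * card (J \<inter> {1..n})"
proof -
  have "{k. k + m \<le> n \<and> (\<exists>i\<in>J. i \<in> {k<..k + m})} \<subseteq> (\<Union>i\<in>J \<inter> {1..n}. {i - m..<i})"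
  proof clarify
    fix k i assume k: "k + m \<le> n" "i \<in> J" "i \<in> {k<..k + m}"
    then have "i \<in> J \<inter> {1..n}" "k \<in> {i - m..<i}" by auto
    then show "k \<in> (\<Union>i\<in>J \<inter> {1..n}. {i - m..<i})" by blast
  qed
  moreover have "{k. k + m \<le> n \<and> J \<inter> {k<..k + m} \<noteq> {}} = {k. k + m \<le> n \<and> (\<exists>i\<in>J. i \<in> {k<..k + m})}"
    by blast
  ultimately have "card {k. k + m \<le> n \<and> J \<inter> {k<..k + m} \<noteq> {}} \<le> card (\<Union>i\<in>J \<inter> {1..n}. {i - m..<i})"
    by (intro card_mono) auto
  also have "\<dots> \<le> (\<Sum>i\<in>J \<inter> {1..n}. card {i - m..<i})" by (rule card_UN_le) simp
  also have "\<dots> \<le> (\<Sum>i\<in>J \<inter> {1..n}. m)" by (intro sum_mono) auto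
  finally show ?thesis by (simp add: mult.commute)
qed

text \<open>
  A path \<open>x\<close> that follows given increments except at the times in \<open>J\<close>, where it moves arbitrarily:
  \<open>b k t\<close> is the sum of the \<open>t\<close> increments following time \<open>k\<close>.
\<close>

locale interrupted_path =
  fixes x :: "nat \<Rightarrow> 'g::ab_group_add" and b :: "nat \<Rightarrow> nat \<Rightarrow> 'g" and J :: "nat set"
  assumes uninterrupted: "J \<inter> {k<..k + t} = {} \<Longrightarrow> x (k + t) = x k + b k t"
begin

definition no_return :: "nat \<Rightarrow> nat \<Rightarrow> nat" where
  "no_return n m = card {k\<in>{..<n}. \<forall>t\<in>{1..m}. b k t \<noteq> 0}"

definition late_revisits :: "nat \<Rightarrow> nat \<Rightarrow> nat" where
  "late_revisits n m = card {j\<in>{..n}. \<exists>i. i + m < j \<and> x i = x j}"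

text \<open>
  A last visit \<open>k\<close> at least \<open>m\<close> steps before the end is a time without return within \<open>m\<close> steps; if the
  window of length \<open>m\<close> after \<open>k\<close> avoids \<open>J\<close>, this can be read off from \<open>b\<close>.
\<close>

lemma range_upper: "card (x ` {0..n}) \<le> no_return n m + (m + 1) + m * card (J \<inter> {1..n})"
proof -
  let ?B = "{k. k + m \<le> n \<and> J \<inter> {k<..k + m} \<noteq> {}}"
  let ?W = "{k\<in>{..<n}. \<forall>t\<in>{1..m}. b k t \<noteq> 0}"
  have "{k\<in>{0..n}. \<forall>j\<in>{k<..n}. x j \<noteq> x k} \<subseteq> (?W \<union> {n - m..n}) \<union> ?B"
  proof
    fix k assume k: "k \<in> {k\<in>{0..n}. \<forall>j\<in>{k<..n}. x j \<noteq> x k}"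
    show "k \<in> (?W \<union> {n - m..n}) \<union> ?B"
    proof (rule ccontr)
      assume neg: "k \<notin> (?W \<union> {n - m..n}) \<union> ?B"
      then have km: "k + m < n" using k by auto
      then obtain t where t: "t \<in> {1..m}" "b k t = 0" using neg by auto
      have "J \<inter> {k<..k + m} = {}" using neg km by auto
      then have "J \<inter> {k<..k + t} = {}" using t(1) by auto
      then have "x (k + t) = x k" using uninterrupted[of k t] t(2) by simp
      moreover have "k + t \<in> {k<..n}" using t(1) km by auto
      ultimately show False using k by blast
    qed
  qed
  moreover have finB: "finite ?B" by (rule finite_subset[of _ "{..n}"]) auto
  ultimately have "card (x ` {0..n}) \<le> card ((?W \<union> {n - m..n}) \<union> ?B)"
    unfolding card_image_eq_last_visits by (intro card_mono) auto
  also have "\<dots> \<le> (card ?W + card {n - m..n}) + card ?B"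
    by (meson add_mono card_Un_le order_refl order_trans)
  also have "\<dots> \<le> (no_return n m + (m + 1)) + m * card (J \<inter> {1..n})"
    using card_windows_meeting_le[of m n J] by (intro add_mono) (auto simp: no_return_def)
  finally show ?thesis .
qed

text \<open>
  A time \<open>k\<close> whose undisturbed window has no return is a last visit unless the site is visited
  again after more than \<open>m\<close> steps. The next visit determines \<open>k\<close>, so the exceptions inject into the
  late revisits.
\<close>

lemma range_lower: "no_return n m \<le> card (x ` {0..n}) + m + m * card (J \<inter> {1..n}) + late_revisits n m"
proof -
  let ?B = "{k. k + m \<le> n \<and> J \<inter> {k<..k + m} \<noteq> {}}"
  let ?L = "{k\<in>{0..n}. \<forall>j\<in>{k<..n}. x j \<noteq> x k}"
  let ?R = "{j\<in>{..n}. \<exists>i. i + m < j \<and> x i = x j}"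
  let ?N = "{k. k + m \<le> n \<and> (\<exists>j\<in>{k<..n}. x j = x k) \<and> (\<forall>j\<in>{k<..k + m}. x j \<noteq> x k)}"
  define nxt where "nxt k = (LEAST j. k < j \<and> x j = x k)" for k
  have nxt: "k < nxt k \<and> x (nxt k) = x k \<and> (\<forall>j. k < j \<and> x j = x k \<longrightarrow> nxt k \<le> j)" if "\<exists>j>k. x j = x k" for k
    using LeastI_ex[OF that] unfolding nxt_def by (auto intro: Least_le)
  have "card ?N \<le> card ?R"
  proof (rule card_inj_on_le)
    show "inj_on nxt ?N"
    proof (rule inj_onI)
      fix k l assume k: "k \<in> ?N" and l: "l \<in> ?N" and eq: "nxt k = nxt l"
      have nk: "k < nxt k \<and> x (nxt k) = x k \<and> (\<forall>j. k < j \<and> x j = x k \<longrightarrow> nxt k \<le> j)" using k by (intro nxt) auto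
      have nl: "l < nxt l \<and> x (nxt l) = x l \<and> (\<forall>j. l < j \<and> x j = x l \<longrightarrow> nxt l \<le> j)" using l by (intro nxt) auto
      show "k = l"
      proof (rule ccontr)
        assume "k \<noteq> l"
        then consider "k < l" | "l < k" by linarith
        then show False
        proof cases
          case 1
          then have "nxt k \<le> l" using nk nl eq by metis
          then show False using nl eq by simp
        next
          case 2
          then have "nxt l \<le> k" using nk nl eq by metis
          then show False using nk eq by simp
        qed
      qed
    qed
    show "nxt ` ?N \<subseteq> ?R"
    proof (rule image_subsetI)
      fix k assume "k \<in> ?N"
      then obtain j where k: "k + m \<le> n" "j \<in> {k<..n}" "x j = x k" "\<forall>j\<in>{k<..k + m}. x j \<noteq> x k" by auto
      have nk: "k < nxt k \<and> x (nxt k) = x k \<and> (\<forall>j. k < j \<and> x j = x k \<longrightarrow> nxt k \<le> j)" using k by (intro nxt) auto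
      then have "nxt k \<le> n" using k by (metis greaterThanAtMost_iff order_trans)
      moreover have "k + m < nxt k" using nk k(4) by (metis greaterThanAtMost_iff not_less)
      ultimately show "nxt k \<in> ?R" using nk by (auto intro!: exI[of _ k])
    qed
  qed simp
  then have N: "card ?N \<le> late_revisits n m" by (simp add: late_revisits_def)
  have "{k\<in>{..<n}. \<forall>t\<in>{1..m}. b k t \<noteq> 0} \<subseteq> ((?L \<union> {n - m..<n}) \<union> ?B) \<union> ?N"
  proof
    fix k assume k: "k \<in> {k\<in>{..<n}. \<forall>t\<in>{1..m}. b k t \<noteq> 0}"
    show "k \<in> ((?L \<union> {n - m..<n}) \<union> ?B) \<union> ?N"
    proof (rule ccontr)
      assume neg: "k \<notin> ((?L \<union> {n - m..<n}) \<union> ?B) \<union> ?N"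
      then have km: "k + m < n" using k by auto
      have "J \<inter> {k<..k + m} = {}" using neg km by auto
      then have ret: "x (k + t) \<noteq> x k" if "t \<in> {1..m}" for t
        using uninterrupted[of k t] that k by fastforce
      have "x j \<noteq> x k" if "j \<in> {k<..k + m}" for j
      proof -
        have "j - k \<in> {1..m}" "k + (j - k) = j" using that by auto
        then show ?thesis using ret[of "j - k"] by metis
      qed
      moreover have "\<exists>j\<in>{k<..n}. x j = x k" using neg k by auto
      ultimately show False using neg km by auto
    qed
  qed
  moreover have "finite ?B" "finite ?N" by (rule finite_subset[of _ "{..n}"], auto)+
  ultimately have "no_return n m \<le> card (((?L \<union> {n - m..<n}) \<union> ?B) \<union> ?N)"
    unfolding no_return_def by (intro card_mono) auto
  also have "\<dots> \<le> ((card ?L + card {n - m..<n}) + card ?B) + card ?N"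
    by (meson add_mono card_Un_le order_refl order_trans)
  also have "\<dots> \<le> ((card (x ` {0..n}) + m) + m * card (J \<inter> {1..n})) + late_revisits n m"
    using card_windows_meeting_le[of m n J] N by (intro add_mono) (auto simp: card_image_eq_last_visits)
  finally show ?thesis .
qed

text \<open>
  In the second case \<open>s\<close> is the last interruption between \<open>i\<close> and \<open>j\<close>. The union bound over \<open>s\<close> is
  affordable because interruptions are rare.
\<close>

lemma late_revisit_cases:
  assumes "i + m < j" "x i = x j"
  shows "(\<exists>i. i + m < j \<and> b i (j - i) = 0) \<or> (\<exists>s\<in>{1..j}. s \<in> J \<and> (\<exists>i<s. x i = x s + b s (j - s)))"
proof (cases "J \<inter> {i<..j} = {}")
  case True
  then have "x j = x i + b i (j - i)" using uninterrupted[of i "j - i"] assms(1) by simp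
  then show ?thesis using assms by auto
next
  case False
  define s where "s = Max (J \<inter> {i<..j})"
  have s: "s \<in> J \<inter> {i<..j}" unfolding s_def using False by (intro Max_in) auto
  have "J \<inter> {s<..j} = {}"
  proof (rule ccontr)
    assume "J \<inter> {s<..j} \<noteq> {}"
    then obtain u where u: "u \<in> J" "s < u" "u \<le> j" by auto
    then have "u \<in> J \<inter> {i<..j}" using s by auto
    then have "u \<le> s" unfolding s_def by (intro Max_ge) auto
    then show False using u by simp
  qed
  then have "x j = x s + b s (j - s)" using uninterrupted[of s "j - s"] s by simp
  then show ?thesis using s assms(2) by (intro disjI2 bexI[of _ s]) (auto intro!: exI[of _ i])
qed

end

lemma erw_0: "erw p \<xi> \<gamma> U 0 \<omega> = 0"
  by (subst erw.simps) simp

lemma erw_Suc: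
  fixes \<xi> :: "nat \<Rightarrow> 'a \<Rightarrow> int ^ 'd"
  shows "erw p \<xi> \<gamma> U (Suc n) \<omega> = erw p \<xi> \<gamma> U n \<omega> +
     (if (\<forall>k<n. erw p \<xi> \<gamma> U k \<omega> \<noteq> erw p \<xi> \<gamma> U n \<omega>) \<and> U (Suc n) \<omega> \<le> p (Suc n) then \<gamma> (Suc n) \<omega> else \<xi> (Suc n) \<omega>)"
proof -
  have *: "of_bool a *s v = (if a then v else 0)" for a and v :: "int ^ 'd" by simp
  define t where "t i = (let E = (\<exists>k\<in>{..<i - 1}. erw p \<xi> \<gamma> U k \<omega> = erw p \<xi> \<gamma> U (i - 1) \<omega>)
        in of_bool E *s \<xi> i \<omega>
           + of_bool (\<not> E \<and> U i \<omega> > p i) *s \<xi> i \<omega>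
           + of_bool (\<not> E \<and> U i \<omega> \<le> p i) *s \<gamma> i \<omega>)" for i
  have "erw p \<xi> \<gamma> U n \<omega> = (\<Sum>i\<in>{1..n}. t i)" for n
    unfolding t_def by (rule erw.simps)
  then have "erw p \<xi> \<gamma> U (Suc n) \<omega> = erw p \<xi> \<gamma> U n \<omega> + t (Suc n)" by simp
  also have "t (Suc n) = (if (\<forall>k<n. erw p \<xi> \<gamma> U k \<omega> \<noteq> erw p \<xi> \<gamma> U n \<omega>) \<and> U (Suc n) \<omega> \<le> p (Suc n) then \<gamma> (Suc n) \<omega> else \<xi> (Suc n) \<omega>)"
    unfolding t_def Let_def * by (auto simp: not_le)
  finally show ?thesis .
qed

definition block :: "(nat \<Rightarrow> 'a \<Rightarrow> int ^ 'd) \<Rightarrow> nat \<Rightarrow> nat \<Rightarrow> 'a \<Rightarrow> int ^ 'd" where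
  "block \<xi> s t \<omega> = (\<Sum>i\<in>{s<..s + t}. \<xi> i \<omega>)"

lemma block_0 [simp]: "block \<xi> s 0 \<omega> = 0"
  by (simp add: block_def)

lemma block_Suc_left: "block \<xi> s (Suc t) \<omega> = \<xi> (Suc s) \<omega> + block \<xi> (Suc s) t \<omega>"
proof -
  have "{s<..s + Suc t} = insert (Suc s) {Suc s<..Suc s + t}" by auto
  then show ?thesis by (simp add: block_def)
qed

lemma block_Suc: "block \<xi> s (Suc t) \<omega> = block \<xi> s t \<omega> + \<xi> (s + Suc t) \<omega>"
proof -
  have "{s<..s + Suc t} = insert (s + Suc t) {s<..s + t}" by auto
  then show ?thesis by (simp add: block_def add.commute)
qed

text \<open>
  Outside the clock times the walk uses the plain step whether or not its site is fresh.
\<close>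

lemma erw_interrupted_path:
  "interrupted_path (\<lambda>k. erw p \<xi> \<gamma> U k \<omega>) (\<lambda>s t. block \<xi> s t \<omega>) {i. U i \<omega> \<le> p i}"
proof
  fix k t
  show "{i. U i \<omega> \<le> p i} \<inter> {k<..k + t} = {} \<Longrightarrow> erw p \<xi> \<gamma> U (k + t) \<omega> = erw p \<xi> \<gamma> U k \<omega> + block \<xi> k t \<omega>"
  proof (induction t)
    case (Suc t)
    have "\<not> U (Suc (k + t)) \<omega> \<le> p (Suc (k + t))" using Suc.prems by auto
    moreover have "{i. U i \<omega> \<le> p i} \<inter> {k<..k + t} = {}" using Suc.prems by auto
    ultimately show ?case using Suc.IH by (simp add: erw_Suc block_Suc add.assoc)
  qed simp
qed

section \<open>Independence of past and future steps\<close>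

lemma Collect_conj_eq2: "{x \<in> A. P x} \<inter> {x \<in> A. Q x} = {x \<in> A. P x \<and> Q x}"
  by blast

lemma sets_vimage_algebra_mono:
  assumes "f \<in> X \<rightarrow> space N" "g \<in> X \<rightarrow> space N'" "\<Phi> \<in> measurable N N'" "\<And>x. x \<in> X \<Longrightarrow> g x = \<Phi> (f x)"
  shows "sets (vimage_algebra X g N') \<subseteq> sets (vimage_algebra X f N)"
proof
  fix A assume "A \<in> sets (vimage_algebra X g N')"
  then obtain B where B: "B \<in> sets N'" "A = g -` B \<inter> X" using assms(2) by (auto simp: sets_vimage_algebra2)
  have "A = f -` (\<Phi> -` B \<inter> space N) \<inter> X" using B(2) assms(1,4) by auto
  then show "A \<in> sets (vimage_algebra X f N)"
    using measurable_sets[OF assms(3) B(1)] unfolding sets_vimage_algebra2[OF assms(1)] by blast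
qed

lemma (in prob_space) indep_var_vimage_algebra:
  assumes "indep_var S A T B"
  shows "indep_set (sets (vimage_algebra (space M) A S)) (sets (vimage_algebra (space M) B T))"
  using assms by (auto simp: indep_var_eq sets_vimage_algebra)

context pn_ERW
begin

abbreviation "lattice \<equiv> (count_space UNIV :: (int ^ 'd) measure)"

definition "past_steps s = vimage_algebra (space M) (\<lambda>\<omega>. \<lambda>i\<in>{1..s}. \<xi> i \<omega>) (PiM {1..s} (\<lambda>_. lattice))"
definition "future_steps s = vimage_algebra (space M) (\<lambda>\<omega>. \<lambda>i\<in>{s<..}. \<xi> i \<omega>) (PiM {s<..} (\<lambda>_. lattice))"
definition "drifts = vimage_algebra (space M) (seq_of \<gamma>) (seq_space lattice)"
definition "clocks = vimage_algebra (space M) (seq_of U) (seq_space borel)"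

text \<open>
  Generators of the information about the plain steps up to \<open>s\<close>, all drifted steps and all clocks.
  Drifted steps and clocks of the future may be included since they are independent of the plain
  steps anyway. The generating sets are closed under intersection, so that independence
  extends from them to the generated \<open>\<sigma>\<close>-algebra.
\<close>

definition "past_rectangles s = {A \<inter> B \<inter> C |A B C. A \<in> sets (past_steps s) \<and> B \<in> sets drifts \<and> C \<in> sets clocks}"

definition "past s = sigma (space M) (past_rectangles s)"

lemma \<xi>_rv: "i \<ge> 1 \<Longrightarrow> \<xi> i \<in> measurable M lattice"
  using \<xi>_iid by (auto simp: iid_seq_def indep_vars_def)

lemma \<gamma>_rv: "i \<ge> 1 \<Longrightarrow> \<gamma> i \<in> measurable M lattice"
  using \<gamma>_iid by (auto simp: iid_seq_def indep_vars_def)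

lemma U_rv: "i \<ge> 1 \<Longrightarrow> U i \<in> borel_measurable M"
  using U_iid by (auto simp: iid_seq_def indep_vars_def)

lemma vimage_PiM_component:
  assumes "i \<in> I"
  shows "Z i \<in> measurable (vimage_algebra (space M) (\<lambda>\<omega>. \<lambda>i\<in>I. Z i \<omega>) (PiM I (\<lambda>_. count_space UNIV))) (count_space UNIV)"
proof -
  have "(\<lambda>\<omega>. (\<lambda>i\<in>I. Z i \<omega>) i) \<in> measurable (vimage_algebra (space M) (\<lambda>\<omega>. \<lambda>i\<in>I. Z i \<omega>) (PiM I (\<lambda>_. count_space UNIV))) (count_space UNIV)"
    by (rule measurable_compose[OF measurable_vimage_algebra1 measurable_component_singleton]) (use assms in \<open>auto simp: space_PiM\<close>)
  then show ?thesis using assms by simp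
qed

lemma past_rectangles_events: "past_rectangles s \<subseteq> events"
  and sets_past_steps: "sets (past_steps s) \<subseteq> events"
  and sets_future_steps: "sets (future_steps s) \<subseteq> events"
  and sets_drifts: "sets drifts \<subseteq> events"
  and sets_clocks: "sets clocks \<subseteq> events"
proof -
  have *: "sets (vimage_algebra (space M) f N) \<subseteq> events" if "f \<in> measurable M N" for f :: "'a \<Rightarrow> 'z" and N
    using that measurable_space[OF that] by (auto simp: sets_vimage_algebra2 Pi_iff intro: measurable_sets)
  have part: "(\<lambda>\<omega>. \<lambda>i\<in>I. \<xi> i \<omega>) \<in> measurable M (PiM I (\<lambda>_. lattice))" if "I \<subseteq> {1..}" for I
    using that \<xi>_rv by (intro measurable_restrict) auto
  show 1: "sets (past_steps s) \<subseteq> events" unfolding past_steps_def by (intro * part) auto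
  show "sets (future_steps s) \<subseteq> events" unfolding future_steps_def by (intro * part) auto
  show 2: "sets drifts \<subseteq> events"
    unfolding drifts_def seq_of_def using \<gamma>_rv by (intro * measurable_restrict) auto
  show 3: "sets clocks \<subseteq> events"
    unfolding clocks_def seq_of_def using U_rv by (intro * measurable_restrict) auto
  show "past_rectangles s \<subseteq> events"
    using 1 2 3 by (auto simp: past_rectangles_def)
qed

lemma space_past [simp]: "space (past s) = space M"
  by (simp add: past_def space_measure_of_conv)

lemma sets_past: "sets (past s) = sigma_sets (space M) (past_rectangles s)"
  unfolding past_def using past_rectangles_events[of s] sets.sets_into_space by (intro sets_measure_of) blast

text \<open>
  The clocks are split off first, then the drifted steps, and the plain steps up to \<open>s\<close> and after \<open>s\<close>
  are separated last; each time the remaining intersection is an event of the family on the other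
  side of the corresponding independence hypothesis.
\<close>

lemma past_rectangle_indep:
  assumes A: "A \<in> sets (past_steps s)" and B: "B \<in> sets drifts" and C: "C \<in> sets clocks" and D: "D \<in> sets (future_steps s)"
  shows "prob (A \<inter> B \<inter> C \<inter> D) = prob A * prob B * prob C * prob D"
proof -
  have seq_\<xi>: "seq_of \<xi> \<in> space M \<rightarrow> space (seq_space lattice)" and seq_\<gamma>: "seq_of \<gamma> \<in> space M \<rightarrow> space (seq_space lattice)"
    by (auto simp: seq_of_def space_PiM)
  have part: "sets (vimage_algebra (space M) (\<lambda>\<omega>. \<lambda>i\<in>I. \<xi> i \<omega>) (PiM I (\<lambda>_. lattice))) \<subseteq> sets (vimage_algebra (space M) (seq_of \<xi>) (seq_space lattice))" if "I \<subseteq> {1..}" for I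
  proof (rule sets_vimage_algebra_mono[OF seq_\<xi>])
    show "(\<lambda>f. restrict f I) \<in> measurable (seq_space lattice) (PiM I (\<lambda>_. lattice))"
      by (rule measurable_restrict_subset[OF that])
  qed (use that in \<open>auto simp: seq_of_def fun_eq_iff restrict_def space_PiM\<close>)
  let ?V\<xi> = "vimage_algebra (space M) (seq_of \<xi>) (seq_space lattice)"
  let ?VP = "vimage_algebra (space M) (\<lambda>\<omega>. (seq_of \<xi> \<omega>, seq_of \<gamma> \<omega>)) (seq_space lattice \<Otimes>\<^sub>M seq_space lattice)"
  have AD: "A \<in> sets ?V\<xi>" "D \<in> sets ?V\<xi>"
  proof -
    have "{1..s} \<subseteq> {1..}" "{s<..} \<subseteq> {1..}" by auto
    then show "A \<in> sets ?V\<xi>" "D \<in> sets ?V\<xi>"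
      using A D part unfolding past_steps_def future_steps_def by blast+
  qed
  have pairX: "(\<lambda>\<omega>. (seq_of \<xi> \<omega>, seq_of \<gamma> \<omega>)) \<in> space M \<rightarrow> space (seq_space lattice \<Otimes>\<^sub>M seq_space lattice)"
    using seq_\<xi> seq_\<gamma> by (auto simp: space_pair_measure)
  have V1: "sets ?V\<xi> \<subseteq> sets ?VP"
    by (rule sets_vimage_algebra_mono[OF pairX seq_\<xi> measurable_fst]) simp
  have V2: "sets drifts \<subseteq> sets ?VP"
    unfolding drifts_def by (rule sets_vimage_algebra_mono[OF pairX seq_\<gamma> measurable_snd]) simp
  have "prob (((A \<inter> D) \<inter> B) \<inter> C) = prob ((A \<inter> D) \<inter> B) * prob C"
  proof (rule indep_setD)
    show "indep_set (sets ?VP) (sets clocks)" using U_indep by (simp add: indep_pair_def clocks_def)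
    show "A \<inter> D \<inter> B \<in> sets ?VP" using AD V1 V2 B by auto
  qed (rule C)
  also have "prob ((A \<inter> D) \<inter> B) = prob (A \<inter> D) * prob B"
  proof (rule indep_setD)
    show "indep_set (sets ?V\<xi>) (sets drifts)" unfolding drifts_def by (rule indep_var_vimage_algebra[OF \<xi>_\<gamma>_indep])
  qed (use AD B in auto)
  also have "prob (A \<inter> D) = prob A * prob D"
  proof (rule indep_setD)
    have "indep_vars (\<lambda>_. lattice) \<xi> {1..}" using \<xi>_iid by (simp add: iid_seq_def)
    then have "indep_var (PiM {1..s} (\<lambda>_. lattice)) (\<lambda>\<omega>. \<lambda>i\<in>{1..s}. \<xi> i \<omega>) (PiM {s<..} (\<lambda>_. lattice)) (\<lambda>\<omega>. \<lambda>i\<in>{s<..}. \<xi> i \<omega>)"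
      by (rule indep_var_restrict) auto
    then show "indep_set (sets (past_steps s)) (sets (future_steps s))"
      unfolding past_steps_def future_steps_def by (rule indep_var_vimage_algebra)
  qed (use A D in auto)
  finally show ?thesis by (simp add: Int_ac)
qed

theorem past_future_indep:
  assumes "A \<in> sets (past s)" "D \<in> sets (future_steps s)"
  shows "prob (A \<inter> D) = prob A * prob D"
proof -
  have sp: "space (past_steps s) = space M" "space drifts = space M" "space clocks = space M" "space (future_steps s) = space M"
    by (simp_all add: past_steps_def drifts_def clocks_def future_steps_def)
  have top: "space M \<in> sets (past_steps s)" "space M \<in> sets drifts" "space M \<in> sets clocks" "space M \<in> sets (future_steps s)"
    using sets.top[of "past_steps s"] sets.top[of drifts] sets.top[of clocks] sets.top[of "future_steps s"] by (simp_all add: sp)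
  have "indep_set (past_rectangles s) (sets (future_steps s))"
    unfolding indep_sets2_eq
  proof (intro conjI ballI past_rectangles_events sets_future_steps)
    fix R D assume "R \<in> past_rectangles s" and D: "D \<in> sets (future_steps s)"
    then obtain A B C where R: "R = A \<inter> B \<inter> C" and ABC: "A \<in> sets (past_steps s)" "B \<in> sets drifts" "C \<in> sets clocks"
      by (auto simp: past_rectangles_def)
    have "A \<inter> B \<inter> C \<inter> space M = A \<inter> B \<inter> C" using sets.sets_into_space[OF ABC(1)] by (auto simp: sp)
    then have "prob R = prob A * prob B * prob C"
      using past_rectangle_indep[OF ABC top(4)] by (simp add: R prob_space)
    then show "prob (R \<inter> D) = prob R * prob D" using past_rectangle_indep[OF ABC D] by (simp add: R)
  qed
  moreover have "Int_stable (past_rectangles s)"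
  proof (rule Int_stableI)
    fix R R' assume "R \<in> past_rectangles s" "R' \<in> past_rectangles s"
    then obtain A B C A' B' C' where "R = A \<inter> B \<inter> C" "R' = A' \<inter> B' \<inter> C'"
      and m: "A \<in> sets (past_steps s)" "B \<in> sets drifts" "C \<in> sets clocks" "A' \<in> sets (past_steps s)" "B' \<in> sets drifts" "C' \<in> sets clocks"
      by (auto simp: past_rectangles_def)
    then have "R \<inter> R' = (A \<inter> A') \<inter> (B \<inter> B') \<inter> (C \<inter> C')" by auto
    moreover have "A \<inter> A' \<in> sets (past_steps s)" "B \<inter> B' \<in> sets drifts" "C \<inter> C' \<in> sets clocks"
      using m by auto
    ultimately show "R \<inter> R' \<in> past_rectangles s" unfolding past_rectangles_def mem_Collect_eq by (intro exI conjI)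
  qed
  moreover have "Int_stable (sets (future_steps s))" by (rule sets.Int_stable)
  ultimately have "indep_set (sigma_sets (space M) (past_rectangles s)) (sigma_sets (space M) (sets (future_steps s)))"
    by (rule indep_set_sigma_sets)
  then show ?thesis
    by (rule indep_setD) (use assms in \<open>auto simp: sets_past\<close>)
qed

lemma measurable_past:
  shows \<xi>_past: "1 \<le> i \<Longrightarrow> i \<le> s \<Longrightarrow> \<xi> i \<in> measurable (past s) lattice"
    and \<gamma>_past: "1 \<le> i \<Longrightarrow> \<gamma> i \<in> measurable (past s) lattice"
    and U_past: "1 \<le> i \<Longrightarrow> U i \<in> borel_measurable (past s)"
proof -
  have sp: "space (past_steps s) = space M" "space drifts = space M" "space clocks = space M"
    by (simp_all add: past_steps_def drifts_def clocks_def)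
  have top: "space M \<in> sets (past_steps s)" "space M \<in> sets drifts" "space M \<in> sets clocks"
    using sets.top[of "past_steps s"] sets.top[of drifts] sets.top[of clocks] by (simp_all add: sp)
  have sub: "sets N \<subseteq> sets (past s)" if "\<And>A. A \<in> sets N \<Longrightarrow> A \<in> past_rectangles s" for N :: "'a measure"
    using that by (auto simp: sets_past)
  have mono: "f \<in> measurable (past s) N'" if "f \<in> measurable N N'" "space N = space M" "sets N \<subseteq> sets (past s)" for f :: "'a \<Rightarrow> 'z" and N N'
    using that by (auto simp: measurable_def)
  have "sets (past_steps s) \<subseteq> sets (past s)"
  proof (rule sub)
    fix A assume A: "A \<in> sets (past_steps s)"
    then have "A = A \<inter> space M \<inter> space M" using sets.sets_into_space[OF A] by (auto simp: sp)
    then show "A \<in> past_rectangles s" using A top unfolding past_rectangles_def by blast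
  qed
  then show "1 \<le> i \<Longrightarrow> i \<le> s \<Longrightarrow> \<xi> i \<in> measurable (past s) lattice"
    by (intro mono[of _ "past_steps s"]) (auto simp: sp past_steps_def intro!: vimage_PiM_component)
  have "sets drifts \<subseteq> sets (past s)"
  proof (rule sub)
    fix A assume A: "A \<in> sets drifts"
    then have "A = space M \<inter> A \<inter> space M" using sets.sets_into_space[OF A] by (auto simp: sp)
    then show "A \<in> past_rectangles s" using A top unfolding past_rectangles_def by blast
  qed
  then show "1 \<le> i \<Longrightarrow> \<gamma> i \<in> measurable (past s) lattice"
    by (intro mono[of _ drifts]) (auto simp: sp drifts_def seq_of_def[abs_def] intro!: vimage_PiM_component)
  have "sets clocks \<subseteq> sets (past s)"
  proof (rule sub)
    fix A assume A: "A \<in> sets clocks"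
    then have "A = space M \<inter> space M \<inter> A" using sets.sets_into_space[OF A] by (auto simp: sp)
    then show "A \<in> past_rectangles s" using A top unfolding past_rectangles_def by blast
  qed
  moreover have "U i \<in> borel_measurable clocks" if "1 \<le> i"
  proof -
    have seqU: "seq_of U \<in> space M \<rightarrow> space (seq_space borel)" by (auto simp: seq_of_def space_PiM)
    have "(\<lambda>\<omega>. seq_of U \<omega> i) \<in> borel_measurable clocks"
      unfolding clocks_def by (rule measurable_compose[OF measurable_vimage_algebra1[OF seqU] measurable_component_singleton]) (use that in auto)
    then show ?thesis using that by (simp add: seq_of_def)
  qed
  ultimately show "1 \<le> i \<Longrightarrow> U i \<in> borel_measurable (past s)"
    by (intro mono[of _ clocks]) (auto simp: sp)
qed

lemma space_future_steps [simp]: "space (future_steps s) = space M"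
  by (simp add: future_steps_def)

lemma \<xi>_future: "s < i \<Longrightarrow> \<xi> i \<in> measurable (future_steps s) lattice"
  unfolding future_steps_def by (intro vimage_PiM_component) auto

lemma measurable_lattice_add:
  assumes "f \<in> measurable N lattice" "g \<in> measurable N lattice"
  shows "(\<lambda>\<omega>. f \<omega> + g \<omega>) \<in> measurable N lattice"
proof (rule measurable_compose_countable[OF _ assms(1), where f = "\<lambda>v \<omega>. v + g \<omega>"])
  show "(\<lambda>\<omega>. v + g \<omega>) \<in> measurable N lattice" for v
    by (rule measurable_compose[OF assms(2)]) simp
qed

lemma measurable_block:
  assumes "\<And>i. s < i \<Longrightarrow> i \<le> s + t \<Longrightarrow> \<xi> i \<in> measurable N lattice"
  shows "block \<xi> s t \<in> measurable N lattice"
  using assms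
proof (induction t)
  case 0
  then show ?case by (simp add: block_def[abs_def])
next
  case (Suc t)
  then have "(\<lambda>\<omega>. block \<xi> s t \<omega> + \<xi> (s + Suc t) \<omega>) \<in> measurable N lattice"
    by (intro measurable_lattice_add) auto
  then show ?case by (simp add: block_Suc[abs_def])
qed

lemma sets_lattice_pred:
  assumes "f \<in> measurable N lattice"
  shows "{\<omega> \<in> space N. P (f \<omega>)} \<in> sets N"
  using measurable_sets[OF assms, of "{v. P v}"] by (simp add: vimage_def Int_def conj_commute)

text \<open>
  Stated for an arbitrary \<open>\<sigma>\<close>-algebra, because the path up to \<open>n\<close> has to be measurable with respect
  to the past as well as on the whole space.
\<close>

lemma measurable_erw:
  assumes "\<And>i. 1 \<le> i \<Longrightarrow> i \<le> n \<Longrightarrow> \<xi> i \<in> measurable N lattice"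
    and "\<And>i. 1 \<le> i \<Longrightarrow> i \<le> n \<Longrightarrow> \<gamma> i \<in> measurable N lattice"
    and "\<And>i. 1 \<le> i \<Longrightarrow> i \<le> n \<Longrightarrow> U i \<in> borel_measurable N"
    and "k \<le> n"
  shows "erw p \<xi> \<gamma> U k \<in> measurable N lattice"
  using assms(4)
proof (induction k rule: less_induct)
  case (less k)
  show ?case
  proof (cases k)
    case 0
    then show ?thesis by (simp add: erw_0[abs_def])
  next
    case (Suc j)
    have X: "erw p \<xi> \<gamma> U i \<in> measurable N lattice" if "i \<le> j" for i
      using less.IH[of i] less.prems that Suc by simp
    have g: "\<gamma> k \<in> measurable N lattice" "\<xi> k \<in> measurable N lattice" "U k \<in> borel_measurable N"
      using assms less.prems Suc by auto
    have eq: "{\<omega> \<in> space N. erw p \<xi> \<gamma> U i \<omega> = erw p \<xi> \<gamma> U j \<omega>} \<in> sets N" if "i < j" for i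
    proof -
      have "(\<lambda>\<omega>. erw p \<xi> \<gamma> U i \<omega> = erw p \<xi> \<gamma> U j \<omega>) \<in> measurable N (count_space UNIV)"
        using that
        by (intro measurable_compose_countable[OF _ X[of i], where f = "\<lambda>v \<omega>. v = erw p \<xi> \<gamma> U j \<omega>"] measurable_compose[OF X[of j]]) auto
      then show ?thesis by measurable
    qed
    have fr: "{\<omega> \<in> space N. \<forall>i<j. erw p \<xi> \<gamma> U i \<omega> \<noteq> erw p \<xi> \<gamma> U j \<omega>} \<in> sets N"
    proof -
      have "{\<omega> \<in> space N. \<forall>i<j. erw p \<xi> \<gamma> U i \<omega> \<noteq> erw p \<xi> \<gamma> U j \<omega>} = space N - (\<Union>i<j. {\<omega> \<in> space N. erw p \<xi> \<gamma> U i \<omega> = erw p \<xi> \<gamma> U j \<omega>})"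
        by auto
      then show ?thesis using eq by auto
    qed
    have "{\<omega> \<in> space N. (\<forall>i<j. erw p \<xi> \<gamma> U i \<omega> \<noteq> erw p \<xi> \<gamma> U j \<omega>) \<and> U k \<omega> \<le> p k} \<in> sets N"
    proof -
      have "{\<omega> \<in> space N. U k \<omega> \<le> p k} \<in> sets N" using g(3) by measurable
      then have "{\<omega> \<in> space N. \<forall>i<j. erw p \<xi> \<gamma> U i \<omega> \<noteq> erw p \<xi> \<gamma> U j \<omega>} \<inter> {\<omega> \<in> space N. U k \<omega> \<le> p k} \<in> sets N"
        using fr by (rule sets.Int[rotated])
      also have "{\<omega> \<in> space N. \<forall>i<j. erw p \<xi> \<gamma> U i \<omega> \<noteq> erw p \<xi> \<gamma> U j \<omega>} \<inter> {\<omega> \<in> space N. U k \<omega> \<le> p k}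
          = {\<omega> \<in> space N. (\<forall>i<j. erw p \<xi> \<gamma> U i \<omega> \<noteq> erw p \<xi> \<gamma> U j \<omega>) \<and> U k \<omega> \<le> p k}" by (rule Collect_conj_eq2)
      finally show ?thesis .
    qed
    then have "(\<lambda>\<omega>. erw p \<xi> \<gamma> U j \<omega> + (if (\<forall>i<j. erw p \<xi> \<gamma> U i \<omega> \<noteq> erw p \<xi> \<gamma> U j \<omega>) \<and> U k \<omega> \<le> p k then \<gamma> k \<omega> else \<xi> k \<omega>)) \<in> measurable N lattice"
      using g X by (intro measurable_lattice_add measurable_If) auto
    then show ?thesis unfolding Suc erw_Suc[abs_def] .
  qed
qed

lemma block_rv [measurable]: "block \<xi> s t \<in> measurable M lattice"
  by (intro measurable_block \<xi>_rv) auto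

lemma erw_rv [measurable]: "erw p \<xi> \<gamma> U k \<in> measurable M lattice"
  by (rule measurable_erw[of k]) (auto intro: \<xi>_rv \<gamma>_rv U_rv)

lemma block_future: "s \<le> k \<Longrightarrow> block \<xi> k t \<in> measurable (future_steps s) lattice"
  by (intro measurable_block \<xi>_future) auto

lemma block_past: "k + t \<le> s \<Longrightarrow> block \<xi> k t \<in> measurable (past s) lattice"
  by (intro measurable_block \<xi>_past) auto

lemma erw_past: "k \<le> s \<Longrightarrow> erw p \<xi> \<gamma> U k \<in> measurable (past s) lattice"
  by (rule measurable_erw[of s]) (auto intro: \<xi>_past \<gamma>_past U_past)

end

section \<open>Laws of blocks of steps\<close>

lemma finite_bounded_lattice_vectors: "finite {v :: int ^ 'n. norm (real_vec v) \<le> K}"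
proof (rule finite_subset)
  show "{v :: int ^ 'n. norm (real_vec v) \<le> K} \<subseteq> (\<lambda>f. \<chi> i. f i) ` (PiE UNIV (\<lambda>_. {-\<lceil>K\<rceil>..\<lceil>K\<rceil>}))"
  proof
    fix v :: "int ^ 'n" assume "v \<in> {v. norm (real_vec v) \<le> K}"
    then have "\<bar>real_of_int (v $ i)\<bar> \<le> K" for i
      using component_le_norm_cart[of "real_vec v" i] by (simp add: real_vec_def)
    then have "v $ i \<in> {-\<lceil>K\<rceil>..\<lceil>K\<rceil>}" for i
      by (simp add: abs_le_iff) (smt (verit, best) ceiling_mono ceiling_of_int le_of_int_ceiling of_int_le_iff of_int_minus)
    then show "v \<in> (\<lambda>f. \<chi> i. f i) ` (PiE UNIV (\<lambda>_. {-\<lceil>K\<rceil>..\<lceil>K\<rceil>}))"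
      by (intro image_eqI[where x = "\<lambda>i. v $ i"]) auto
  qed
qed (intro finite_imageI finite_PiE, auto)

context pn_ERW
begin

text \<open>
  Boundedness provides some finite set containing all values of all steps; one is fixed here so that
  sums over the values of a step have a common index set.
\<close>

definition "step_support = (SOME V. finite V \<and> (\<forall>i\<ge>1. \<forall>\<omega>\<in>space M. \<xi> i \<omega> \<in> V))"

lemma step_support: "finite step_support" "i \<ge> 1 \<Longrightarrow> \<omega> \<in> space M \<Longrightarrow> \<xi> i \<omega> \<in> step_support"
proof -
  obtain K where "\<forall>n\<ge>1. \<forall>\<omega>\<in>space M. norm (real_vec (\<xi> n \<omega>)) \<le> K \<and> norm (real_vec (\<gamma> n \<omega>)) \<le> K"
    using bounded_steps by auto
  then have "\<exists>V. finite V \<and> (\<forall>i\<ge>1. \<forall>\<omega>\<in>space M. \<xi> i \<omega> \<in> V)"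
    by (intro exI[of _ "{v. norm (real_vec v) \<le> K}"] conjI finite_bounded_lattice_vectors) auto
  from someI_ex[OF this] show "finite step_support" "i \<ge> 1 \<Longrightarrow> \<omega> \<in> space M \<Longrightarrow> \<xi> i \<omega> \<in> step_support"
    unfolding step_support_def by auto
qed

lemma finite_range_block: "finite (block \<xi> s t ` space M)"
proof (induction t)
  case 0
  then show ?case by (auto simp: image_constant_conv)
next
  case (Suc t)
  have "block \<xi> s (Suc t) ` space M \<subseteq> (\<lambda>(x, y). x + y) ` (block \<xi> s t ` space M \<times> step_support)"
    using step_support(2) by (fastforce simp: block_Suc)
  then show ?case by (rule finite_subset) (use Suc step_support(1) in blast)
qed

definition step_law :: "(int ^ 'd) \<Rightarrow>\<^sub>0 real" where
  "step_law = Abs_poly_mapping (\<lambda>v. prob {\<omega> \<in> space M. \<xi> 1 \<omega> = v})"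

lemma lookup_step_law_1: "lookup step_law v = prob {\<omega> \<in> space M. \<xi> 1 \<omega> = v}"
proof -
  have "{v. prob {\<omega> \<in> space M. \<xi> 1 \<omega> = v} \<noteq> 0} \<subseteq> step_support"
  proof
    fix v assume "v \<in> {v. prob {\<omega> \<in> space M. \<xi> 1 \<omega> = v} \<noteq> 0}"
    then have *: "prob {\<omega> \<in> space M. \<xi> 1 \<omega> = v} \<noteq> 0" by simp
    have "{\<omega> \<in> space M. \<xi> 1 \<omega> = v} \<noteq> {}"
    proof
      assume e: "{\<omega> \<in> space M. \<xi> 1 \<omega> = v} = {}"
      show False using * unfolding e by simp
    qed
    then show "v \<in> step_support" using step_support(2) by auto
  qed
  then have "finite {v. prob {\<omega> \<in> space M. \<xi> 1 \<omega> = v} \<noteq> 0}" using step_support(1) by (rule finite_subset)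
  then show ?thesis unfolding step_law_def by (subst lookup_Abs_poly_mapping) auto
qed

lemma lookup_step_law:
  assumes "i \<ge> 1"
  shows "lookup step_law v = prob {\<omega> \<in> space M. \<xi> i \<omega> = v}"
proof -
  have *: "prob {\<omega> \<in> space M. \<xi> i \<omega> = v} = measure (distr M lattice (\<xi> i)) {v}" if "i \<ge> 1" for i
  proof -
    have "measure (distr M lattice (\<xi> i)) {v} = prob (\<xi> i -` {v} \<inter> space M)"
      using \<xi>_rv[OF that] by (rule measure_distr) simp
    also have "\<xi> i -` {v} \<inter> space M = {\<omega> \<in> space M. \<xi> i \<omega> = v}" by auto
    finally show ?thesis by simp
  qed
  have eq: "distr M lattice (\<xi> i) = distr M lattice (\<xi> 1)" using \<xi>_iid assms unfolding iid_seq_def by blast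
  show ?thesis unfolding lookup_step_law_1 *[OF assms] *[OF order_refl] eq ..
qed

lemma keys_step_law: "keys step_law \<subseteq> step_support"
proof
  fix v assume "v \<in> keys step_law"
  then have *: "prob {\<omega> \<in> space M. \<xi> 1 \<omega> = v} \<noteq> 0" by (simp add: in_keys_iff lookup_step_law_1)
  have "{\<omega> \<in> space M. \<xi> 1 \<omega> = v} \<noteq> {}"
  proof
    assume e: "{\<omega> \<in> space M. \<xi> 1 \<omega> = v} = {}"
    show False using * unfolding e by simp
  qed
  then show "v \<in> step_support" using step_support(2) by auto
qed

text \<open>
  Conditioning on the first step after time \<open>s\<close>. Both the law of blocks and the stationarity of
  avoidance probabilities follow from it by induction over the length, uniformly in \<open>s\<close>.
\<close>

lemma prob_first_step:
  assumes D: "\<And>v. D v \<in> sets (future_steps (Suc s))"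
  shows "prob {\<omega> \<in> space M. \<omega> \<in> D (\<xi> (Suc s) \<omega>)} = (\<Sum>v\<in>keys step_law. lookup step_law v * prob (D v))"
proof -
  have D': "D v \<in> events" for v using D sets_future_steps by blast
  have P: "{\<omega> \<in> space M. \<xi> (Suc s) \<omega> = v} \<in> sets (past (Suc s))" for v
    using sets_lattice_pred[OF \<xi>_past[of "Suc s" "Suc s"], of "\<lambda>x. x = v"] by simp
  have P': "{\<omega> \<in> space M. \<xi> (Suc s) \<omega> = v} \<in> events" for v
    using sets_lattice_pred[OF \<xi>_rv[of "Suc s"], of "\<lambda>x. x = v"] by simp
  have "{\<omega> \<in> space M. \<omega> \<in> D (\<xi> (Suc s) \<omega>)} = (\<Union>v\<in>step_support. {\<omega> \<in> space M. \<xi> (Suc s) \<omega> = v} \<inter> D v)"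
    using step_support(2)[of "Suc s"] by auto
  then have "prob {\<omega> \<in> space M. \<omega> \<in> D (\<xi> (Suc s) \<omega>)} = prob (\<Union>v\<in>step_support. {\<omega> \<in> space M. \<xi> (Suc s) \<omega> = v} \<inter> D v)"
    by simp
  also have "\<dots> = (\<Sum>v\<in>step_support. prob ({\<omega> \<in> space M. \<xi> (Suc s) \<omega> = v} \<inter> D v))"
    using step_support(1) D' P' by (intro finite_measure_finite_Union) (auto simp: disjoint_family_on_def)
  also have "\<dots> = (\<Sum>v\<in>step_support. lookup step_law v * prob (D v))"
    using past_future_indep[OF P D] lookup_step_law[of "Suc s"] by simp
  also have "\<dots> = (\<Sum>v\<in>keys step_law. lookup step_law v * prob (D v))"
    using step_support(1) keys_step_law by (intro sum.mono_neutral_right) (auto simp: in_keys_iff)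
  finally show ?thesis .
qed

theorem block_law: "prob {\<omega> \<in> space M. block \<xi> s t \<omega> = y} = lookup (step_law ^ t) y"
proof (induction t arbitrary: s y)
  case 0
  then show ?case by (auto simp: lookup_one prob_space when_def)
next
  case (Suc t)
  define D where "D v = {\<omega> \<in> space M. block \<xi> (Suc s) t \<omega> = y - v}" for v
  have "D v \<in> sets (future_steps (Suc s))" for v
    using sets_lattice_pred[OF block_future[of "Suc s" "Suc s" t], of "\<lambda>x. x = y - v"] by (simp add: D_def)
  moreover have "{\<omega> \<in> space M. block \<xi> s (Suc t) \<omega> = y} = {\<omega> \<in> space M. \<omega> \<in> D (\<xi> (Suc s) \<omega>)}"
    by (auto simp: D_def block_Suc_left algebra_simps)
  ultimately have "prob {\<omega> \<in> space M. block \<xi> s (Suc t) \<omega> = y} = (\<Sum>v\<in>keys step_law. lookup step_law v * prob (D v))"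
    using prob_first_step[of D s] by simp
  then show ?case by (simp add: D_def Suc lookup_mult_group)
qed

lemma sets_avoid_block:
  assumes "\<And>t. t \<in> {1..m} \<Longrightarrow> block \<xi> s t \<in> measurable N lattice"
  shows "{\<omega> \<in> space N. \<forall>t\<in>{1..m}. z + block \<xi> s t \<omega> \<noteq> 0} \<in> sets N"
proof -
  have "{\<omega> \<in> space N. \<forall>t\<in>{1..m}. z + block \<xi> s t \<omega> \<noteq> 0} = space N - (\<Union>t\<in>{1..m}. {\<omega> \<in> space N. z + block \<xi> s t \<omega> = 0})"
    by auto
  moreover have "{\<omega> \<in> space N. z + block \<xi> s t \<omega> = 0} \<in> sets N" if "t \<in> {1..m}" for t
    by (rule sets_lattice_pred[OF assms[OF that]])
  ultimately show ?thesis by auto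
qed

text \<open>
  The starting point \<open>z\<close> is needed for the induction: the first step moves it.
\<close>

lemma avoid_block_stationary:
  "prob {\<omega> \<in> space M. \<forall>t\<in>{1..m}. z + block \<xi> s t \<omega> \<noteq> 0} = prob {\<omega> \<in> space M. \<forall>t\<in>{1..m}. z + block \<xi> 0 t \<omega> \<noteq> 0}"
proof (induction m arbitrary: s z)
  case 0
  then show ?case by simp
next
  case (Suc m)
  define D where "D s v = (if z + v = 0 then {} else {\<omega> \<in> space M. \<forall>t\<in>{1..m}. (z + v) + block \<xi> (Suc s) t \<omega> \<noteq> 0})" for s v
  have D: "D s v \<in> sets (future_steps (Suc s))" for s v
    using sets_avoid_block[where N = "future_steps (Suc s)" and s = "Suc s" and m = m and z = "z + v"] block_future[of "Suc s" "Suc s"]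
    by (simp add: D_def)
  have eq: "{\<omega> \<in> space M. \<forall>t\<in>{1..Suc m}. z + block \<xi> s t \<omega> \<noteq> 0} = {\<omega> \<in> space M. \<omega> \<in> D s (\<xi> (Suc s) \<omega>)}" for s
  proof -
    have split: "(\<forall>t\<in>{1..Suc m}. P t) \<longleftrightarrow> P (Suc 0) \<and> (\<forall>t\<in>{1..m}. P (Suc t))" for P
    proof -
      have "{1..Suc m} = insert (Suc 0) (Suc ` {1..m})" by auto
      then show ?thesis by (simp del: image_Suc_atLeastAtMost)
    qed
    show ?thesis unfolding split by (auto simp: D_def block_Suc_left add.assoc)
  qed
  have D0: "prob (D s v) = prob (D 0 v)" for s v
    unfolding D_def using Suc[of "z + v" "Suc s"] Suc[of "z + v" "Suc 0"] by simp
  show ?case unfolding eq prob_first_step[of "D _", OF D] D0[of s] ..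
qed

definition no_return_prob :: "nat \<Rightarrow> real" where
  "no_return_prob m = prob {\<omega> \<in> space M. \<forall>t\<in>{1..m}. block \<xi> 0 t \<omega> \<noteq> 0}"

lemma prob_no_return: "prob {\<omega> \<in> space M. \<forall>t\<in>{1..m}. block \<xi> s t \<omega> \<noteq> 0} = no_return_prob m"
  using avoid_block_stationary[of m 0 s] by (simp add: no_return_prob_def)

sublocale step: centred_step_law step_law
proof
  have V: "(\<Sum>v\<in>keys step_law. lookup step_law v *\<^sub>R f v) = (\<Sum>v\<in>step_support. lookup step_law v *\<^sub>R f v)"
    for f :: "int ^ 'd \<Rightarrow> real ^ 'd"
    using step_support(1) keys_step_law by (intro sum.mono_neutral_left) (auto simp: in_keys_iff)
  have P': "{\<omega> \<in> space M. \<xi> 1 \<omega> = v} \<in> events" for v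
    using sets_lattice_pred[OF \<xi>_rv[of 1], of "\<lambda>x. x = v"] by simp
  show "0 \<le> lookup step_law v" for v by (simp add: lookup_step_law_1)
  have "{} \<in> sets (future_steps (Suc 0))" "space M \<in> sets (future_steps (Suc 0))"
    using sets.top[of "future_steps (Suc 0)"] by auto
  then show "(\<Sum>v\<in>keys step_law. lookup step_law v) = 1"
    using prob_first_step[of "\<lambda>_. space M" 0] by (simp add: prob_space)
  show "(\<Sum>v\<in>keys step_law. lookup step_law v *\<^sub>R real_vec v) = 0"
  proof -
    have "0 = expectation (\<lambda>\<omega>. real_vec (\<xi> 1 \<omega>))" using \<xi>_mean[of 1] by simp
    also have "\<dots> = expectation (\<lambda>\<omega>. \<Sum>v\<in>step_support. indicator {\<omega> \<in> space M. \<xi> 1 \<omega> = v} \<omega> *\<^sub>R real_vec v)"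
    proof (rule Bochner_Integration.integral_cong[OF refl])
      fix \<omega> assume \<omega>: "\<omega> \<in> space M"
      have "(\<Sum>v\<in>step_support. indicator {\<omega> \<in> space M. \<xi> 1 \<omega> = v} \<omega> *\<^sub>R real_vec v) = (\<Sum>v\<in>step_support. if v = \<xi> 1 \<omega> then real_vec (\<xi> 1 \<omega>) else 0)"
        using \<omega> by (intro sum.cong) auto
      then show "real_vec (\<xi> 1 \<omega>) = (\<Sum>v\<in>step_support. indicator {\<omega> \<in> space M. \<xi> 1 \<omega> = v} \<omega> *\<^sub>R real_vec v)"
        using step_support(1) step_support(2)[of 1 \<omega>] \<omega> by simp
    qed
    also have "\<dots> = (\<Sum>v\<in>step_support. lookup step_law v *\<^sub>R real_vec v)"
      using P' by (subst Bochner_Integration.integral_sum) (auto simp: lookup_step_law_1 less_top[symmetric] intro!: integrable_scaleR_left)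
    finally show ?thesis using V by simp
  qed
  fix l' :: "real ^ 'd" assume l': "norm l' = 1"
  show "\<exists>v\<in>keys step_law. real_vec v \<bullet> l' \<noteq> 0"
  proof (rule ccontr)
    assume neg: "\<not> ?thesis"
    have "prob {\<omega> \<in> space M. \<omega> \<in> (if real_vec (\<xi> (Suc 0) \<omega>) \<bullet> l' = 0 then space M else {})} = (\<Sum>v\<in>keys step_law. lookup step_law v * prob (if real_vec v \<bullet> l' = 0 then space M else {}))"
      by (rule prob_first_step) (use \<open>space M \<in> sets (future_steps (Suc 0))\<close> in auto)
    also have "\<dots> = (\<Sum>v\<in>keys step_law. lookup step_law v)"
      using neg by (intro sum.cong) (auto simp: prob_space)
    also have "\<dots> = 1" by fact
    also have "{\<omega> \<in> space M. \<omega> \<in> (if real_vec (\<xi> (Suc 0) \<omega>) \<bullet> l' = 0 then space M else {})} = {\<omega> \<in> space M. real_vec (\<xi> 1 \<omega>) \<bullet> l' = 0}"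
      by auto
    finally show False using \<xi>_nondegenerate[of 1 l'] l' by simp
  qed
qed

lemma prob_clock: "i \<ge> 1 \<Longrightarrow> prob {\<omega> \<in> space M. U i \<omega> \<le> p i} = p i"
proof -
  assume i: "i \<ge> 1"
  have "prob {\<omega> \<in> space M. U i \<omega> \<le> p i} = measure (distr M borel (U i)) {..p i}"
  proof -
    have "measure (distr M borel (U i)) {..p i} = prob (U i -` {..p i} \<inter> space M)"
      using U_rv[OF i] by (rule measure_distr) simp
    also have "U i -` {..p i} \<inter> space M = {\<omega> \<in> space M. U i \<omega> \<le> p i}" by auto
    finally show ?thesis by simp
  qed
  also have "\<dots> = measure lborel ({0..1} \<inter> {..p i}) / measure lborel {0..1::real}"
    unfolding U_uniform[OF i] by (subst measure_uniform_measure) auto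
  also have "{0..1} \<inter> {..p i} = {0..p i}" using p_range[OF i] by auto
  finally show ?thesis using p_range[OF i] by simp
qed

end

section \<open>Moments of the three counts\<close>

lemma (in prob_space) expectation_card:
  assumes "finite I" "\<And>i. i \<in> I \<Longrightarrow> {\<omega> \<in> space M. P i \<omega>} \<in> events"
  shows "integrable M (\<lambda>\<omega>. real (card {i \<in> I. P i \<omega>}))"
    and "expectation (\<lambda>\<omega>. real (card {i \<in> I. P i \<omega>})) = (\<Sum>i\<in>I. prob {\<omega> \<in> space M. P i \<omega>})"
proof -
  have eq: "real (card {i \<in> I. P i \<omega>}) = (\<Sum>i\<in>I. indicator {\<omega> \<in> space M. P i \<omega>} \<omega>)" if "\<omega> \<in> space M" for \<omega>
  proof -
    have "(\<Sum>i\<in>I. indicator {\<omega> \<in> space M. P i \<omega>} \<omega>) = (\<Sum>i\<in>I. if P i \<omega> then 1 else (0::real))"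
      using that by (intro sum.cong) auto
    then show ?thesis using assms(1) by (simp add: sum.If_cases Int_def)
  qed
  have int: "integrable M (\<lambda>\<omega>. indicator {\<omega> \<in> space M. P i \<omega>} \<omega> :: real)" if "i \<in> I" for i
    using assms(2)[OF that] by (intro integrable_real_indicator) (auto simp: less_top[symmetric])
  show "integrable M (\<lambda>\<omega>. real (card {i \<in> I. P i \<omega>}))"
    by (subst Bochner_Integration.integrable_cong[OF refl eq]) (auto intro: int)
  have "expectation (\<lambda>\<omega>. real (card {i \<in> I. P i \<omega>})) = expectation (\<lambda>\<omega>. \<Sum>i\<in>I. indicator {\<omega> \<in> space M. P i \<omega>} \<omega>)"
    by (rule Bochner_Integration.integral_cong[OF refl eq])
  also have "\<dots> = (\<Sum>i\<in>I. prob {\<omega> \<in> space M. P i \<omega>})"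
    using int by (subst Bochner_Integration.integral_sum) (auto intro!: sum.cong arg_cong[where f = prob])
  finally show "expectation (\<lambda>\<omega>. real (card {i \<in> I. P i \<omega>})) = (\<Sum>i\<in>I. prob {\<omega> \<in> space M. P i \<omega>})" .
qed

context pn_ERW
begin

lemma coincidence_event_past:
  assumes "1 \<le> s" "i \<le> s"
  shows "{\<omega> \<in> space M. U s \<omega> \<le> p s \<and> erw p \<xi> \<gamma> U i \<omega> - erw p \<xi> \<gamma> U s \<omega> = z} \<in> sets (past s)"
proof -
  have "{\<omega> \<in> space (past s). U s \<omega> \<le> p s} \<in> sets (past s)"
    using U_past[OF assms(1), of s] by measurable
  moreover have "{\<omega> \<in> space (past s). erw p \<xi> \<gamma> U i \<omega> - erw p \<xi> \<gamma> U s \<omega> = z} \<in> sets (past s)"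
  proof -
    have "(\<lambda>\<omega>. - erw p \<xi> \<gamma> U s \<omega>) \<in> measurable (past s) lattice"
      by (rule measurable_compose[OF erw_past[OF order_refl]]) simp
    from measurable_lattice_add[OF erw_past[OF assms(2)] this]
    have "(\<lambda>\<omega>. erw p \<xi> \<gamma> U i \<omega> - erw p \<xi> \<gamma> U s \<omega>) \<in> measurable (past s) lattice" by simp
    from sets_lattice_pred[OF this, of "\<lambda>v. v = z"] show ?thesis .
  qed
  ultimately have "{\<omega> \<in> space (past s). U s \<omega> \<le> p s} \<inter> {\<omega> \<in> space (past s). erw p \<xi> \<gamma> U i \<omega> - erw p \<xi> \<gamma> U s \<omega> = z} \<in> sets (past s)"
    by (rule sets.Int)
  then show ?thesis unfolding Collect_conj_eq2 by simp
qed

lemma sets_past_events: "sets (past s) \<subseteq> events"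
  unfolding sets_past by (rule sets.sigma_sets_subset[OF past_rectangles_events])

lemma sets_clock: "1 \<le> s \<Longrightarrow> {\<omega> \<in> space M. U s \<omega> \<le> p s} \<in> events"
  using U_rv[of s] by measurable

text \<open>
  The block after \<open>s\<close> is independent of the clock at \<open>s\<close> and of the path up to \<open>s\<close>, so given these it hits
  each of the \<open>s\<close> earlier positions with probability at most \<open>B\<close>. The alternative \<open>1\<close> in the minimum is the
  probability that the clock at \<open>s\<close> rings at all.
\<close>

lemma revisit_after_clock_bound:
  assumes s: "1 \<le> s" and B: "\<And>y. lookup (step_law ^ t) y \<le> B"
  shows "prob {\<omega> \<in> space M. U s \<omega> \<le> p s \<and> (\<exists>i<s. erw p \<xi> \<gamma> U i \<omega> = erw p \<xi> \<gamma> U s \<omega> + block \<xi> s t \<omega>)} \<le> p s * min 1 (real s * B)"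
proof -
  let ?X = "erw p \<xi> \<gamma> U"
  define Z where "Z = block \<xi> s t ` space M"
  define A where "A i z = {\<omega> \<in> space M. U s \<omega> \<le> p s \<and> ?X i \<omega> - ?X s \<omega> = z}" for i z
  define D where "D z = {\<omega> \<in> space M. block \<xi> s t \<omega> = z}" for z
  have Z: "finite Z" unfolding Z_def by (rule finite_range_block)
  have A: "A i z \<in> sets (past s)" if "i < s" for i z
    unfolding A_def using that by (intro coincidence_event_past s) simp
  have A': "A i z \<in> events" if "i < s" for i z using A[OF that] sets_past_events by blast
  have D: "D z \<in> sets (future_steps s)" for z
    unfolding D_def using sets_lattice_pred[OF block_future[of s s t], of "\<lambda>v. v = z"] by simp
  have D': "D z \<in> events" for z using D sets_future_steps by blast
  have B0: "0 \<le> B" using B[of 0] step.lookup_power_nonneg[of t 0] by linarith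
  have one: "(\<Sum>z\<in>Z. prob (A i z \<inter> D z)) \<le> B * p s" if "i < s" for i
  proof -
    have "(\<Sum>z\<in>Z. prob (A i z \<inter> D z)) = (\<Sum>z\<in>Z. prob (A i z) * lookup (step_law ^ t) z)"
      using past_future_indep[OF A[OF that] D] by (simp add: D_def block_law)
    also have "\<dots> \<le> (\<Sum>z\<in>Z. prob (A i z) * B)" by (intro sum_mono mult_left_mono B) simp
    also have "\<dots> = B * prob (\<Union>z\<in>Z. A i z)"
      using Z A'[OF that]
      by (subst finite_measure_finite_Union) (auto simp: disjoint_family_on_def A_def sum_distrib_left mult.commute)
    also have "\<dots> \<le> B * prob {\<omega> \<in> space M. U s \<omega> \<le> p s}"
      using sets_clock[OF s] B0 by (intro mult_left_mono finite_measure_mono) (auto simp: A_def)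
    finally show ?thesis using prob_clock[OF s] by simp
  qed
  let ?E = "{\<omega> \<in> space M. U s \<omega> \<le> p s \<and> (\<exists>i<s. ?X i \<omega> = ?X s \<omega> + block \<xi> s t \<omega>)}"
  have "?E \<subseteq> (\<Union>(i, z)\<in>{..<s} \<times> Z. A i z \<inter> D z)"
  proof
    fix \<omega> assume "\<omega> \<in> ?E"
    then obtain i where "\<omega> \<in> space M" "U s \<omega> \<le> p s" "i < s" "?X i \<omega> = ?X s \<omega> + block \<xi> s t \<omega>" by auto
    then have "(i, block \<xi> s t \<omega>) \<in> {..<s} \<times> Z" "\<omega> \<in> A i (block \<xi> s t \<omega>) \<inter> D (block \<xi> s t \<omega>)"
      by (auto simp: A_def D_def Z_def)
    then show "\<omega> \<in> (\<Union>(i, z)\<in>{..<s} \<times> Z. A i z \<inter> D z)" by (intro UN_I[where a = "(i, block \<xi> s t \<omega>)"]) auto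
  qed
  then have "prob ?E \<le> prob (\<Union>(i, z)\<in>{..<s} \<times> Z. A i z \<inter> D z)"
    using Z A' D' by (intro finite_measure_mono sets.finite_UN) auto
  also have "\<dots> \<le> (\<Sum>(i, z)\<in>{..<s} \<times> Z. prob (A i z \<inter> D z))"
    using Z A' D' finite_measure_subadditive_finite[of "{..<s} \<times> Z" "\<lambda>(i, z). A i z \<inter> D z"] by (simp add: case_prod_beta image_subset_iff)
  also have "\<dots> = (\<Sum>i<s. \<Sum>z\<in>Z. prob (A i z \<inter> D z))" by (simp add: sum.cartesian_product)
  also have "\<dots> \<le> (\<Sum>i<s. B * p s)" by (intro sum_mono one) simp
  finally have 1: "prob ?E \<le> p s * (real s * B)" by (simp add: mult_ac)
  have "prob ?E \<le> prob {\<omega> \<in> space M. U s \<omega> \<le> p s}"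
    using sets_clock[OF s] by (intro finite_measure_mono) auto
  then have "prob ?E \<le> p s" using prob_clock[OF s] by simp
  with 1 show ?thesis by (simp add: min_def)
qed

text \<open>
  The three counts of the pathwise comparison as random variables: windows without return, late
  revisits, and clock times.
\<close>

definition escape_count :: "nat \<Rightarrow> nat \<Rightarrow> 'a \<Rightarrow> real" where
  "escape_count n m \<omega> = real (interrupted_path.no_return (\<lambda>s t. block \<xi> s t \<omega>) n m)"

definition late_revisit_count :: "nat \<Rightarrow> nat \<Rightarrow> 'a \<Rightarrow> real" where
  "late_revisit_count n m \<omega> = real (interrupted_path.late_revisits (\<lambda>k. erw p \<xi> \<gamma> U k \<omega>) n m)"

definition clock_count :: "nat \<Rightarrow> 'a \<Rightarrow> real" where
  "clock_count n \<omega> = real (card ({i. U i \<omega> \<le> p i} \<inter> {1..n}))"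

lemma range_le: "real (card (walk_range (erw p \<xi> \<gamma> U) n \<omega>)) \<le> escape_count n m \<omega> + (real m + 1) + real m * clock_count n \<omega>"
proof -
  interpret P: interrupted_path "\<lambda>k. erw p \<xi> \<gamma> U k \<omega>" "\<lambda>s t. block \<xi> s t \<omega>" "{i. U i \<omega> \<le> p i}" by (rule erw_interrupted_path)
  show ?thesis unfolding escape_count_def clock_count_def walk_range_def
    using P.range_upper[of n m] by (simp flip: of_nat_add of_nat_mult of_nat_Suc)
qed

lemma le_range: "escape_count n m \<omega> \<le> real (card (walk_range (erw p \<xi> \<gamma> U) n \<omega>)) + real m + real m * clock_count n \<omega> + late_revisit_count n m \<omega>"
proof -
  interpret P: interrupted_path "\<lambda>k. erw p \<xi> \<gamma> U k \<omega>" "\<lambda>s t. block \<xi> s t \<omega>" "{i. U i \<omega> \<le> p i}" by (rule erw_interrupted_path)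
  show ?thesis unfolding escape_count_def clock_count_def late_revisit_count_def walk_range_def
    using P.range_lower[of n m] by (simp flip: of_nat_add of_nat_mult of_nat_Suc)
qed

lemma clock_count_expectation: "integrable M (clock_count n)" "expectation (clock_count n) = (\<Sum>i=1..n. p i)"
proof -
  have *: "clock_count n = (\<lambda>\<omega>. real (card {i\<in>{1..n}. U i \<omega> \<le> p i}))"
    by (auto simp: clock_count_def fun_eq_iff intro!: arg_cong[where f = card])
  show "integrable M (clock_count n)" unfolding * by (rule expectation_card) (auto intro: sets_clock)
  have "expectation (clock_count n) = (\<Sum>i=1..n. prob {\<omega> \<in> space M. U i \<omega> \<le> p i})"
    unfolding * by (rule expectation_card) (auto intro: sets_clock)
  then show "expectation (clock_count n) = (\<Sum>i=1..n. p i)" by (simp add: prob_clock)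
qed

lemma late_revisit_count_expectation:
  assumes B: "\<And>t y. lookup (step_law ^ t) y \<le> B t"
  shows "integrable M (late_revisit_count n m)"
    and "expectation (late_revisit_count n m) \<le> (\<Sum>j\<le>n. (\<Sum>i | i + m < j. B (j - i)) + (\<Sum>s=1..j. p s * min 1 (real s * B (j - s))))"
proof -
  let ?X = "erw p \<xi> \<gamma> U"
  have *: "late_revisit_count n m = (\<lambda>\<omega>. real (card {j\<in>{..n}. \<exists>i. i + m < j \<and> ?X i \<omega> = ?X j \<omega>}))"
    by (simp add: late_revisit_count_def fun_eq_iff interrupted_path.late_revisits_def[OF erw_interrupted_path])
  have eq: "{\<omega> \<in> space M. ?X i \<omega> = ?X j \<omega>} \<in> events" for i j
  proof -
    have "(\<lambda>\<omega>. ?X i \<omega> = ?X j \<omega>) \<in> measurable M (count_space UNIV)"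
      by (intro measurable_compose_countable[OF _ erw_rv[of i], where f = "\<lambda>v \<omega>. v = ?X j \<omega>"] measurable_compose[OF erw_rv[of j]]) auto
    then show ?thesis by measurable
  qed
  have E: "{\<omega> \<in> space M. \<exists>i. i + m < j \<and> ?X i \<omega> = ?X j \<omega>} \<in> events" for j
  proof -
    have "{\<omega> \<in> space M. \<exists>i. i + m < j \<and> ?X i \<omega> = ?X j \<omega>} = (\<Union>i\<in>{i. i + m < j}. {\<omega> \<in> space M. ?X i \<omega> = ?X j \<omega>})" by auto
    then show ?thesis using eq by auto
  qed
  show "integrable M (late_revisit_count n m)" unfolding * by (rule expectation_card) (auto intro: E)
  have "expectation (late_revisit_count n m) = (\<Sum>j\<le>n. prob {\<omega> \<in> space M. \<exists>i. i + m < j \<and> ?X i \<omega> = ?X j \<omega>})"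
    unfolding * by (rule expectation_card) (auto intro: E)
  also have "\<dots> \<le> (\<Sum>j\<le>n. (\<Sum>i | i + m < j. B (j - i)) + (\<Sum>s=1..j. p s * min 1 (real s * B (j - s))))"
  proof (rule sum_mono)
    fix j
    define E1 where "E1 i = {\<omega> \<in> space M. block \<xi> i (j - i) \<omega> = 0}" for i
    define E2 where "E2 s = {\<omega> \<in> space M. U s \<omega> \<le> p s \<and> (\<exists>i<s. ?X i \<omega> = ?X s \<omega> + block \<xi> s (j - s) \<omega>)}" for s
    have e1: "E1 i \<in> events" for i unfolding E1_def using sets_lattice_pred[OF block_rv] .
    have e2: "E2 s \<in> events" if "1 \<le> s" for s
    proof -
      have c: "{\<omega> \<in> space M. ?X i \<omega> = ?X s \<omega> + block \<xi> s (j - s) \<omega>} \<in> events" for i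
      proof -
        have "(\<lambda>\<omega>. ?X i \<omega> = ?X s \<omega> + block \<xi> s (j - s) \<omega>) \<in> measurable M (count_space UNIV)"
          by (intro measurable_compose_countable[OF _ erw_rv[of i], where f = "\<lambda>v \<omega>. v = ?X s \<omega> + block \<xi> s (j - s) \<omega>"]
              measurable_compose[OF measurable_lattice_add[OF erw_rv[of s] block_rv[of s "j - s"]]]) auto
        then show ?thesis by measurable
      qed
      have "E2 s = {\<omega> \<in> space M. U s \<omega> \<le> p s} \<inter> (\<Union>i<s. {\<omega> \<in> space M. ?X i \<omega> = ?X s \<omega> + block \<xi> s (j - s) \<omega>})"
        by (auto simp: E2_def)
      then show ?thesis using c sets_clock[OF that] by auto
    qed
    have fin: "finite {i. i + m < j}" by (rule finite_subset[of _ "{..j}"]) auto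
    have "{\<omega> \<in> space M. \<exists>i. i + m < j \<and> ?X i \<omega> = ?X j \<omega>} \<subseteq> (\<Union>i\<in>{i. i + m < j}. E1 i) \<union> (\<Union>s\<in>{1..j}. E2 s)"
    proof
      fix \<omega> assume "\<omega> \<in> {\<omega> \<in> space M. \<exists>i. i + m < j \<and> ?X i \<omega> = ?X j \<omega>}"
      then obtain i where \<omega>: "\<omega> \<in> space M" and i: "i + m < j" "?X i \<omega> = ?X j \<omega>" by auto
      interpret P: interrupted_path "\<lambda>k. ?X k \<omega>" "\<lambda>s t. block \<xi> s t \<omega>" "{i. U i \<omega> \<le> p i}" by (rule erw_interrupted_path)
      from P.late_revisit_cases[OF i] \<omega> show "\<omega> \<in> (\<Union>i\<in>{i. i + m < j}. E1 i) \<union> (\<Union>s\<in>{1..j}. E2 s)"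
        unfolding E1_def E2_def by blast
    qed
    then have "prob {\<omega> \<in> space M. \<exists>i. i + m < j \<and> ?X i \<omega> = ?X j \<omega>} \<le> prob ((\<Union>i\<in>{i. i + m < j}. E1 i) \<union> (\<Union>s\<in>{1..j}. E2 s))"
      using e1 e2 fin by (intro finite_measure_mono sets.Un sets.finite_UN) auto
    also have "\<dots> \<le> prob (\<Union>i\<in>{i. i + m < j}. E1 i) + prob (\<Union>s\<in>{1..j}. E2 s)"
      using e1 e2 fin by (intro measure_Un_le sets.finite_UN) auto
    also have "\<dots> \<le> (\<Sum>i | i + m < j. prob (E1 i)) + (\<Sum>s=1..j. prob (E2 s))"
      using e1 e2 fin by (intro add_mono finite_measure_subadditive_finite) auto
    also have "\<dots> \<le> (\<Sum>i | i + m < j. B (j - i)) + (\<Sum>s=1..j. p s * min 1 (real s * B (j - s)))"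
      using B unfolding E1_def E2_def by (intro add_mono sum_mono revisit_after_clock_bound) (auto simp: block_law)
    finally show "prob {\<omega> \<in> space M. \<exists>i. i + m < j \<and> ?X i \<omega> = ?X j \<omega>} \<le> (\<Sum>i | i + m < j. B (j - i)) + (\<Sum>s=1..j. p s * min 1 (real s * B (j - s)))" .
  qed
  finally show "expectation (late_revisit_count n m) \<le> (\<Sum>j\<le>n. (\<Sum>i | i + m < j. B (j - i)) + (\<Sum>s=1..j. p s * min 1 (real s * B (j - s))))" .
qed

text \<open>
  Windows of length \<open>m\<close> starting at distance at least \<open>m\<close> are uncorrelated, which leaves at most
  \<open>2m + 1\<close> covariances per window, each at most \<open>1\<close>.
\<close>

lemma escape_count_variance:
  shows "integrable M (\<lambda>\<omega>. (escape_count n m \<omega> - real n * no_return_prob m)\<^sup>2)"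
    and "expectation (\<lambda>\<omega>. (escape_count n m \<omega> - real n * no_return_prob m)\<^sup>2) \<le> real n * (2 * real m + 1)"
proof -
  define w where "w = no_return_prob m"
  define A where "A k = {\<omega> \<in> space M. \<forall>t\<in>{1..m}. block \<xi> k t \<omega> \<noteq> 0}" for k
  have Ap: "A k \<in> sets (past s)" if "k + m \<le> s" for k s
    unfolding A_def using sets_avoid_block[where N = "past s" and s = k and m = m and z = 0] block_past[of k _ s] that by simp
  have Af: "A k \<in> sets (future_steps s)" if "s \<le> k" for k s
    unfolding A_def using sets_avoid_block[where N = "future_steps s" and s = k and m = m and z = 0] block_future[of s k] that by simp
  have Ae: "A k \<in> events" for k using Ap[OF order_refl] sets_past_events by blast
  have pA: "prob (A k) = w" for k unfolding A_def w_def by (rule prob_no_return)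
  have w: "0 \<le> w" "w \<le> 1" using pA[of 0] prob_le_1[of "A 0"] measure_nonneg[of M "A 0"] by auto
  define I where "I k \<omega> = (indicator (A k) \<omega> - w :: real)" for k \<omega>
  have Irv: "I k \<in> borel_measurable M" for k unfolding I_def[abs_def] using Ae by measurable
  have Ibd: "\<bar>I k \<omega>\<bar> \<le> 1" for k \<omega> using w by (auto simp: I_def indicator_def)
  have IIbd: "\<bar>I j \<omega> * I k \<omega>\<bar> \<le> 1" for j k \<omega>
    unfolding abs_mult using Ibd[of j \<omega>] Ibd[of k \<omega>] by (simp add: mult_le_one)
  have intI: "integrable M (\<lambda>\<omega>. I j \<omega> * I k \<omega>)" for j k
    using Irv IIbd by (intro integrable_const_bound[where B = 1]) auto
  have cov1: "expectation (\<lambda>\<omega>. I j \<omega> * I k \<omega>) \<le> 1" for j k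
  proof -
    have "expectation (\<lambda>\<omega>. I j \<omega> * I k \<omega>) \<le> expectation (\<lambda>\<omega>. 1)"
      using intI IIbd by (intro integral_mono) (auto simp: abs_le_iff)
    then show ?thesis by (simp add: prob_space)
  qed
  have cov0: "expectation (\<lambda>\<omega>. I j \<omega> * I k \<omega>) = 0" if "j + m \<le> k" for j k
  proof -
    have "I j \<omega> * I k \<omega> = indicator (A j \<inter> A k) \<omega> - w * indicator (A j) \<omega> - w * indicator (A k) \<omega> + w * w" for \<omega>
      by (simp add: I_def indicator_inter_arith algebra_simps)
    moreover have "integrable M (indicator B :: 'a \<Rightarrow> real)" if "B \<in> events" for B
      using that by (intro integrable_real_indicator) (auto simp: less_top[symmetric])
    ultimately have "expectation (\<lambda>\<omega>. I j \<omega> * I k \<omega>) = prob (A j \<inter> A k) - w * prob (A j) - w * prob (A k) + w * w"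
      using Ae by (simp add: prob_space)
    moreover have "prob (A j \<inter> A k) = prob (A j) * prob (A k)"
      by (rule past_future_indep[OF Ap[OF that] Af]) simp
    ultimately show ?thesis by (simp add: pA)
  qed
  have NI: "escape_count n m \<omega> - real n * w = (\<Sum>k<n. I k \<omega>)" if "\<omega> \<in> space M" for \<omega>
  proof -
    have "(\<Sum>k<n. indicator (A k) \<omega>) = (\<Sum>k<n. if \<forall>t\<in>{1..m}. block \<xi> k t \<omega> \<noteq> 0 then 1 else (0::real))"
      using that by (intro sum.cong) (auto simp: A_def)
    also have "\<dots> = escape_count n m \<omega>"
      unfolding escape_count_def interrupted_path.no_return_def[OF erw_interrupted_path] by (simp add: sum.If_cases Int_def)
    finally show ?thesis by (simp add: I_def sum_subtractf)
  qed
  have sq: "(escape_count n m \<omega> - real n * w)\<^sup>2 = (\<Sum>j<n. \<Sum>k<n. I j \<omega> * I k \<omega>)" if "\<omega> \<in> space M" for \<omega>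
    by (simp add: NI[OF that] power2_eq_square sum_product)
  show "integrable M (\<lambda>\<omega>. (escape_count n m \<omega> - real n * no_return_prob m)\<^sup>2)"
    unfolding w_def[symmetric] by (subst Bochner_Integration.integrable_cong[OF refl sq]) (auto intro!: Bochner_Integration.integrable_sum intI)
  have "expectation (\<lambda>\<omega>. (escape_count n m \<omega> - real n * w)\<^sup>2) = (\<Sum>j<n. \<Sum>k<n. expectation (\<lambda>\<omega>. I j \<omega> * I k \<omega>))"
    by (subst Bochner_Integration.integral_cong[OF refl sq]) (auto simp: intI)
  also have "\<dots> \<le> (\<Sum>j<n. \<Sum>k<n. of_bool (k \<in> {j - m..j + m}))"
  proof (intro sum_mono)
    fix j k
    show "expectation (\<lambda>\<omega>. I j \<omega> * I k \<omega>) \<le> of_bool (k \<in> {j - m..j + m})"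
    proof (cases "k \<in> {j - m..j + m}")
      case False
      then have "j + m \<le> k \<or> k + m \<le> j" by auto
      then show ?thesis using cov0[of j k] cov0[of k j] False by (auto simp: mult.commute)
    qed (use cov1[of j k] in simp)
  qed
  also have "\<dots> \<le> (\<Sum>j<n. 2 * real m + 1)"
  proof (rule sum_mono)
    fix j
    have "(\<Sum>k<n. of_bool (k \<in> {j - m..j + m})) = (real (card ({..<n} \<inter> {j - m..j + m})) :: real)"
      by (simp add: of_bool_def sum.If_cases Int_def)
    also have "\<dots> \<le> real (card {j - m..j + m})" by (intro of_nat_mono card_mono) auto
    also have "\<dots> \<le> 2 * real m + 1" by simp
    finally show "(\<Sum>k<n. of_bool (k \<in> {j - m..j + m})) \<le> 2 * real m + 1" .
  qed
  finally show "expectation (\<lambda>\<omega>. (escape_count n m \<omega> - real n * no_return_prob m)\<^sup>2) \<le> real n * (2 * real m + 1)"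
    by (simp add: w_def)
qed

end

section \<open>Almost sure limits and the escape probability\<close>

text \<open>
  Comparison with the integral, one summand at a time, by the mean value theorem.
\<close>

lemma sum_powr_le:
  fixes b :: real
  assumes b: "0 < b" "b < 1"
  shows "(\<Sum>i=1..n. real i powr (-b)) \<le> real n powr (1 - b) / (1 - b)"
proof (induction n)
  case 0
  then show ?case by simp
next
  case (Suc n)
  have step: "real n powr (1 - b) + (1 - b) * real (Suc n) powr (-b) \<le> real (Suc n) powr (1 - b)"
  proof (cases "n = 0")
    case True
    then show ?thesis using b by simp
  next
    case False
    have "((\<lambda>x. x powr (1 - b)) has_real_derivative (1 - b) * x powr (-b)) (at x)" if "real n \<le> x" for x
      using has_real_derivative_powr[of x "1 - b"] that False by simp
    then obtain z where z: "real n < z" "z < real (Suc n)"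
      "real (Suc n) powr (1 - b) - real n powr (1 - b) = (real (Suc n) - real n) * ((1 - b) * z powr (-b))"
      using MVT2[of "real n" "real (Suc n)" "\<lambda>x. x powr (1 - b)" "\<lambda>x. (1 - b) * x powr (-b)"] by auto
    have "real (Suc n) powr (-b) \<le> z powr (-b)"
      using z b False by (intro powr_mono2') auto
    then have "(1 - b) * real (Suc n) powr (-b) \<le> (1 - b) * z powr (-b)"
      using b by (intro mult_left_mono) auto
    then show ?thesis using z(3) by simp
  qed
  have "(1 - b) * (\<Sum>i=1..Suc n. real i powr (-b)) = (1 - b) * (\<Sum>i=1..n. real i powr (-b)) + (1 - b) * real (Suc n) powr (-b)"
    by (simp add: algebra_simps)
  also have "\<dots> \<le> real n powr (1 - b) + (1 - b) * real (Suc n) powr (-b)"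
    using Suc b by (simp add: field_simps)
  also note step
  finally show ?case using b by (simp add: field_simps)
qed

lemma min_one_le_powr:
  fixes x :: real
  assumes "0 \<le> x" "0 < \<theta>" "\<theta> \<le> 1"
  shows "min 1 x \<le> x powr \<theta>"
proof (cases "x \<le> 1")
  case True
  show ?thesis
  proof (cases "x = 0")
    case False
    then have "x powr 1 \<le> x powr \<theta>" using True assms by (intro powr_mono') auto
    then show ?thesis using assms True by simp
  qed simp
next
  case False
  then show ?thesis using assms ge_one_powr_ge_zero[of x \<theta>] by simp
qed

text \<open>
  The sum of the \<open>Z k\<close> has finite expectation, so it is almost surely finite and its terms tend to \<open>0\<close>.
\<close>

lemma (in prob_space) AE_tendsto_0_of_summable_expectation:
  fixes Z :: "nat \<Rightarrow> 'a \<Rightarrow> real"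
  assumes int: "\<And>k. integrable M (Z k)" and pos: "\<And>k \<omega>. \<omega> \<in> space M \<Longrightarrow> 0 \<le> Z k \<omega>"
    and sum: "summable (\<lambda>k. expectation (Z k))"
  shows "AE \<omega> in M. (\<lambda>k. Z k \<omega>) \<longlonglongrightarrow> 0"
proof -
  have m [measurable]: "Z k \<in> borel_measurable M" for k using int[of k] by auto
  have "(\<integral>\<^sup>+\<omega>. suminf (\<lambda>k. ennreal (Z k \<omega>)) \<partial>M) = suminf (\<lambda>k. \<integral>\<^sup>+\<omega>. ennreal (Z k \<omega>) \<partial>M)"
    by (rule nn_integral_suminf) measurable
  also have "\<dots> = suminf (\<lambda>k. ennreal (expectation (Z k)))"
    using int pos by (intro suminf_cong nn_integral_eq_integral) auto
  also have "\<dots> = ennreal (suminf (\<lambda>k. expectation (Z k)))"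
    using sum pos by (intro suminf_ennreal2) (auto intro!: integral_nonneg_AE)
  finally have "(\<integral>\<^sup>+\<omega>. suminf (\<lambda>k. ennreal (Z k \<omega>)) \<partial>M) \<noteq> \<infinity>" by simp
  then have "AE \<omega> in M. suminf (\<lambda>k. ennreal (Z k \<omega>)) \<noteq> \<infinity>"
    by (intro nn_integral_PInf_AE) auto
  then show ?thesis
  proof (rule AE_mp, intro AE_I2 impI)
    fix \<omega> assume "\<omega> \<in> space M" "suminf (\<lambda>k. ennreal (Z k \<omega>)) \<noteq> \<infinity>"
    then have "summable (\<lambda>k. Z k \<omega>)" using pos by (intro summable_suminf_not_top) auto
    then show "(\<lambda>k. Z k \<omega>) \<longlonglongrightarrow> 0" by (rule summable_LIMSEQ_zero)
  qed
qed

text \<open>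
  Between consecutive powers \<open>k\<^sup>r\<close> and \<open>(k + 1)\<^sup>r\<close> a monotone \<open>f\<close> is squeezed between its values at these
  two points, whose ratio tends to \<open>1\<close>.
\<close>

lemma tendsto_of_power_subsequence:
  fixes f :: "nat \<Rightarrow> real"
  assumes mono: "mono f" and pos: "\<And>n. 0 \<le> f n" and r: "r > 0"
    and lim: "(\<lambda>k. f (k ^ r) / real (k ^ r)) \<longlonglongrightarrow> L"
  shows "(\<lambda>n. f n / real n) \<longlonglongrightarrow> L"
proof -
  define \<kappa> where "\<kappa> n = nat \<lfloor>root r (real n)\<rfloor>" for n :: nat
  have k1: "\<kappa> n ^ r \<le> n" for n
  proof -
    have "real (\<kappa> n) \<le> root r (real n)" unfolding \<kappa>_def by (intro of_nat_floor real_root_ge_zero) simp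
    then have "real (\<kappa> n) ^ r \<le> root r (real n) ^ r" by (intro power_mono) auto
    also have "\<dots> = real n" using r by (simp add: real_root_pow_pos2)
    finally show ?thesis by (metis of_nat_le_iff of_nat_power)
  qed
  have k2: "n < Suc (\<kappa> n) ^ r" for n
  proof -
    have "root r (real n) < real (Suc (\<kappa> n))" unfolding \<kappa>_def by (simp add: floor_less_iff) linarith
    then have "root r (real n) ^ r < real (Suc (\<kappa> n)) ^ r" using r by (intro power_strict_mono) auto
    moreover have "root r (real n) ^ r = real n" using r by (simp add: real_root_pow_pos2)
    ultimately show ?thesis by (metis of_nat_less_iff of_nat_power)
  qed
  have kinf: "filterlim \<kappa> at_top sequentially"
    unfolding filterlim_at_top_ge[where c = 0]
  proof (intro allI impI)
    fix Z :: nat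
    have "Z \<le> \<kappa> n" if "Z ^ r \<le> n" for n
    proof (rule ccontr)
      assume "\<not> Z \<le> \<kappa> n"
      then have "Suc (\<kappa> n) ^ r \<le> Z ^ r" by (intro power_mono) auto
      then show False using k2[of n] that by simp
    qed
    then show "\<forall>\<^sub>F n in sequentially. Z \<le> \<kappa> n" unfolding eventually_sequentially by blast
  qed
  have q: "(\<lambda>k. (real k / real (Suc k)) ^ r) \<longlonglongrightarrow> 1 ^ r"
    by (intro tendsto_power LIMSEQ_n_over_Suc_n)
  have low: "(\<lambda>k. f (k ^ r) / real (k ^ r) * (real k / real (Suc k)) ^ r) \<longlonglongrightarrow> L * 1 ^ r"
    by (intro tendsto_mult lim q)
  have up: "(\<lambda>k. f (Suc k ^ r) / real (Suc k ^ r) / (real k / real (Suc k)) ^ r) \<longlonglongrightarrow> L / 1 ^ r"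
    by (intro tendsto_divide q LIMSEQ_Suc[OF lim]) simp
  have lo': "(\<lambda>n. f (\<kappa> n ^ r) / real (\<kappa> n ^ r) * (real (\<kappa> n) / real (Suc (\<kappa> n))) ^ r) \<longlonglongrightarrow> L"
    using filterlim_compose[OF low kinf] by simp
  have up': "(\<lambda>n. f (Suc (\<kappa> n) ^ r) / real (Suc (\<kappa> n) ^ r) / (real (\<kappa> n) / real (Suc (\<kappa> n))) ^ r) \<longlonglongrightarrow> L"
    using filterlim_compose[OF up kinf] by simp
  have ev: "\<forall>\<^sub>F n in sequentially. f (\<kappa> n ^ r) / real (\<kappa> n ^ r) * (real (\<kappa> n) / real (Suc (\<kappa> n))) ^ r \<le> f n / real n \<and>
      f n / real n \<le> f (Suc (\<kappa> n) ^ r) / real (Suc (\<kappa> n) ^ r) / (real (\<kappa> n) / real (Suc (\<kappa> n))) ^ r"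
    using filterlim_at_top[THEN iffD1, OF kinf, rule_format, of 1]
  proof eventually_elim
    case (elim n)
    then have pos': "0 < real (\<kappa> n) ^ r" "0 < real (Suc (\<kappa> n)) ^ r" by auto
    have kn: "real (\<kappa> n) ^ r \<le> real n" "real n \<le> real (Suc (\<kappa> n)) ^ r"
      using k1[of n] k2[of n] by (metis of_nat_le_iff of_nat_power, metis less_imp_le of_nat_le_iff of_nat_power)
    have n0: "0 < real n" using kn pos' by linarith
    have "f (\<kappa> n ^ r) / real (\<kappa> n ^ r) * (real (\<kappa> n) / real (Suc (\<kappa> n))) ^ r = f (\<kappa> n ^ r) / real (Suc (\<kappa> n)) ^ r"
      using pos' by (simp add: power_divide)
    also have "\<dots> \<le> f n / real n"
      using kn pos' n0 monoD[OF mono k1[of n]] pos by (intro frac_le) auto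
    finally have 1: "f (\<kappa> n ^ r) / real (\<kappa> n ^ r) * (real (\<kappa> n) / real (Suc (\<kappa> n))) ^ r \<le> f n / real n" .
    have "f n / real n \<le> f (Suc (\<kappa> n) ^ r) / real (\<kappa> n) ^ r"
      using kn pos' n0 monoD[OF mono less_imp_le[OF k2[of n]]] pos by (intro frac_le) auto
    also have "\<dots> = f (Suc (\<kappa> n) ^ r) / real (Suc (\<kappa> n) ^ r) / (real (\<kappa> n) / real (Suc (\<kappa> n))) ^ r"
      using pos' by (simp add: power_divide)
    finally show ?case using 1 by blast
  qed
  show ?thesis
    by (rule tendsto_sandwich[OF _ _ lo' up']) (use ev in \<open>auto elim: eventually_mono\<close>)
qed

context pn_ERW
begin

lemma no_return_prob_tendsto: "no_return_prob \<longlonglongrightarrow> escape_prob M \<xi>"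
proof -
  define A where "A m = {\<omega> \<in> space M. \<forall>t\<in>{1..m}. block \<xi> 0 t \<omega> \<noteq> 0}" for m
  have A: "A m \<in> events" for m
    unfolding A_def using sets_avoid_block[where N = M and s = 0 and m = m and z = 0] block_rv by simp
  have "(\<lambda>m. prob (A m)) \<longlonglongrightarrow> prob (\<Inter>m. A m)"
    using A by (intro finite_Lim_measure_decseq) (auto simp: A_def decseq_def)
  moreover have "(\<Inter>m. A m) = {\<omega> \<in> space M. \<forall>n\<ge>1. (\<Sum>i=1..n. \<xi> i \<omega>) \<noteq> 0}"
  proof -
    have "{0<..0 + n} = {1..n}" for n :: nat by auto
    then have "block \<xi> 0 n \<omega> = (\<Sum>i=1..n. \<xi> i \<omega>)" for n \<omega> by (simp add: block_def)
    note eq = this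
    show ?thesis
    proof (intro equalityI subsetI)
      fix \<omega> assume \<omega>: "\<omega> \<in> (\<Inter>m. A m)"
      then have An: "\<omega> \<in> A n" for n by blast
      have "block \<xi> 0 n \<omega> \<noteq> 0" if "n \<ge> 1" for n
        using An[of n] that by (auto simp: A_def)
      then show "\<omega> \<in> {\<omega> \<in> space M. \<forall>n\<ge>1. (\<Sum>i=1..n. \<xi> i \<omega>) \<noteq> 0}"
        using \<omega> unfolding eq by (auto simp: A_def)
    qed (auto simp: A_def eq)
  qed
  moreover have "no_return_prob = (\<lambda>m. prob (A m))" by (simp add: fun_eq_iff no_return_prob_def A_def)
  ultimately show ?thesis by (simp only: escape_prob_def)
qed

lemma no_return_prob_antimono: "decseq no_return_prob"
  unfolding decseq_def no_return_prob_def
proof (intro allI impI finite_measure_mono)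
  fix m n :: nat
  show "{\<omega> \<in> space M. \<forall>t\<in>{1..m}. block \<xi> 0 t \<omega> \<noteq> 0} \<in> events"
    using sets_avoid_block[where N = M and s = 0 and m = m and z = 0] block_rv by simp
qed auto

text \<open>
  The events that \<open>k\<close> is a time at the origin with no return in the next \<open>K\<close> steps are disjoint for
  different \<open>k < K\<close>.
\<close>

lemma expected_returns_le:
  "(\<Sum>k<K. lookup (step_law ^ k) 0) * no_return_prob K \<le> 1"
proof -
  define F where "F k = {\<omega> \<in> space M. \<forall>t\<in>{1..K}. block \<xi> k t \<omega> \<noteq> 0}" for k
  define R where "R k = {\<omega> \<in> space M. block \<xi> 0 k \<omega> = 0}" for k
  have F: "F k \<in> sets (future_steps k)" for k
    unfolding F_def using sets_avoid_block[where N = "future_steps k" and s = k and m = K and z = 0] block_future[of k k] by simp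
  have R: "R k \<in> sets (past k)" for k
    unfolding R_def using sets_lattice_pred[OF block_past[of 0 k k], of "\<lambda>v. v = 0"] by simp
  have split: "block \<xi> 0 (j + t) \<omega> = block \<xi> 0 j \<omega> + block \<xi> j t \<omega>" for j t \<omega>
    by (induction t) (simp_all add: block_Suc add.assoc)
  have disj: "(R j \<inter> F j) \<inter> (R k \<inter> F k) = {}" if "j < k" "k < K" for j k
  proof -
    have "k - j \<in> {1..K}" "block \<xi> 0 k \<omega> = block \<xi> 0 j \<omega> + block \<xi> j (k - j) \<omega>" for \<omega>
      using that split[of j "k - j" \<omega>] by auto
    then show ?thesis unfolding R_def F_def by fastforce
  qed
  have "(\<Sum>k<K. lookup (step_law ^ k) 0) * no_return_prob K = (\<Sum>k<K. prob (R k \<inter> F k))"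
    using past_future_indep[OF R F] unfolding sum_distrib_right R_def F_def block_law prob_no_return by simp
  also have "\<dots> = prob (\<Union>k<K. R k \<inter> F k)"
  proof (rule finite_measure_finite_Union[symmetric])
    show "disjoint_family_on (\<lambda>k. R k \<inter> F k) {..<K}"
      unfolding disjoint_family_on_def using disj by (metis Int_commute lessThan_iff linorder_neqE_nat)
    show "(\<lambda>k. R k \<inter> F k) ` {..<K} \<subseteq> events" using R F sets_past_events sets_future_steps by blast
  qed simp
  also have "\<dots> \<le> 1" by (rule prob_le_1)
  finally show ?thesis .
qed

text \<open>
  With a positive escape probability \<open>e\<close> the expected number of returns would be at most \<open>1 / e\<close>.
\<close>

lemma escape_prob_planar:
  assumes "CARD('d) = 2" shows "escape_prob M \<xi> = 0"
proof (rule ccontr)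
  assume "escape_prob M \<xi> \<noteq> 0"
  then have e: "escape_prob M \<xi> > 0" by (simp add: escape_prob_def less_le)
  obtain K where K: "(\<Sum>k<K. lookup (step_law ^ k) 0) > 1 / escape_prob M \<xi>"
    using step.planar_walk_recurrent[OF assms] by blast
  have "escape_prob M \<xi> \<le> no_return_prob K"
    using decseq_ge[OF no_return_prob_antimono no_return_prob_tendsto] .
  then have "1 / escape_prob M \<xi> * escape_prob M \<xi> < (\<Sum>k<K. lookup (step_law ^ k) 0) * no_return_prob K"
    using K e by (intro mult_less_le_imp_less) auto
  then show False using expected_returns_le[of K] e by simp
qed

end

section \<open>The range along polynomially decaying excitation\<close>

locale polynomial_pn_ERW = pn_ERW M F l p \<xi> \<gamma> U
  for M :: "'a measure" and F :: "nat \<Rightarrow> 'a measure" and l :: "real ^ 'd" and p :: "nat \<Rightarrow> real"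
    and \<xi> \<gamma> :: "nat \<Rightarrow> 'a \<Rightarrow> int ^ 'd" and U :: "nat \<Rightarrow> 'a \<Rightarrow> real" +
  fixes C \<beta> :: real
  assumes C: "C > 0" and \<beta>: "0 < \<beta>" "\<beta> \<le> 1"
    and p_eq: "\<And>n. n \<ge> 1 \<Longrightarrow> p n = min (C * real n powr (- \<beta>)) 1"
begin

text \<open>
  Long enough for returns after more than a window to be rare, short enough for the windows to be
  nearly independent and for few of them to contain a clock time.
\<close>

definition window :: "nat \<Rightarrow> nat" where
  "window n = nat \<lfloor>real n powr (\<beta> / 4)\<rfloor>"

lemma window_le: "real (window n) \<le> real n powr (\<beta> / 4)"
  unfolding window_def by (intro of_nat_floor) simp

lemma window_less: "real n powr (\<beta> / 4) < real (window n) + 1"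
  unfolding window_def by linarith

lemma window_at_top: "filterlim window at_top sequentially"
proof -
  have "filterlim (\<lambda>n. real n powr (\<beta> / 4)) at_top sequentially"
    using \<beta> by real_asymp
  then have "filterlim (\<lambda>n. real (window n) + 1) at_top sequentially"
    by (rule filterlim_at_top_mono) (auto intro!: always_eventually less_imp_le window_less)
  then have "filterlim (\<lambda>n. real (window n)) at_top sequentially"
    using filterlim_tendsto_add_at_top[OF tendsto_const[of "-1"], of "\<lambda>n. real (window n) + 1" sequentially] by simp
  then show ?thesis by (simp add: filterlim_sequentially_iff_filterlim_real)
qed

text \<open>
  The exponent \<open>3 \<beta> / 4\<close> instead of \<open>\<beta>\<close> is below \<open>1\<close> also for \<open>\<beta> = 1\<close>, where the sum is logarithmic; the
  loss is harmless below.
\<close>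

lemma sum_p_le:
  obtains A where "A > 0" "\<And>n. (\<Sum>i=1..n. p i) \<le> A * real n powr (1 - 3 * \<beta> / 4)"
proof
  show "C / (1 - 3 * \<beta> / 4) > 0" using C \<beta> by simp
  fix n :: nat
  have "(\<Sum>i=1..n. p i) \<le> (\<Sum>i=1..n. C * real i powr (- (3 * \<beta> / 4)))"
  proof (rule sum_mono)
    fix i assume i: "i \<in> {1..n}"
    have "p i \<le> C * real i powr (- \<beta>)" using p_eq[of i] i by simp
    also have "\<dots> \<le> C * real i powr (- (3 * \<beta> / 4))"
      using i C \<beta> by (intro mult_left_mono powr_mono) auto
    finally show "p i \<le> C * real i powr (- (3 * \<beta> / 4))" .
  qed
  also have "\<dots> = C * (\<Sum>i=1..n. real i powr (- (3 * \<beta> / 4)))" by (simp add: sum_distrib_left)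
  also have "\<dots> \<le> C * (real n powr (1 - 3 * \<beta> / 4) / (1 - 3 * \<beta> / 4))"
    using C \<beta> by (intro mult_left_mono sum_powr_le) auto
  finally show "(\<Sum>i=1..n. p i) \<le> C / (1 - 3 * \<beta> / 4) * real n powr (1 - 3 * \<beta> / 4)" by simp
qed

definition window_error :: "nat \<Rightarrow> 'a \<Rightarrow> real" where
  "window_error n \<omega> = (real (window n) + 1 + real (window n) * clock_count n \<omega>) / real n"

definition fluctuation :: "nat \<Rightarrow> 'a \<Rightarrow> real" where
  "fluctuation n \<omega> = ((escape_count n (window n) \<omega> - real n * no_return_prob (window n)) / real n)\<^sup>2"

lemma one_le_powr: "n \<ge> 1 \<Longrightarrow> 0 \<le> e \<Longrightarrow> 1 \<le> real n powr e"
  by (rule ge_one_powr_ge_zero) auto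

lemma fluctuation_expectation:
  "integrable M (fluctuation n)" "n \<ge> 1 \<Longrightarrow> expectation (fluctuation n) \<le> 3 * real n powr (- (\<beta> / 4))"
proof -
  have eq: "fluctuation n = (\<lambda>\<omega>. (escape_count n (window n) \<omega> - real n * no_return_prob (window n))\<^sup>2 / (real n)\<^sup>2)"
    by (simp add: fluctuation_def fun_eq_iff power_divide)
  show "integrable M (fluctuation n)" unfolding eq by (intro integrable_divide escape_count_variance(1))
  assume n: "n \<ge> 1"
  have "expectation (fluctuation n) \<le> real n * (2 * real (window n) + 1) / (real n)\<^sup>2"
    unfolding eq using escape_count_variance(2)[of n "window n"] by (simp add: divide_right_mono)
  also have "\<dots> = (2 * real (window n) + 1) / real n" using n by (simp add: power2_eq_square)
  also have "\<dots> \<le> 3 * real n powr (\<beta> / 4) / real n"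
    using window_le[of n] one_le_powr[OF n, of "\<beta> / 4"] \<beta> by (intro divide_right_mono) auto
  also have "\<dots> = 3 * real n powr (\<beta> / 4 - 1)" using n by (simp add: powr_diff)
  also have "\<dots> \<le> 3 * real n powr (- (\<beta> / 4))"
    using n \<beta> by (intro mult_left_mono powr_mono) auto
  finally show "expectation (fluctuation n) \<le> 3 * real n powr (- (\<beta> / 4))" .
qed

lemma window_error_expectation:
  obtains A where "\<And>n. integrable M (window_error n)" "\<And>n. n \<ge> 1 \<Longrightarrow> expectation (window_error n) \<le> A * real n powr (- (\<beta> / 4))"
proof -
  obtain A where A: "A > 0" "\<And>n. (\<Sum>i=1..n. p i) \<le> A * real n powr (1 - 3 * \<beta> / 4)" using sum_p_le by blast
  have int: "integrable M (window_error n)" for n unfolding window_error_def[abs_def] using clock_count_expectation(1) by auto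
  have "expectation (window_error n) \<le> (2 + A) * real n powr (- (\<beta> / 4))" if n: "n \<ge> 1" for n
  proof -
    have sp: "0 \<le> (\<Sum>i=1..n. p i)" using p_range by (intro sum_nonneg) (auto intro: less_imp_le)
    have "expectation (window_error n) = (real (window n) + 1 + real (window n) * (\<Sum>i=1..n. p i)) / real n"
      unfolding window_error_def[abs_def] using clock_count_expectation by (simp add: prob_space)
    also have "\<dots> \<le> (2 * real n powr (\<beta> / 4) + real n powr (\<beta> / 4) * (A * real n powr (1 - 3 * \<beta> / 4))) / real n"
      using window_le[of n] one_le_powr[OF n, of "\<beta> / 4"] \<beta> A(2)[of n] sp
      by (intro divide_right_mono add_mono mult_mono) auto
    also have "\<dots> = 2 * real n powr (\<beta> / 4 - 1) + A * real n powr (\<beta> / 4 + (1 - 3 * \<beta> / 4) - 1)"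
    proof -
      have e: "real n powr (e - 1) = real n powr e / real n" for e using n by (simp add: powr_diff)
      show ?thesis unfolding e powr_add by (simp only: add_divide_distrib times_divide_eq_right mult_ac)
    qed
    also have "\<dots> \<le> 2 * real n powr (- (\<beta> / 4)) + A * real n powr (- (\<beta> / 4))"
      using n \<beta> A(1) by (intro add_mono mult_left_mono powr_mono) auto
    finally show ?thesis by (simp add: algebra_simps)
  qed
  with int show thesis using that by blast
qed

text \<open>
  With \<open>a = d / 2\<close>, a block of \<open>t\<close> plain steps hits a given site with probability at most \<open>D t\<^bsup>-a\<^esup>\<close>.
  Revisits without a clock time in between contribute the tail \<open>\<Sum> t\<^bsup>-a\<^esup>\<close> beyond the window. For the others,
  \<open>min(1, n D t\<^bsup>-a\<^esup>) \<le> (n D)\<^bsup>\<theta>\<^esup> t\<^bsup>-a \<theta>\<^esup>\<close> with \<open>\<theta> = \<beta> / 2\<close>; the dimension makes \<open>a \<theta> > 1\<close>, so that the sum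
  over \<open>t\<close> is of order \<open>n\<^bsup>\<beta>/2\<^esup>\<close> per clock time.
\<close>

lemma revisit_expectation:
  assumes d: "real CARD('d) > 2 + 4 / \<beta>"
  obtains A where "\<And>n. n \<ge> 1 \<Longrightarrow> expectation (\<lambda>\<omega>. late_revisit_count n (window n) \<omega> / real n) \<le> A * real n powr (- (\<beta> / 4))"
proof -
  define a where "a = real CARD('d) / 2"
  define \<theta> where "\<theta> = \<beta> / 2"
  have "1 + 2 / \<beta> < a" using d by (simp add: a_def)
  moreover have "2 / \<beta> \<ge> 2" using \<beta> by (simp add: field_simps)
  ultimately have a3: "a > 3" and a: "a > 1 + 2 / \<beta>" by auto
  have a\<theta>: "a * \<theta> > 1"
  proof -
    have "(1 + 2 / \<beta>) * \<theta> < a * \<theta>" using a \<beta> by (intro mult_strict_right_mono) (auto simp: \<theta>_def)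
    moreover have "(1 + 2 / \<beta>) * \<theta> = \<beta> / 2 + 1" using \<beta> by (simp add: \<theta>_def field_simps)
    ultimately show ?thesis using \<beta> by simp
  qed
  obtain A where A: "A > 0" "\<And>n. (\<Sum>i=1..n. p i) \<le> A * real n powr (1 - 3 * \<beta> / 4)" using sum_p_le by blast
  obtain D where D: "D > 0" "\<And>t y. t \<ge> 1 \<Longrightarrow> lookup (step_law ^ t) y \<le> D * real t powr (- a)"
    using step.local_bound unfolding a_def by blast
  define B where "B t = (if t = 0 then 1 else D * real t powr (- a))" for t
  have B: "lookup (step_law ^ t) y \<le> B t" for t y
    using D(2)[of t y] by (auto simp: B_def lookup_one when_def)
  have B0: "B t \<ge> 0" for t using D(1) by (simp add: B_def)
  have s1: "summable (\<lambda>t. real t powr (- 2))" by (simp add: summable_real_powr_iff)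
  define Z1 where "Z1 = suminf (\<lambda>t. real t powr (- 2))"
  have s2: "summable (\<lambda>t. real t powr (- (a * \<theta>)))" using a\<theta> by (simp add: summable_real_powr_iff)
  define Z2 where "Z2 = suminf (\<lambda>t. real t powr (- (a * \<theta>)))"
  have Z: "Z1 \<ge> 0" "Z2 \<ge> 0" unfolding Z1_def Z2_def by (intro suminf_nonneg s1 s2; simp)+
  \<comment> \<open>Here \<open>t\<^bsup>-a\<^esup> \<le> t\<^bsup>-1\<^esup> t\<^bsup>-2\<^esup>\<close>, and \<open>t\<close> exceeds \<open>n\<^bsup>\<beta>/4\<^esup>\<close> beyond the window.\<close>
  have within: "(\<Sum>i | i + m < j. B (j - i)) \<le> D * Z1 * real n powr (- (\<beta> / 4))" if n: "n \<ge> 1" and m: "m = window n" for n m j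
  proof -
    have "(\<Sum>i | i + m < j. B (j - i)) = (\<Sum>t\<in>{m<..j}. B t)"
      by (rule sum.reindex_bij_witness[of _ "\<lambda>t. j - t" "\<lambda>i. j - i"]) auto
    also have "\<dots> \<le> (\<Sum>t\<in>{m<..j}. D * real n powr (- (\<beta> / 4)) * real t powr (- 2))"
    proof (rule sum_mono)
      fix t assume t: "t \<in> {m<..j}"
      have tn: "real n powr (\<beta> / 4) \<le> real t" using window_less[of n] t m by simp
      have "B t = D * real t powr (- a)" using t by (simp add: B_def)
      also have "real t powr (- a) \<le> real t powr (- 1 + - 2)" using t a3 by (intro powr_mono) auto
      also have "\<dots> = real t powr (- 1) * real t powr (- 2)" by (rule powr_add)
      also have "real t powr (- 1) \<le> (real n powr (\<beta> / 4)) powr (- 1)"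
        using tn n by (intro powr_mono2') auto
      also have "(real n powr (\<beta> / 4)) powr (- 1) = real n powr (- (\<beta> / 4))" unfolding powr_powr by simp
      finally show "B t \<le> D * real n powr (- (\<beta> / 4)) * real t powr (- 2)"
        using D(1) by (simp add: mult_left_mono mult_right_mono)
    qed
    also have "\<dots> = D * real n powr (- (\<beta> / 4)) * (\<Sum>t\<in>{m<..j}. real t powr (- 2))" by (simp add: sum_distrib_left)
    also have "\<dots> \<le> D * real n powr (- (\<beta> / 4)) * Z1"
      unfolding Z1_def using D(1) by (intro mult_left_mono sum_le_suminf s1) auto
    finally show ?thesis by (simp add: mult_ac)
  qed
  have across: "(\<Sum>t\<le>n. min 1 (real n * B t)) \<le> (1 + D powr \<theta> * Z2) * real n powr (\<beta> / 2)" if n: "n \<ge> 1" for n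
  proof -
    have "(\<Sum>t\<le>n. min 1 (real n * B t)) = min 1 (real n) + (\<Sum>t=1..n. min 1 (real n * B t))"
      by (simp add: atMost_atLeast0 sum.atLeast_Suc_atMost B_def)
    also have "(\<Sum>t=1..n. min 1 (real n * B t)) \<le> (\<Sum>t=1..n. (real n powr \<theta> * D powr \<theta>) * real t powr (- (a * \<theta>)))"
    proof (rule sum_mono)
      fix t assume t: "t \<in> {1..n}"
      have "min 1 (real n * B t) \<le> (real n * B t) powr \<theta>"
        using B0 \<beta> by (intro min_one_le_powr) (auto simp: \<theta>_def)
      also have "\<dots> = (real n powr \<theta> * D powr \<theta>) * real t powr (- (a * \<theta>))"
        using t D(1) by (simp add: B_def powr_mult powr_powr)
      finally show "min 1 (real n * B t) \<le> (real n powr \<theta> * D powr \<theta>) * real t powr (- (a * \<theta>))" .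
    qed
    also have "\<dots> = (real n powr \<theta> * D powr \<theta>) * (\<Sum>t=1..n. real t powr (- (a * \<theta>)))" by (simp add: sum_distrib_left)
    also have "\<dots> \<le> (real n powr \<theta> * D powr \<theta>) * Z2"
      unfolding Z2_def by (intro mult_left_mono sum_le_suminf s2) auto
    also have "min 1 (real n) \<le> real n powr \<theta>" using one_le_powr[OF n, of \<theta>] \<beta> by (auto simp: \<theta>_def)
    finally show ?thesis by (simp add: \<theta>_def algebra_simps)
  qed
  define K where "K = 2 * D * Z1 + A * (1 + D powr \<theta> * Z2)"
  have "expectation (\<lambda>\<omega>. late_revisit_count n (window n) \<omega> / real n) \<le> K * real n powr (- (\<beta> / 4))" if n: "n \<ge> 1" for n
  proof -
    define m where "m = window n"
    have "(\<Sum>j\<le>n. \<Sum>s=1..j. p s * min 1 (real s * B (j - s))) \<le> (\<Sum>j\<le>n. \<Sum>s=1..j. p s * min 1 (real n * B (j - s)))"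
      using B0 p_range by (intro sum_mono mult_left_mono min.mono mult_right_mono) (auto intro: less_imp_le)
    also have "\<dots> = (\<Sum>(j, s)\<in>Sigma {..n} (\<lambda>j. {1..j}). p s * min 1 (real n * B (j - s)))"
      by (simp add: sum.Sigma)
    \<comment> \<open>Exchange of summation: sum over the clock time \<open>s\<close> and the length \<open>t = j - s\<close> of the block after it.\<close>
    also have "\<dots> = (\<Sum>(s, t)\<in>Sigma {1..n} (\<lambda>s. {..n - s}). p s * min 1 (real n * B t))"
      by (rule sum.reindex_bij_witness[of _ "\<lambda>(s, t). (s + t, s)" "\<lambda>(j, s). (s, j - s)"]) auto
    also have "\<dots> = (\<Sum>s=1..n. \<Sum>t\<le>n - s. p s * min 1 (real n * B t))"
      by (simp add: sum.Sigma)
    also have "\<dots> \<le> (\<Sum>s=1..n. \<Sum>t\<le>n. p s * min 1 (real n * B t))"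
      using B0 p_range by (intro sum_mono sum_mono2) (auto intro!: mult_nonneg_nonneg less_imp_le[OF p_range[THEN conjunct1]])
    also have "\<dots> = (\<Sum>s=1..n. p s) * (\<Sum>t\<le>n. min 1 (real n * B t))"
      by (simp add: sum_product)
    also have "\<dots> \<le> (A * real n powr (1 - 3 * \<beta> / 4)) * ((1 + D powr \<theta> * Z2) * real n powr (\<beta> / 2))"
      using A across[OF n] B0 by (intro mult_mono) (auto intro!: sum_nonneg)
    also have "\<dots> = A * (1 + D powr \<theta> * Z2) * real n powr (1 - \<beta> / 4)"
      by (simp flip: powr_add)
    finally have II: "(\<Sum>j\<le>n. \<Sum>s=1..j. p s * min 1 (real s * B (j - s))) \<le> A * (1 + D powr \<theta> * Z2) * real n powr (1 - \<beta> / 4)" .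
    have "(\<Sum>j\<le>n. \<Sum>i | i + m < j. B (j - i)) \<le> (\<Sum>j\<le>n. D * Z1 * real n powr (- (\<beta> / 4)))"
      using within[OF n m_def] by (intro sum_mono) auto
    also have "\<dots> \<le> 2 * real n * (D * Z1 * real n powr (- (\<beta> / 4)))"
      using n D(1) Z by (simp only: sum_constant) (intro mult_right_mono, auto)
    finally have I: "(\<Sum>j\<le>n. \<Sum>i | i + m < j. B (j - i)) \<le> 2 * real n * (D * Z1 * real n powr (- (\<beta> / 4)))" .
    have "expectation (late_revisit_count n m) \<le> (\<Sum>j\<le>n. (\<Sum>i | i + m < j. B (j - i)) + (\<Sum>s=1..j. p s * min 1 (real s * B (j - s))))"
      by (rule late_revisit_count_expectation(2)[OF B])
    also have "\<dots> \<le> 2 * real n * (D * Z1 * real n powr (- (\<beta> / 4))) + A * (1 + D powr \<theta> * Z2) * real n powr (1 - \<beta> / 4)"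
      unfolding sum.distrib using I II by (rule add_mono)
    also have "real n powr (1 - \<beta> / 4) = real n * real n powr (- (\<beta> / 4))"
      using n powr_add[of "real n" 1 "- (\<beta> / 4)"] by simp
    finally have "expectation (late_revisit_count n m) \<le> real n * (K * real n powr (- (\<beta> / 4)))"
      by (simp add: K_def algebra_simps)
    then show ?thesis using n by (simp add: m_def[symmetric] field_simps)
  qed
  then show thesis by (rule that)
qed

text \<open>
  Along \<open>n = k\<^bsup>rate\<^esup>\<close> an error of order \<open>n\<^bsup>-\<beta>/4\<^esup>\<close> is at most of order \<open>k\<^bsup>-2\<^esup>\<close>.
\<close>

definition rate :: nat where "rate = nat \<lceil>8 / \<beta>\<rceil>"

lemma rate_pos: "rate > 0"
  using \<beta> by (simp add: rate_def)

lemma summable_along_rate: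
  assumes "\<And>n. n \<ge> 1 \<Longrightarrow> e n \<le> A * real n powr (- (\<beta> / 4))" "\<And>n. 0 \<le> e n"
  shows "summable (\<lambda>k. e (Suc k ^ rate))"
proof (rule summable_comparison_test)
  show "\<exists>K. \<forall>k\<ge>K. norm (e (Suc k ^ rate)) \<le> \<bar>A\<bar> * real (Suc k) powr (- 2)"
  proof (intro exI allI impI)
    fix k :: nat
    have "e (Suc k ^ rate) \<le> A * real (Suc k ^ rate) powr (- (\<beta> / 4))" by (rule assms(1)) simp
    also have "\<dots> \<le> \<bar>A\<bar> * real (Suc k ^ rate) powr (- (\<beta> / 4))" by (intro mult_right_mono) auto
    also have "real (Suc k ^ rate) powr (- (\<beta> / 4)) = real (Suc k) powr (real rate * - (\<beta> / 4))"
      by (simp add: powr_powr flip: powr_realpow)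
    also have "\<dots> \<le> real (Suc k) powr (- 2)"
    proof (rule powr_mono)
      have "8 / \<beta> \<le> real rate" unfolding rate_def by linarith
      then show "real rate * - (\<beta> / 4) \<le> - 2" using \<beta> by (simp add: field_simps)
    qed simp
    finally show "norm (e (Suc k ^ rate)) \<le> \<bar>A\<bar> * real (Suc k) powr (- 2)"
      using assms(2) by (simp add: mult_left_mono)
  qed
  have "summable (\<lambda>k. real k powr (- 2))" by (simp add: summable_real_powr_iff)
  then have "summable (\<lambda>k. real (Suc k) powr (- 2))" by (subst summable_Suc_iff)
  then show "summable (\<lambda>k. \<bar>A\<bar> * real (Suc k) powr (- 2))" by (rule summable_mult)
qed

lemma main_part_tendsto:
  assumes "(\<lambda>k. fluctuation (Suc k ^ rate) \<omega>) \<longlonglongrightarrow> 0"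
  shows "(\<lambda>k. escape_count (Suc k ^ rate) (window (Suc k ^ rate)) \<omega> / real (Suc k ^ rate)) \<longlonglongrightarrow> escape_prob M \<xi>"
proof -
  have "(\<lambda>k. sqrt (fluctuation (Suc k ^ rate) \<omega>)) \<longlonglongrightarrow> sqrt 0"
    using assms by (rule tendsto_real_sqrt)
  then have "(\<lambda>k. \<bar>(escape_count (Suc k ^ rate) (window (Suc k ^ rate)) \<omega> - real (Suc k ^ rate) * no_return_prob (window (Suc k ^ rate))) / real (Suc k ^ rate)\<bar>) \<longlonglongrightarrow> 0"
    unfolding fluctuation_def real_sqrt_abs real_sqrt_zero .
  then have "(\<lambda>k. (escape_count (Suc k ^ rate) (window (Suc k ^ rate)) \<omega> - real (Suc k ^ rate) * no_return_prob (window (Suc k ^ rate))) / real (Suc k ^ rate)) \<longlonglongrightarrow> 0"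
    by (rule tendsto_rabs_zero_cancel)
  moreover have "(\<lambda>k. no_return_prob (window (Suc k ^ rate))) \<longlonglongrightarrow> escape_prob M \<xi>"
  proof -
    have "filterlim (\<lambda>k. Suc k ^ rate) at_top sequentially"
      by (rule filterlim_at_top_mono[OF filterlim_Suc]) (use rate_pos in \<open>auto intro!: always_eventually self_le_power\<close>)
    then show ?thesis
      by (rule filterlim_compose[OF filterlim_compose[OF no_return_prob_tendsto window_at_top]])
  qed
  ultimately have "(\<lambda>k. (escape_count (Suc k ^ rate) (window (Suc k ^ rate)) \<omega> - real (Suc k ^ rate) * no_return_prob (window (Suc k ^ rate))) / real (Suc k ^ rate)
     + no_return_prob (window (Suc k ^ rate))) \<longlonglongrightarrow> 0 + escape_prob M \<xi>"
    by (rule tendsto_add)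
  then show ?thesis by (simp add: diff_divide_distrib)
qed

text \<open>
  In the plane the escape probability vanishes and only the upper bound is needed; otherwise the
  count of windows without return squeezes the range from both sides.
\<close>

theorem range_tendsto:
  assumes d: "CARD('d) = 2 \<or> real CARD('d) > 2 + 4 / \<beta>"
  shows "AE \<omega> in M. (\<lambda>n. real (card (walk_range (erw p \<xi> \<gamma> U) n \<omega>)) / real n) \<longlonglongrightarrow> escape_prob M \<xi>"
proof -
  define R where "R n \<omega> = real (card (walk_range (erw p \<xi> \<gamma> U) n \<omega>))" for n \<omega>
  define \<nu> where "\<nu> k = Suc k ^ rate" for k
  have \<nu>: "\<nu> k \<ge> 1" for k by (simp add: \<nu>_def)
  have F: "AE \<omega> in M. (\<lambda>k. fluctuation (\<nu> k) \<omega>) \<longlonglongrightarrow> 0"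
    unfolding \<nu>_def
    by (rule AE_tendsto_0_of_summable_expectation[OF fluctuation_expectation(1) _ summable_along_rate[where e = "\<lambda>n. expectation (fluctuation n)", OF fluctuation_expectation(2)]])
       (auto simp: fluctuation_def)
  have E: "AE \<omega> in M. (\<lambda>k. window_error (\<nu> k) \<omega>) \<longlonglongrightarrow> 0"
  proof -
    obtain A where A: "\<And>n. integrable M (window_error n)" "\<And>n. n \<ge> 1 \<Longrightarrow> expectation (window_error n) \<le> A * real n powr (- (\<beta> / 4))"
      using window_error_expectation by blast
    have pos: "0 \<le> window_error n \<omega>" for n \<omega> by (simp add: window_error_def clock_count_def)
    show ?thesis
      unfolding \<nu>_def
      by (rule AE_tendsto_0_of_summable_expectation[OF A(1) _ summable_along_rate[where e = "\<lambda>n. expectation (window_error n)", OF A(2)]])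
         (auto simp: pos)
  qed
  have subseq: "AE \<omega> in M. (\<lambda>k. R (\<nu> k) \<omega> / real (\<nu> k)) \<longlonglongrightarrow> escape_prob M \<xi>"
  proof (cases "CARD('d) = 2")
    case True
    from F E show ?thesis
    proof eventually_elim
      case (elim \<omega>)
      have "(\<lambda>k. escape_count (\<nu> k) (window (\<nu> k)) \<omega> / real (\<nu> k) + window_error (\<nu> k) \<omega>) \<longlonglongrightarrow> escape_prob M \<xi> + 0"
        unfolding \<nu>_def using elim by (intro tendsto_add main_part_tendsto) (auto simp: \<nu>_def)
      then have up: "(\<lambda>k. escape_count (\<nu> k) (window (\<nu> k)) \<omega> / real (\<nu> k) + window_error (\<nu> k) \<omega>) \<longlonglongrightarrow> 0"
        by (simp add: escape_prob_planar[OF True])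
      have "R n \<omega> / real n \<le> escape_count n (window n) \<omega> / real n + window_error n \<omega>" for n
        using range_le[of n \<omega> "window n"] unfolding R_def window_error_def by (simp add: divide_right_mono flip: add_divide_distrib)
      then have "(\<lambda>k. R (\<nu> k) \<omega> / real (\<nu> k)) \<longlonglongrightarrow> 0"
        by (intro tendsto_sandwich[OF _ _ tendsto_const up] always_eventually) (auto simp: R_def)
      then show ?case by (simp add: escape_prob_planar[OF True])
    qed
  next
    case False
    obtain A where A: "\<And>n. n \<ge> 1 \<Longrightarrow> expectation (\<lambda>\<omega>. late_revisit_count n (window n) \<omega> / real n) \<le> A * real n powr (- (\<beta> / 4))"
      using revisit_expectation d False by blast
    have int: "integrable M (\<lambda>\<omega>. late_revisit_count n m \<omega> / real n)" for n m
      by (intro integrable_divide late_revisit_count_expectation(1)[of "\<lambda>_. 1"]) (metis block_law prob_le_1)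
    have "AE \<omega> in M. (\<lambda>k. late_revisit_count (\<nu> k) (window (\<nu> k)) \<omega> / real (\<nu> k)) \<longlonglongrightarrow> 0"
      unfolding \<nu>_def
      by (rule AE_tendsto_0_of_summable_expectation[OF int _ summable_along_rate[where e = "\<lambda>n. expectation (\<lambda>\<omega>. late_revisit_count n (window n) \<omega> / real n)", OF A]])
         (auto simp: late_revisit_count_def)
    with F E show ?thesis
    proof eventually_elim
      case (elim \<omega>)
      have main: "(\<lambda>k. escape_count (\<nu> k) (window (\<nu> k)) \<omega> / real (\<nu> k)) \<longlonglongrightarrow> escape_prob M \<xi>"
        unfolding \<nu>_def using elim by (intro main_part_tendsto) (auto simp: \<nu>_def)
      have up: "(\<lambda>k. escape_count (\<nu> k) (window (\<nu> k)) \<omega> / real (\<nu> k) + window_error (\<nu> k) \<omega>) \<longlonglongrightarrow> escape_prob M \<xi> + 0"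
        by (intro tendsto_add main elim)
      have low: "(\<lambda>k. escape_count (\<nu> k) (window (\<nu> k)) \<omega> / real (\<nu> k) - window_error (\<nu> k) \<omega> - late_revisit_count (\<nu> k) (window (\<nu> k)) \<omega> / real (\<nu> k)) \<longlonglongrightarrow> escape_prob M \<xi> - 0 - 0"
        by (intro tendsto_diff main elim)
      have "R n \<omega> / real n \<le> escape_count n (window n) \<omega> / real n + window_error n \<omega>" for n
        using range_le[of n \<omega> "window n"] unfolding R_def window_error_def by (simp add: divide_right_mono flip: add_divide_distrib)
      moreover have "escape_count n (window n) \<omega> / real n - window_error n \<omega> - late_revisit_count n (window n) \<omega> / real n \<le> R n \<omega> / real n" for n
        using le_range[of n "window n" \<omega>] unfolding R_def window_error_def by (simp add: divide_right_mono flip: diff_divide_distrib)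
      ultimately show ?case
        using up low by (intro tendsto_sandwich[OF _ _ low[simplified] up[simplified]] always_eventually) auto
    qed
  qed
  then show ?thesis
  proof eventually_elim
    case (elim \<omega>)
    have "(\<lambda>n. R n \<omega> / real n) \<longlonglongrightarrow> escape_prob M \<xi>"
    proof (rule tendsto_of_power_subsequence[OF _ _ rate_pos])
      show "mono (\<lambda>n. R n \<omega>)"
        unfolding R_def walk_range_def by (intro monoI of_nat_mono card_mono image_mono) auto
      show "0 \<le> R n \<omega>" for n by (simp add: R_def)
      show "(\<lambda>k. R (k ^ rate) \<omega> / real (k ^ rate)) \<longlonglongrightarrow> escape_prob M \<xi>"
        by (rule LIMSEQ_imp_Suc) (use elim in \<open>simp add: \<nu>_def\<close>)
    qed
    then show ?case by (simp only: R_def)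
  qed
qed

end

theorem theorem2p1:
  fixes M :: "'a measure" and F :: "nat \<Rightarrow> 'a measure"
    and l :: "real ^ 'd" and p :: "nat \<Rightarrow> real"
    and \<xi> \<gamma> :: "nat \<Rightarrow> 'a \<Rightarrow> int ^ 'd" and U :: "nat \<Rightarrow> 'a \<Rightarrow> real"
    and C \<beta> :: real
  assumes "C > 0"
    and "0 < \<beta>" and "\<beta> \<le> 1"
    and "CARD('d) \<ge> 2"
    and "CARD('d) = 2 \<or> int CARD('d) \<ge> h \<beta>"
    and "\<And>n. n \<ge> 1 \<Longrightarrow> p n = min (C * real n powr (- \<beta>)) 1"
    and "pn_ERW M F l p \<xi> \<gamma> U"
  shows "AE \<omega> in M.
           (\<lambda>n. real (card (walk_range (erw p \<xi> \<gamma> U) n \<omega>)) / real n) \<longlonglongrightarrow> escape_prob M \<xi>"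
proof -
  interpret pn_ERW M F l p \<xi> \<gamma> U by fact
  interpret polynomial_pn_ERW M F l p \<xi> \<gamma> U C \<beta> by unfold_locales fact+
  have "real CARD('d) > 2 + 4 / \<beta>" if "int CARD('d) \<ge> h \<beta>"
    using that by (auto simp: h_def) linarith
  then show ?thesis using assms(5) by (intro range_tendsto) blast
qed

end
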